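(* Let $(M,J)$ be a connected complex manifold of real dimension $2n\ge 4$, and assume that two nonproportional Kähler-Einstein metrics (of arbitrary signature) on $(M,J)$ are c-projectively equivalent. Then any Kähler metric on $(M,J)$ that is c-projectively equivalent to them is also Einstein.
   Context: All manifolds, metrics and tensor fields are smooth. A pseudo-Riemannian metric $g$ (of arbitrary signature) on a complex manifold $(M,J)$ is Kähler (with respect to $J$) if $g(J\cdot,J\cdot)=g$ and $\nabla J=0$, where $\nabla$ is the Levi-Civita connection of $g$. It is Einstein if $\mathrm{Ric}(g)=\tfrac{\mathrm{Scal}(g)}{2n}g$ with $\mathrm{Scal}(g)$ constant; Kähler-Einstein means Kähler and Einstein. Two metrics are proportional if one is a constant multiple of the other. A regular curve $\gamma$ is $J$-planar for $(g,J)$ if $(\nabla_{\dot\gamma}\dot\gamma)\wedge\dot\gamma\wedge J\dot\gamma=0$ at each point of the curve. Two metrics on $(M,J)$ that are Kähler with respect to $J$ are c-projectively equivalent if their $J$-planar curves coincide. *)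

theory Defs
  imports "HOL-Analysis.Analysis"
begin

section \<open>Smooth maps on open subsets of normed spaces\<close>

primrec ck_on :: "nat \<Rightarrow> 'a::real_normed_vector set \<Rightarrow> ('a \<Rightarrow> 'b::real_normed_vector) \<Rightarrow> bool" where
  "ck_on 0 S f \<longleftrightarrow> continuous_on S f"
| "ck_on (Suc k) S f \<longleftrightarrow>
     (\<forall>x\<in>S. f differentiable (at x)) \<and>
     (\<forall>v. ck_on k S (\<lambda>x. frechet_derivative f (at x) v))"

text \<open>Only used with \<open>S\<close> open and with a finite-dimensional domain, where this is the usual notion.\<close>

definition smooth_on :: "'a::real_normed_vector set \<Rightarrow> ('a \<Rightarrow> 'b::real_normed_vector) \<Rightarrow> bool" where
  "smooth_on S f \<longleftrightarrow> (\<forall>k. ck_on k S f)"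


section \<open>Manifolds\<close>

text \<open>A chart is a pair of its domain and its coordinate map; the values of the coordinate map
  outside the domain are irrelevant.\<close>

type_synonym ('p, 'e) chart = "'p set \<times> ('p \<Rightarrow> 'e)"

definition chart_image :: "('p, 'e) chart \<Rightarrow> 'e set" where
  "chart_image c = snd c ` fst c"

definition chart_overlap :: "('p, 'e) chart \<Rightarrow> ('p, 'e) chart \<Rightarrow> 'e set" where
  "chart_overlap c d = snd c ` (fst c \<inter> fst d)"

definition transition :: "('p, 'e) chart \<Rightarrow> ('p, 'e) chart \<Rightarrow> 'e \<Rightarrow> 'e" where
  "transition c d = snd d \<circ> inv_into (fst c) (snd c)"

definition dtransition ::
    "('p, 'e::euclidean_space) chart \<Rightarrow> ('p, 'e) chart \<Rightarrow> 'e \<Rightarrow> 'e \<Rightarrow> 'e" where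
  "dtransition c d x = frechet_derivative (transition c d) (at x)"

definition smooth_manifold :: "'p topology \<Rightarrow> ('p, 'e::euclidean_space) chart set \<Rightarrow> bool" where
  "smooth_manifold X A \<longleftrightarrow>
     Hausdorff_space X \<and> second_countable X \<and>
     (\<Union>c\<in>A. fst c) = topspace X \<and>
     (\<forall>c\<in>A. openin X (fst c) \<and> open (chart_image c) \<and>
        homeomorphic_map (subtopology X (fst c)) (top_of_set (chart_image c)) (snd c)) \<and>
     (\<forall>c\<in>A. \<forall>d\<in>A. smooth_on (chart_overlap c d) (transition c d))"

text \<open>Fields on a manifold are given by their components in every chart of the atlas: at the
  coordinate point \<open>x\<close> of the chart \<open>c\<close>, tangent vectors are identified with vectors of the model
  space. Components are only meaningful for charts \<open>c\<close> of the atlas and \<open>x \<in> chart_image c\<close>.\<close>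

type_synonym ('p, 'e) bilinear_field = "('p, 'e) chart \<Rightarrow> 'e \<Rightarrow> 'e \<Rightarrow> 'e \<Rightarrow> real"
type_synonym ('p, 'e) endo_field = "('p, 'e) chart \<Rightarrow> 'e \<Rightarrow> 'e \<Rightarrow> 'e"

text \<open>The complex structure is multiplication by the imaginary unit in complex charts.\<close>

definition complex_structure :: "('p, complex ^ 'n) endo_field" where
  "complex_structure c x v = \<i> *s v"

text \<open>A smooth map between open sets of complex coordinate space is holomorphic iff its
  differential commutes with multiplication by the imaginary unit.\<close>

definition complex_manifold :: "'p topology \<Rightarrow> ('p, complex ^ 'n) chart set \<Rightarrow> bool" where
  "complex_manifold X A \<longleftrightarrow>
     smooth_manifold X A \<and>
     (\<forall>c\<in>A. \<forall>d\<in>A. \<forall>x\<in>chart_overlap c d. \<forall>v.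
        dtransition c d x (complex_structure c x v)
          = complex_structure d (transition c d x) (dtransition c d x v))"


section \<open>Pseudo-Riemannian metrics and the Levi-Civita connection\<close>

definition pseudo_riemannian ::
    "('p, 'e::euclidean_space) chart set \<Rightarrow> ('p, 'e) bilinear_field \<Rightarrow> bool" where
  "pseudo_riemannian A g \<longleftrightarrow>
     (\<forall>c\<in>A. \<forall>v w. smooth_on (chart_image c) (\<lambda>x. g c x v w)) \<and>
     (\<forall>c\<in>A. \<forall>x\<in>chart_image c.
        bilinear (g c x) \<and>
        (\<forall>v w. g c x v w = g c x w v) \<and>
        (\<forall>v. (\<forall>w. g c x v w = 0) \<longrightarrow> v = 0)) \<and>
     (\<forall>c\<in>A. \<forall>d\<in>A. \<forall>x\<in>chart_overlap c d. \<forall>v w.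
        g c x v w = g d (transition c d x) (dtransition c d x v) (dtransition c d x w))"

text \<open>\<open>G\<close> is the Christoffel map at \<open>x\<close> of a torsion-free connection
  \<open>\<nabla>\<^sub>v W = D\<^sub>v W + G v W\<close> with \<open>\<nabla>g = 0\<close> at \<open>x\<close>.\<close>

definition levi_civita_at ::
    "('p, 'e::euclidean_space) bilinear_field \<Rightarrow> ('p, 'e) chart \<Rightarrow> 'e \<Rightarrow> ('e \<Rightarrow> 'e \<Rightarrow> 'e) \<Rightarrow> bool" where
  "levi_civita_at g c x G \<longleftrightarrow>
     bilinear G \<and>
     (\<forall>v w. G v w = G w v) \<and>
     (\<forall>z v w. frechet_derivative (\<lambda>y. g c y v w) (at x) z
                = g c x (G z v) w + g c x v (G z w))"

definition christoffel ::
    "('p, 'e::euclidean_space) bilinear_field \<Rightarrow> ('p, 'e) chart \<Rightarrow> 'e \<Rightarrow> 'e \<Rightarrow> 'e \<Rightarrow> 'e" where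
  "christoffel g c x = (THE G. levi_civita_at g c x G)"

text \<open>\<open>(\<nabla>\<^sub>v T) w\<close>.\<close>

definition nabla_endo ::
    "('p, 'e::euclidean_space) bilinear_field \<Rightarrow> ('p, 'e) endo_field \<Rightarrow> ('p, 'e) chart
       \<Rightarrow> 'e \<Rightarrow> 'e \<Rightarrow> 'e \<Rightarrow> 'e" where
  "nabla_endo g T c x v w =
     frechet_derivative (\<lambda>y. T c y w) (at x) v
       + christoffel g c x v (T c x w) - T c x (christoffel g c x v w)"

definition kaehler ::
    "('p, 'e::euclidean_space) chart set \<Rightarrow> ('p, 'e) endo_field \<Rightarrow> ('p, 'e) bilinear_field \<Rightarrow> bool" where
  "kaehler A J g \<longleftrightarrow>
     pseudo_riemannian A g \<and>
     (\<forall>c\<in>A. \<forall>x\<in>chart_image c. \<forall>v w. g c x (J c x v) (J c x w) = g c x v w) \<and>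
     (\<forall>c\<in>A. \<forall>x\<in>chart_image c. \<forall>v w. nabla_endo g J c x v w = 0)"


section \<open>Curvature\<close>

text \<open>\<open>R(u, v) w = \<nabla>\<^sub>u \<nabla>\<^sub>v w - \<nabla>\<^sub>v \<nabla>\<^sub>u w\<close> for constant coordinate vector fields.\<close>

definition riemann ::
    "('p, 'e::euclidean_space) bilinear_field \<Rightarrow> ('p, 'e) chart \<Rightarrow> 'e \<Rightarrow> 'e \<Rightarrow> 'e \<Rightarrow> 'e \<Rightarrow> 'e" where
  "riemann g c x u v w =
     frechet_derivative (\<lambda>y. christoffel g c y v w) (at x) u
       - frechet_derivative (\<lambda>y. christoffel g c y u w) (at x) v
       + christoffel g c x u (christoffel g c x v w)
       - christoffel g c x v (christoffel g c x u w)"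

definition endo_trace :: "('e::euclidean_space \<Rightarrow> 'e) \<Rightarrow> real" where
  "endo_trace T = (\<Sum>b\<in>Basis. T b \<bullet> b)"

definition ricci :: "('p, 'e::euclidean_space) bilinear_field \<Rightarrow> ('p, 'e) bilinear_field" where
  "ricci g c x v w = endo_trace (\<lambda>u. riemann g c x u v w)"

text \<open>The vector metrically dual to a linear functional.\<close>

definition sharp ::
    "('p, 'e::euclidean_space) bilinear_field \<Rightarrow> ('p, 'e) chart \<Rightarrow> 'e \<Rightarrow> ('e \<Rightarrow> real) \<Rightarrow> 'e" where
  "sharp g c x \<alpha> = (THE u. \<forall>w. g c x u w = \<alpha> w)"

definition scal :: "('p, 'e::euclidean_space) bilinear_field \<Rightarrow> ('p, 'e) chart \<Rightarrow> 'e \<Rightarrow> real" where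
  "scal g c x = endo_trace (\<lambda>v. sharp g c x (ricci g c x v))"

definition einstein ::
    "('p, 'e::euclidean_space) chart set \<Rightarrow> ('p, 'e) bilinear_field \<Rightarrow> bool" where
  "einstein A g \<longleftrightarrow>
     (\<exists>s. \<forall>c\<in>A. \<forall>x\<in>chart_image c. scal g c x = s) \<and>
     (\<forall>c\<in>A. \<forall>x\<in>chart_image c. \<forall>v w.
        ricci g c x v w = scal g c x / real DIM('e) * g c x v w)"

definition kaehler_einstein ::
    "('p, 'e::euclidean_space) chart set \<Rightarrow> ('p, 'e) endo_field \<Rightarrow> ('p, 'e) bilinear_field \<Rightarrow> bool" where
  "kaehler_einstein A J g \<longleftrightarrow> kaehler A J g \<and> einstein A g"

definition proportional ::
    "('p, 'e) chart set \<Rightarrow> ('p, 'e) bilinear_field \<Rightarrow> ('p, 'e) bilinear_field \<Rightarrow> bool" where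
  "proportional A g h \<longleftrightarrow>
     (\<exists>k. \<forall>c\<in>A. \<forall>x\<in>chart_image c. \<forall>v w. h c x v w = k * g c x v w)"


section \<open>Curves and c-projective equivalence\<close>

text \<open>The trivector \<open>u \<and> v \<and> w\<close>, as an alternating form on covectors.\<close>

definition wedge3 ::
    "'e::real_normed_vector \<Rightarrow> 'e \<Rightarrow> 'e \<Rightarrow> ('e \<Rightarrow>\<^sub>L real) \<Rightarrow> ('e \<Rightarrow>\<^sub>L real) \<Rightarrow> ('e \<Rightarrow>\<^sub>L real) \<Rightarrow> real" where
  "wedge3 u v w = (\<lambda>\<alpha> \<beta> \<gamma>.
       blinfun_apply \<alpha> u * (blinfun_apply \<beta> v * blinfun_apply \<gamma> w - blinfun_apply \<gamma> v * blinfun_apply \<beta> w)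
     - blinfun_apply \<beta> u * (blinfun_apply \<alpha> v * blinfun_apply \<gamma> w - blinfun_apply \<gamma> v * blinfun_apply \<alpha> w)
     + blinfun_apply \<gamma> u * (blinfun_apply \<alpha> v * blinfun_apply \<beta> w - blinfun_apply \<beta> v * blinfun_apply \<alpha> w))"

definition velocity ::
    "('p, 'e::euclidean_space) chart \<Rightarrow> (real \<Rightarrow> 'p) \<Rightarrow> real \<Rightarrow> 'e" where
  "velocity c \<gamma> t = vector_derivative (snd c \<circ> \<gamma>) (at t)"

definition regular_curve ::
    "'p topology \<Rightarrow> ('p, 'e::euclidean_space) chart set \<Rightarrow> real set \<Rightarrow> (real \<Rightarrow> 'p) \<Rightarrow> bool" where
  "regular_curve X A I \<gamma> \<longleftrightarrow>
     open I \<and> is_interval I \<and>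
     continuous_map (top_of_set I) X \<gamma> \<and>
     (\<forall>c\<in>A. smooth_on {t \<in> I. \<gamma> t \<in> fst c} (snd c \<circ> \<gamma>)) \<and>
     (\<forall>c\<in>A. \<forall>t\<in>I. \<gamma> t \<in> fst c \<longrightarrow> velocity c \<gamma> t \<noteq> 0)"

text \<open>The covariant derivative of the velocity along the curve.\<close>

definition acceleration ::
    "('p, 'e::euclidean_space) bilinear_field \<Rightarrow> ('p, 'e) chart \<Rightarrow> (real \<Rightarrow> 'p) \<Rightarrow> real \<Rightarrow> 'e" where
  "acceleration g c \<gamma> t =
     vector_derivative (velocity c \<gamma>) (at t)
       + christoffel g c (snd c (\<gamma> t)) (velocity c \<gamma> t) (velocity c \<gamma> t)"

definition J_planar ::
    "'p topology \<Rightarrow> ('p, 'e::euclidean_space) chart set \<Rightarrow> ('p, 'e) endo_field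
       \<Rightarrow> ('p, 'e) bilinear_field \<Rightarrow> real set \<Rightarrow> (real \<Rightarrow> 'p) \<Rightarrow> bool" where
  "J_planar X A J g I \<gamma> \<longleftrightarrow>
     regular_curve X A I \<gamma> \<and>
     (\<forall>c\<in>A. \<forall>t\<in>I. \<gamma> t \<in> fst c \<longrightarrow>
        wedge3 (acceleration g c \<gamma> t) (velocity c \<gamma> t) (J c (snd c (\<gamma> t)) (velocity c \<gamma> t))
          = (\<lambda>_ _ _. 0))"

definition c_projectively_equivalent ::
    "'p topology \<Rightarrow> ('p, 'e::euclidean_space) chart set \<Rightarrow> ('p, 'e) endo_field
       \<Rightarrow> ('p, 'e) bilinear_field \<Rightarrow> ('p, 'e) bilinear_field \<Rightarrow> bool" where
  "c_projectively_equivalent X A J g h \<longleftrightarrow>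
     (\<forall>I \<gamma>. J_planar X A J g I \<gamma> \<longleftrightarrow> J_planar X A J h I \<gamma>)"


section \<open>Well-definedness\<close>

lemma dual_vector_unique:
  fixes B :: "'e::euclidean_space \<Rightarrow> 'e \<Rightarrow> real"
  assumes B: "bilinear B" and nd: "\<And>v. (\<And>w. B v w = 0) \<Longrightarrow> v = 0" and \<alpha>: "linear \<alpha>"
  shows "\<exists>!u. \<forall>w. B u w = \<alpha> w"
proof -
  have lin: "linear (B v)" "linear (\<lambda>v. B v w)" for v w
    using B by (auto simp: bilinear_def)
  define L where "L u = (\<Sum>b\<in>Basis. B u b *\<^sub>R b)" for u
  have Lb: "L u \<bullet> b = B u b" if "b \<in> Basis" for u b
    using that by (simp add: L_def)
  have linL: "linear L"
    by (rule linearI)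
       (simp_all add: L_def linear_add[OF lin(2)] linear_scale[OF lin(2)] scaleR_add_left
          sum.distrib scaleR_sum_right)
  have ext: "B u = \<beta>" if "\<And>b. b \<in> Basis \<Longrightarrow> B u b = \<beta> b" "linear \<beta>" for u \<beta>
    by (rule linear_eq_stdbasis[OF lin(1) that(2) that(1)])
  have "inj L"
    unfolding linear_injective_0[OF linL]
  proof (intro allI impI)
    fix u assume u: "L u = 0"
    have "B u = (\<lambda>_. 0)"
    proof (rule ext)
      show "B u b = 0" if "b \<in> Basis" for b
        using Lb[OF that, of u] by (simp add: u)
    qed (rule linear_zero)
    then show "u = 0" by (intro nd) simp
  qed
  then have "surj L" by (rule linear_inj_imp_surj[OF linL])
  then obtain u where u: "L u = (\<Sum>b\<in>Basis. \<alpha> b *\<^sub>R b)" by (metis surjD)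
  have "B u = \<alpha>"
  proof (rule ext[OF _ \<alpha>])
    show "B u b = \<alpha> b" if "b \<in> Basis" for b
      using Lb[OF that, of u] that by (simp add: u)
  qed
  moreover have "u' = u" if "\<forall>w. B u' w = \<alpha> w" for u'
  proof -
    have "u' - u = 0"
      using that \<open>B u = \<alpha>\<close> by (intro nd) (simp add: linear_diff[OF lin(2)])
    then show ?thesis by simp
  qed
  ultimately show ?thesis by blast
qed

lemma levi_civita_unique:
  assumes g: "pseudo_riemannian A g" and c: "c \<in> A" and x: "x \<in> chart_image c"
    and op: "open (chart_image c)"
  shows "\<exists>!G. levi_civita_at g c x G"
proof -
  have bil: "bilinear (g c y)" if "y \<in> chart_image c" for y
    using g c that by (auto simp: pseudo_riemannian_def)
  have lin: "linear (g c y v)" "linear (\<lambda>v. g c y v w)" if "y \<in> chart_image c" for y v w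
    using bil[OF that] by (auto simp: bilinear_def)
  have sym: "g c y v w = g c y w v" if "y \<in> chart_image c" for y v w
    using g c that by (auto simp: pseudo_riemannian_def)
  have nd: "v = 0" if "\<And>w. g c x v w = 0" for v
    using g c x that by (auto simp: pseudo_riemannian_def)
  define D where "D z v w = frechet_derivative (\<lambda>y. g c y v w) (at x) z" for z v w
  have "smooth_on (chart_image c) (\<lambda>y. g c y v w)" for v w
    using g c by (auto simp: pseudo_riemannian_def)
  then have "ck_on (Suc 0) (chart_image c) (\<lambda>y. g c y v w)" for v w
    by (simp only: smooth_on_def)
  then have "(\<lambda>y. g c y v w) differentiable (at x)" for v w
    using x by simp
  then have hd: "((\<lambda>y. g c y v w) has_derivative (\<lambda>z. D z v w)) (at x)" for v w
    unfolding D_def by (simp add: frechet_derivative_works[symmetric])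
  have linD: "linear (\<lambda>z. D z v w)" for v w
    using hd has_derivative_linear by blast
  have eqD: "D z v w = E z"
    if "(f has_derivative E) (at x)" "\<And>y. y \<in> chart_image c \<Longrightarrow> f y = g c y v w" for z v w f E
    using has_derivative_unique[OF hd has_derivative_transform_within_open[OF that(1) op x that(2)]]
    by metis
  have symD: "D z v w = D z w v" for z v w
    by (rule eqD[OF hd]) (rule sym)
  have addD: "D z v (w + w') = D z v w + D z v w'" for z v w w'
    by (rule eqD[OF has_derivative_add[OF hd hd]]) (simp add: linear_add[OF lin(1)])
  have scaleD: "D z v (k *\<^sub>R w) = k * D z v w" for z v w k
    by (rule eqD[OF has_derivative_mult_right[OF hd]]) (simp add: linear_scale[OF lin(1)])
  have addD': "D z (v + v') w = D z v w + D z v' w" for z v v' w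
    using addD symD by metis
  have scaleD': "D z (k *\<^sub>R v) w = k * D z v w" for z v w k
    using scaleD symD by metis
  define K where "K v w z = (D v w z + D w v z - D z v w) / 2" for v w z
  have "linear (K v w)" for v w
    by (rule linearI)
       (simp_all add: K_def addD scaleD linear_add[OF linD] linear_scale[OF linD] field_simps)
  then have "\<exists>!u. \<forall>z. g c x u z = K v w z" for v w
    using dual_vector_unique[OF bil[OF x] nd] by blast
  then obtain G where G: "\<And>v w z. g c x (G v w) z = K v w z" by metis
  have eqI: "u = u'" if "\<And>z. g c x u z = g c x u' z" for u u'
    using nd[of "u - u'"] that by (simp add: linear_diff[OF lin(2)[OF x]])
  have "levi_civita_at g c x G"
    unfolding levi_civita_at_def bilinear_def
  proof (intro conjI allI)
    show "linear (G v)" for v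
      by (rule linearI; rule eqI)
         (simp_all add: G linear_add[OF lin(2)[OF x]] linear_scale[OF lin(2)[OF x]] K_def
            addD scaleD addD' scaleD' linear_add[OF linD] linear_scale[OF linD] field_simps)
    show sG: "G v w = G w v" for v w
      by (rule eqI) (simp add: G K_def symD[of _ v w])
    show "linear (\<lambda>v. G v w)" for w
      unfolding sG[of _ w] by fact
    show "frechet_derivative (\<lambda>y. g c y v w) (at x) z = g c x (G z v) w + g c x v (G z w)" for z v w
      unfolding D_def[symmetric] sym[OF x, of v] G K_def
      using symD[of z v w] symD[of v w z] symD[of w v z] by (simp add: field_simps)
  qed
  moreover have "H = G" if H: "levi_civita_at g c x H" for H
  proof (intro ext eqI)
    fix v w z
    have sH: "H a b = H b a" for a b
      using H by (auto simp: levi_civita_at_def)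
    have m: "D a b d = g c x (H a b) d + g c x (H a d) b" for a b d
      using H by (simp add: levi_civita_at_def D_def sym[OF x])
    show "g c x (H v w) z = g c x (G v w) z"
      unfolding G K_def m sH[of w v] sH[of z v] sH[of z w] by simp
  qed
  ultimately show ?thesis by blast
qed

end

theory Submission
  imports Defs
begin

text \<open>In a complex chart the Christoffel map \<open>G\<close> of a Kaehler metric is complex bilinear, and its
  curvature is the antiholomorphic derivative \<open>C(u; v, w)\<close> of \<open>G(v, w)\<close> in the direction \<open>u\<close>. With the
  Hermitian form \<open>h\<close> of the metric, \<open>h(C(u; v, w), z) = h(w, C(v; u, z))\<close>. Geodesics are \<open>J\<close>-planar, so
  for c-projectively equivalent metrics the Christoffel maps differ by \<open>Ups(v) w + Ups(w) v\<close>; hence the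
  trace-free part \<open>W\<close> of \<open>C\<close> is the same for all metrics of the class. An Einstein metric satisfies the
  above symmetry with \<open>W\<close> in place of \<open>C\<close>, and for a general metric the defect is an expression in its
  Ricci form. Write \<open>h2 = h1(a _, _)\<close> for the Einstein metrics. By the two symmetries \<open>a\<close> can be moved
  between the slots of \<open>W\<close>, and comparing the defects for \<open>h\<close> shows that the Ricci form of \<open>h\<close> is a
  multiple of \<open>h\<close> wherever \<open>a\<close> is not a scalar. Those points are dense: if \<open>h2 = k h1\<close> on an open set,
  then \<open>(h2 - k h1, Ups)\<close> vanishes there, and for Einstein metrics this pair solves a linear first
  order system, so it vanishes on all of the connected manifold. By continuity the Ricci form of \<open>h\<close>
  is everywhere a multiple of \<open>h\<close>, and commuting antiholomorphic derivatives makes the factor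
  locally constant.\<close>

section \<open>Calculus of smooth maps\<close>

text \<open>The signature is arbitrary, so \<open>a\<close> need not be diagonalisable and vectors
  may be null: the pointwise step uses no eigenbasis, only a vector \<open>u\<close> that is not an
  eigenvector of \<open>a\<close> and a \<open>w\<close> with \<open>h1 w u = 0\<close> and
  \<open>h1 w (a u) = 1\<close>. At a point where \<open>a\<close> is scalar this step says nothing.
  An open set of such points is excluded because there \<open>h2 = k h1\<close> may be
  differentiated: \<open>n >= 2\<close> then forces \<open>Ups = 0\<close>, hence equal Ricci forms,
  hence \<open>b2 * k = b1\<close> for the Einstein constants. This relation is what closes the
  linear system, since the derivative of \<open>Ups\<close> contains \<open>b2 h2 - b1 h1\<close>,
  which becomes \<open>b2 (h2 - k h1)\<close>. Equality of two families of curves informs about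
  Christoffel maps only if there are enough curves, so geodesics with arbitrary initial data are
  constructed; this needs smoothness of the Christoffel maps, which are given only by a unique
  description. Tensoriality of the curvature is never established: the Ricci factor of
  \<open>h\<close> is compared between charts through \<open>Ups\<close>, relative to
  \<open>h1\<close>, whose factor is a global constant.\<close>

lemma frechet_derivative_eqI:
  "(f has_derivative f') (at x) \<Longrightarrow> frechet_derivative f (at x) = f'"
  using frechet_derivative_at by metis

lemma has_derivative_frechet:
  "f differentiable (at x) \<Longrightarrow> (f has_derivative frechet_derivative f (at x)) (at x)"
  by (simp add: frechet_derivative_works[symmetric])

lemma frechet_derivative_cong_open:
  assumes "open S" "x \<in> S" "\<And>y. y \<in> S \<Longrightarrow> f y = g y" "g differentiable (at x)"
  shows "f differentiable (at x)" "frechet_derivative f (at x) = frechet_derivative g (at x)"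
proof -
  have "(f has_derivative frechet_derivative g (at x)) (at x)"
    using has_derivative_transform_within_open[OF has_derivative_frechet[OF assms(4)] assms(1,2)] assms(3)
    by metis
  then show "f differentiable (at x)" "frechet_derivative f (at x) = frechet_derivative g (at x)"
    by (auto simp: differentiable_def frechet_derivative_eqI)
qed

section \<open>Closure properties of finite and infinite order differentiability\<close>

lemma ck_on_subset: "ck_on k S f \<Longrightarrow> T \<subseteq> S \<Longrightarrow> ck_on k T f"
  by (induction k arbitrary: f) (auto intro: continuous_on_subset)

lemma ck_on_cong:
  assumes "open S" "\<And>y. y \<in> S \<Longrightarrow> f y = g y" "ck_on k S g"
  shows "ck_on k S f"
  using assms(2,3)
proof (induction k arbitrary: f g)
  case 0
  then show ?case using continuous_on_cong[OF refl, of S f g] by simp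
next
  case (Suc k)
  note fd = frechet_derivative_cong_open[OF assms(1) _ Suc.prems(1)]
  show ?case
    unfolding ck_on.simps
  proof (intro conjI ballI allI)
    show "f differentiable (at x)" if "x \<in> S" for x
      using fd(1) that Suc.prems(2) by auto
    show "ck_on k S (\<lambda>x. frechet_derivative f (at x) v)" for v
      by (rule Suc.IH[where g = "\<lambda>x. frechet_derivative g (at x) v"])
        (use fd(2) Suc.prems in auto)
  qed
qed

lemma ck_on_SucI:
  assumes "open S" "\<And>x. x \<in> S \<Longrightarrow> (f has_derivative f' x) (at x)" "\<And>v. ck_on k S (\<lambda>x. f' x v)"
  shows "ck_on (Suc k) S f"
  unfolding ck_on.simps
proof (intro conjI ballI allI)
  show "f differentiable (at x)" if "x \<in> S" for x
    using assms(2)[OF that] by (auto simp: differentiable_def)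
  show "ck_on k S (\<lambda>x. frechet_derivative f (at x) v)" for v
    by (rule ck_on_cong[OF assms(1) _ assms(3)]) (simp add: frechet_derivative_eqI[OF assms(2)])
qed

lemma ck_on_Suc_has_derivative:
  "ck_on (Suc k) S f \<Longrightarrow> x \<in> S \<Longrightarrow> (f has_derivative frechet_derivative f (at x)) (at x)"
  by (simp add: has_derivative_frechet)

lemma ck_on_imp_continuous_on: "ck_on k S f \<Longrightarrow> continuous_on S f"
proof (cases k)
  case (Suc m)
  assume "ck_on k S f"
  then show ?thesis
    using Suc differentiable_imp_continuous_within[of f _ UNIV]
    by (auto intro!: continuous_at_imp_continuous_on)
qed simp

lemma ck_on_Suc_D: "ck_on (Suc k) S f \<Longrightarrow> ck_on k S f"
proof (induction k arbitrary: f)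
  case 0
  then show ?case using ck_on_imp_continuous_on[OF 0] by simp
next
  case (Suc k)
  show ?case
    unfolding ck_on.simps(2)[of k]
    using Suc.prems Suc.IH unfolding ck_on.simps(2)[of "Suc k"] by blast
qed

lemma ck_on_const: "ck_on k S (\<lambda>_. c)"
  by (induction k arbitrary: c) (auto simp: frechet_derivative_const)

lemma ck_on_bounded_linear:
  assumes L: "bounded_linear L" and "open S" "ck_on k S f"
  shows "ck_on k S (\<lambda>x. L (f x))"
  using assms(3)
proof (induction k arbitrary: f)
  case 0
  then show ?case
    using bounded_linear.continuous_on[OF L] by simp
next
  case (Suc k)
  show ?case
    by (rule ck_on_SucI[OF \<open>open S\<close> bounded_linear.has_derivative[OF L ck_on_Suc_has_derivative]])
      (use Suc in auto)
qed

lemma ck_on_add: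
  assumes "open S" "ck_on k S f" "ck_on k S g"
  shows "ck_on k S (\<lambda>x. f x + g x)"
  using assms(2,3)
proof (induction k arbitrary: f g)
  case 0
  then show ?case by (auto intro: continuous_on_add)
next
  case (Suc k)
  show ?case
    by (rule ck_on_SucI[OF \<open>open S\<close> has_derivative_add]; (rule ck_on_Suc_has_derivative)?)
      (use Suc in auto)
qed

lemma ck_on_sum:
  assumes "open S" "\<And>i. i \<in> I \<Longrightarrow> ck_on k S (f i)"
  shows "ck_on k S (\<lambda>x. \<Sum>i\<in>I. f i x)"
  using assms(2)
  by (induction I rule: infinite_finite_induct) (auto intro!: ck_on_const ck_on_add[OF assms(1)])

lemma ck_on_bilinear:
  assumes B: "bounded_bilinear B" and "open S" "ck_on k S f" "ck_on k S g"
  shows "ck_on k S (\<lambda>x. B (f x) (g x))"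
  using assms(3,4)
proof (induction k arbitrary: f g)
  case 0
  then show ?case using bounded_bilinear.continuous_on[OF B] by auto
next
  case (Suc k)
  note d = ck_on_Suc_has_derivative
  show ?case
  proof (rule ck_on_SucI[OF \<open>open S\<close> bounded_bilinear.FDERIV[OF B d[OF Suc.prems(1)] d[OF Suc.prems(2)]]])
    show "ck_on k S (\<lambda>x. B (f x) (frechet_derivative g (at x) v) + B (frechet_derivative f (at x) v) (g x))"
      for v
      by (intro ck_on_add \<open>open S\<close> Suc.IH) (use Suc.prems ck_on_Suc_D in auto)
  qed
qed

lemma linear_eq_sum_Basis:
  fixes f :: "'a::euclidean_space \<Rightarrow> 'b::real_vector"
  assumes "linear f"
  shows "f v = (\<Sum>b\<in>Basis. (v \<bullet> b) *\<^sub>R f b)"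
  using assms euclidean_representation[of v] linear_sum[OF assms] linear_scale[OF assms]
  by (metis (mono_tags, lifting) sum.cong)

text \<open>\<open>ck_on\<close> differentiates in fixed directions, whereas the chain rule produces
  the moving direction \<open>?G x v\<close>. Expanding it in \<open>Basis\<close> restores fixed
  directions, which is why the middle space is Euclidean.\<close>

lemma ck_on_compose:
  fixes g :: "'a::real_normed_vector \<Rightarrow> 'b::euclidean_space" and f :: "'b \<Rightarrow> 'c::real_normed_vector"
  assumes "open S" "ck_on k S g" "ck_on k T f" "\<And>x. x \<in> S \<Longrightarrow> g x \<in> T"
  shows "ck_on k S (\<lambda>x. f (g x))"
  using assms(2,3)
proof (induction k arbitrary: f)
  case 0
  then show ?case using continuous_on_compose2[of T f S g] assms(4) by auto
next
  case (Suc k)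
  let ?D = "\<lambda>x. frechet_derivative f (at (g x))" and ?G = "\<lambda>x. frechet_derivative g (at x)"
  show ?case
  proof (rule ck_on_SucI[OF assms(1)])
    fix x assume x: "x \<in> S"
    show "((\<lambda>x. f (g x)) has_derivative (\<lambda>v. ?D x (?G x v))) (at x)"
      using has_derivative_compose[OF ck_on_Suc_has_derivative[OF Suc.prems(1) x]
          ck_on_Suc_has_derivative[OF Suc.prems(2) assms(4)[OF x]]] by simp
  next
    fix v
    have l: "linear (?D x)" if "x \<in> S" for x
      by (rule has_derivative_linear[OF ck_on_Suc_has_derivative[OF Suc.prems(2) assms(4)[OF that]]])
    have "ck_on k S (\<lambda>x. \<Sum>b\<in>Basis. (?G x v \<bullet> b) *\<^sub>R ?D x b)"
      by (intro ck_on_sum ck_on_bilinear[OF bounded_bilinear_scaleR] assms(1)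
            ck_on_bounded_linear[OF bounded_linear_inner_left] Suc.IH)
        (use Suc.prems ck_on_Suc_D in auto)
    then show "ck_on k S (\<lambda>x. ?D x (?G x v))"
      by (rule ck_on_cong[OF assms(1), rotated]) (rule linear_eq_sum_Basis[OF l])
  qed
qed

lemma smooth_on_D: "smooth_on S f \<Longrightarrow> ck_on k S f"
  by (simp add: smooth_on_def)

lemma smooth_on_derivative:
  "smooth_on S f \<Longrightarrow> smooth_on S (\<lambda>x. frechet_derivative f (at x) v)"
  unfolding smooth_on_def using ck_on.simps(2) by blast

lemma smooth_on_has_derivative:
  "smooth_on S f \<Longrightarrow> x \<in> S \<Longrightarrow> (f has_derivative frechet_derivative f (at x)) (at x)"
  using ck_on_Suc_has_derivative smooth_on_D by metis

lemma smooth_on_imp_continuous_on: "smooth_on S f \<Longrightarrow> continuous_on S f"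
  using ck_on_imp_continuous_on smooth_on_D by metis

lemma smooth_on_subset: "smooth_on S f \<Longrightarrow> T \<subseteq> S \<Longrightarrow> smooth_on T f"
  unfolding smooth_on_def using ck_on_subset by blast

lemma smooth_on_cong:
  "smooth_on S g \<Longrightarrow> open S \<Longrightarrow> (\<And>y. y \<in> S \<Longrightarrow> f y = g y) \<Longrightarrow> smooth_on S f"
  unfolding smooth_on_def using ck_on_cong[of S f g] by auto

lemma smooth_on_bounded_linear:
  "bounded_linear L \<Longrightarrow> open S \<Longrightarrow> smooth_on S f \<Longrightarrow> smooth_on S (\<lambda>x. L (f x))"
  unfolding smooth_on_def using ck_on_bounded_linear by blast

lemma smooth_on_bilinear:
  "bounded_bilinear B \<Longrightarrow> open S \<Longrightarrow> smooth_on S f \<Longrightarrow> smooth_on S g \<Longrightarrow> smooth_on S (\<lambda>x. B (f x) (g x))"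
  unfolding smooth_on_def using ck_on_bilinear by blast

lemma smooth_on_add:
  "open S \<Longrightarrow> smooth_on S f \<Longrightarrow> smooth_on S g \<Longrightarrow> smooth_on S (\<lambda>x. f x + g x)"
  unfolding smooth_on_def using ck_on_add by blast

lemma smooth_on_diff:
  fixes f g :: "'a::real_normed_vector \<Rightarrow> 'b::real_normed_vector"
  assumes "open S" "smooth_on S f" "smooth_on S g"
  shows "smooth_on S (\<lambda>x. f x - g x)"
  using smooth_on_add[OF assms(1,2) smooth_on_bounded_linear[OF bounded_linear_minus[OF bounded_linear_ident] assms(1,3)]]
  by simp

lemma smooth_on_sum:
  assumes "open S" "\<And>i. i \<in> I \<Longrightarrow> smooth_on S (f i)"
  shows "smooth_on S (\<lambda>x. \<Sum>i\<in>I. f i x)"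
  unfolding smooth_on_def
  by (intro allI ck_on_sum[OF assms(1)] smooth_on_D[OF assms(2)])

lemma smooth_on_compose:
  fixes g :: "'a::real_normed_vector \<Rightarrow> 'b::euclidean_space" and f :: "'b \<Rightarrow> 'c::real_normed_vector"
  assumes "open S" "smooth_on S g" "smooth_on T f" "\<And>x. x \<in> S \<Longrightarrow> g x \<in> T"
  shows "smooth_on S (\<lambda>x. f (g x))"
  unfolding smooth_on_def
  by (intro allI ck_on_compose[OF assms(1) smooth_on_D[OF assms(2)] smooth_on_D[OF assms(3)] assms(4)])

subsection \<open>Derivatives of bilinear expressions\<close>

lemma bilinear_eq_sum_Basis:
  fixes B :: "'a::euclidean_space \<Rightarrow> 'b::euclidean_space \<Rightarrow> 'c::real_vector"
  assumes "bilinear B"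
  shows "B v w = (\<Sum>a\<in>Basis. \<Sum>b\<in>Basis. (v \<bullet> a) *\<^sub>R (w \<bullet> b) *\<^sub>R B a b)"
proof -
  have l: "linear (\<lambda>v. B v w)" "linear (B v)" for v w
    using assms by (auto simp: bilinear_def)
  have "B v w = (\<Sum>a\<in>Basis. (v \<bullet> a) *\<^sub>R B a w)"
    by (rule linear_eq_sum_Basis[OF l(1)])
  also have "\<dots> = (\<Sum>a\<in>Basis. (v \<bullet> a) *\<^sub>R (\<Sum>b\<in>Basis. (w \<bullet> b) *\<^sub>R B a b))"
    by (intro sum.cong refl arg_cong2[where f = scaleR] linear_eq_sum_Basis[OF l(2)])
  finally show ?thesis by (simp add: scaleR_sum_right)
qed

text \<open>Metrics and Christoffel maps are known through their values at fixed arguments, so the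
  product rule is stated for such fields; the expansion in \<open>Basis\<close> reduces it to
  finitely many scalar products.\<close>

lemma has_derivative_bilinear_field:
  fixes B :: "'a::real_normed_vector \<Rightarrow> 'b::euclidean_space \<Rightarrow> 'c::euclidean_space \<Rightarrow> 'd::real_normed_vector"
  assumes S: "open S" "x \<in> S" and bil: "\<And>y. y \<in> S \<Longrightarrow> bilinear (B y)"
    and D: "\<And>v w. ((\<lambda>y. B y v w) has_derivative (\<lambda>z. D z v w)) (at x)"
    and f: "(f has_derivative f') (at x)" and g: "(g has_derivative g') (at x)"
  shows "((\<lambda>y. B y (f y) (g y)) has_derivative
           (\<lambda>z. D z (f x) (g x) + B x (f' z) (g x) + B x (f x) (g' z))) (at x)"
proof -
  \<comment> \<open>Bilinearity of \<open>B y\<close> holds on an open set, so it passes to the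
    derivative by uniqueness of derivatives.\<close>
  have bilD: "bilinear (D z)" for z
  proof -
    have e: "D z v w = E z" if "((\<lambda>y. B y v w) has_derivative E) (at x)" for E v w
      using has_derivative_unique[OF D that] by metis
    have t: "((\<lambda>y. B y v w) has_derivative E) (at x)"
      if "(F has_derivative E) (at x)" "\<And>y. y \<in> S \<Longrightarrow> F y = B y v w" for E F v w
      by (rule has_derivative_transform_within_open[OF that(1) S that(2)])
    have add1: "D z (v + v') w = D z v w + D z v' w" for v v' w
      by (rule e, rule t[OF has_derivative_add[OF D D]]) (simp add: bilinear_ladd[OF bil])
    have add2: "D z v (w + w') = D z v w + D z v w'" for v w w'
      by (rule e, rule t[OF has_derivative_add[OF D D]]) (simp add: bilinear_radd[OF bil])
    have sc1: "D z (k *\<^sub>R v) w = k *\<^sub>R D z v w" for k v w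
      by (rule e, rule t[OF has_derivative_scaleR_right[OF D]]) (simp add: bilinear_lmul[OF bil])
    have sc2: "D z v (k *\<^sub>R w) = k *\<^sub>R D z v w" for k v w
      by (rule e, rule t[OF has_derivative_scaleR_right[OF D]]) (simp add: bilinear_rmul[OF bil])
    show ?thesis
      unfolding bilinear_def by (auto intro!: linearI simp: add1 add2 sc1 sc2)
  qed
  let ?F = "\<lambda>y. \<Sum>a\<in>Basis. \<Sum>b\<in>Basis. (f y \<bullet> a) *\<^sub>R (g y \<bullet> b) *\<^sub>R B y a b"
  have "(?F has_derivative (\<lambda>z. \<Sum>a\<in>Basis. \<Sum>b\<in>Basis.
      (f x \<bullet> a) *\<^sub>R ((g x \<bullet> b) *\<^sub>R D z a b + (g' z \<bullet> b) *\<^sub>R B x a b) + (f' z \<bullet> a) *\<^sub>R (g x \<bullet> b) *\<^sub>R B x a b)) (at x)"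
    by (intro has_derivative_sum has_derivative_scaleR has_derivative_inner_left f g D)
  also have "(\<lambda>z. \<Sum>a\<in>Basis. \<Sum>b\<in>Basis.
      (f x \<bullet> a) *\<^sub>R ((g x \<bullet> b) *\<^sub>R D z a b + (g' z \<bullet> b) *\<^sub>R B x a b) + (f' z \<bullet> a) *\<^sub>R (g x \<bullet> b) *\<^sub>R B x a b)
     = (\<lambda>z. D z (f x) (g x) + B x (f' z) (g x) + B x (f x) (g' z))"
  proof
    fix z
    have "D z (f x) (g x) + B x (f' z) (g x) + B x (f x) (g' z) = (\<Sum>a\<in>Basis. \<Sum>b\<in>Basis.
        (f x \<bullet> a) *\<^sub>R (g x \<bullet> b) *\<^sub>R D z a b + (f' z \<bullet> a) *\<^sub>R (g x \<bullet> b) *\<^sub>R B x a b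
          + (f x \<bullet> a) *\<^sub>R (g' z \<bullet> b) *\<^sub>R B x a b)"
      by (subst bilinear_eq_sum_Basis[OF bilD, of z "f x" "g x"],
          subst bilinear_eq_sum_Basis[OF bil[OF S(2)], of "f' z" "g x"],
          subst bilinear_eq_sum_Basis[OF bil[OF S(2)], of "f x" "g' z"])
        (simp only: sum.distrib)
    then show "(\<Sum>a\<in>Basis. \<Sum>b\<in>Basis.
      (f x \<bullet> a) *\<^sub>R ((g x \<bullet> b) *\<^sub>R D z a b + (g' z \<bullet> b) *\<^sub>R B x a b) + (f' z \<bullet> a) *\<^sub>R (g x \<bullet> b) *\<^sub>R B x a b)
      = D z (f x) (g x) + B x (f' z) (g x) + B x (f x) (g' z)"
      by (simp only: scaleR_add_right add_ac)
  qed
  finally show ?thesis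
    by (rule has_derivative_transform_within_open[OF _ S]) (rule bilinear_eq_sum_Basis[OF bil, symmetric])
qed

lemma smooth_on_bilinear_field:
  fixes B :: "'a::real_normed_vector \<Rightarrow> 'b::euclidean_space \<Rightarrow> 'c::euclidean_space \<Rightarrow> 'd::real_normed_vector"
  assumes S: "open S" and bil: "\<And>y. y \<in> S \<Longrightarrow> bilinear (B y)"
    and B: "\<And>v w. smooth_on S (\<lambda>y. B y v w)" and f: "smooth_on S f" and g: "smooth_on S g"
  shows "smooth_on S (\<lambda>y. B y (f y) (g y))"
proof -
  have "smooth_on S (\<lambda>y. (f y \<bullet> a) *\<^sub>R (g y \<bullet> b) *\<^sub>R B y a b)" for a b
    by (rule smooth_on_bilinear[OF bounded_bilinear_scaleR S
          smooth_on_bounded_linear[OF bounded_linear_inner_left S f]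
          smooth_on_bilinear[OF bounded_bilinear_scaleR S
            smooth_on_bounded_linear[OF bounded_linear_inner_left S g] B]])
  then have "smooth_on S (\<lambda>y. \<Sum>a\<in>Basis. \<Sum>b\<in>Basis. (f y \<bullet> a) *\<^sub>R (g y \<bullet> b) *\<^sub>R B y a b)"
    by (intro smooth_on_sum S)
  then show ?thesis
    by (rule smooth_on_cong) (rule S, rule bilinear_eq_sum_Basis[OF bil])
qed

subsection \<open>Symmetry of second derivatives\<close>

text \<open>The second difference over a parallelogram is evaluated by the mean value theorem along
  \<open>u\<close> and then along \<open>v\<close>. Its left-hand side is symmetric in
  \<open>u\<close> and \<open>v\<close>, which compares the two mixed derivatives at nearby
  points.\<close>

lemma second_difference_mean_value:
  fixes f :: "'a::real_normed_vector \<Rightarrow> real"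
  assumes f: "smooth_on S f" and h: "h > 0"
    and S: "\<And>s t. 0 \<le> s \<Longrightarrow> s \<le> h \<Longrightarrow> 0 \<le> t \<Longrightarrow> t \<le> h \<Longrightarrow> x + s *\<^sub>R u + t *\<^sub>R v \<in> S"
  shows "\<exists>s t. 0 < s \<and> s < h \<and> 0 < t \<and> t < h \<and>
    f (x + h *\<^sub>R u + h *\<^sub>R v) - f (x + h *\<^sub>R u) - f (x + h *\<^sub>R v) + f x
      = h * h * frechet_derivative (\<lambda>y. frechet_derivative f (at y) u) (at (x + s *\<^sub>R u + t *\<^sub>R v)) v"
proof -
  let ?D = "\<lambda>y. frechet_derivative f (at y)"
  let ?D2 = "\<lambda>y. frechet_derivative (\<lambda>y. ?D y u) (at y)"
  have d1: "((\<lambda>s. f (y + s *\<^sub>R w)) has_real_derivative ?D (y + s *\<^sub>R w) w) (at s)"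
    if "y + s *\<^sub>R w \<in> S" for y s w
  proof -
    have "((\<lambda>s. f (y + s *\<^sub>R w)) has_derivative (\<lambda>k. ?D (y + s *\<^sub>R w) (k *\<^sub>R w))) (at s)"
      by (rule has_derivative_compose[where f = "\<lambda>s. y + s *\<^sub>R w" and x = s,
            OF _ smooth_on_has_derivative[OF f that]])
        (auto intro!: derivative_eq_intros)
    then show ?thesis
      by (rule has_derivative_imp_has_field_derivative)
        (simp add: linear_scale[OF has_derivative_linear[OF smooth_on_has_derivative[OF f that]]])
  qed
  have d2: "((\<lambda>s. ?D (y + s *\<^sub>R w) u) has_real_derivative ?D2 (y + s *\<^sub>R w) w) (at s)"
    if "y + s *\<^sub>R w \<in> S" for y s w
  proof -
    note sd = smooth_on_has_derivative[OF smooth_on_derivative[OF f, of u] that]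
    have "((\<lambda>s. ?D (y + s *\<^sub>R w) u) has_derivative (\<lambda>k. ?D2 (y + s *\<^sub>R w) (k *\<^sub>R w))) (at s)"
      by (rule has_derivative_compose[where f = "\<lambda>s. y + s *\<^sub>R w" and x = s, OF _ sd]) (auto intro!: derivative_eq_intros)
    then show ?thesis
      by (rule has_derivative_imp_has_field_derivative)
        (simp add: linear_scale[OF has_derivative_linear[OF sd]])
  qed
  define g where "g s = f (x + h *\<^sub>R v + s *\<^sub>R u) - f (x + s *\<^sub>R u)" for s
  have "\<exists>s. 0 < s \<and> s < h \<and> g h - g 0 = (h - 0) * (?D (x + h *\<^sub>R v + s *\<^sub>R u) u - ?D (x + s *\<^sub>R u) u)"
  proof (rule MVT2[OF h])
    fix s assume s: "0 \<le> s" "s \<le> h"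
    show "(g has_real_derivative ?D (x + h *\<^sub>R v + s *\<^sub>R u) u - ?D (x + s *\<^sub>R u) u) (at s)"
      unfolding g_def
      by (intro DERIV_diff d1) (use S[of s h] S[of s 0] s h in \<open>auto simp: add_ac\<close>)
  qed
  then obtain s where s: "0 < s" "s < h"
    and g1: "g h - g 0 = h * (?D (x + h *\<^sub>R v + s *\<^sub>R u) u - ?D (x + s *\<^sub>R u) u)" by auto
  have "\<exists>t. 0 < t \<and> t < h \<and> ?D (x + s *\<^sub>R u + h *\<^sub>R v) u - ?D (x + s *\<^sub>R u + 0 *\<^sub>R v) u
      = (h - 0) * ?D2 (x + s *\<^sub>R u + t *\<^sub>R v) v"
    by (rule MVT2[OF h]) (rule d2, use S s in auto)
  then obtain t where t: "0 < t" "t < h"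
    and g2: "?D (x + s *\<^sub>R u + h *\<^sub>R v) u - ?D (x + s *\<^sub>R u) u = h * ?D2 (x + s *\<^sub>R u + t *\<^sub>R v) v"
    by auto
  have "f (x + h *\<^sub>R u + h *\<^sub>R v) - f (x + h *\<^sub>R u) - f (x + h *\<^sub>R v) + f x = g h - g 0"
    by (simp add: g_def add_ac)
  also have "\<dots> = h * h * ?D2 (x + s *\<^sub>R u + t *\<^sub>R v) v"
    using g1 g2 by (simp add: add_ac)
  finally show ?thesis using s t by blast
qed

lemma second_derivative_symmetric_real:
  fixes f :: "'a::real_normed_vector \<Rightarrow> real"
  assumes f: "smooth_on S f" and S: "open S" "x \<in> S"
  shows "frechet_derivative (\<lambda>y. frechet_derivative f (at y) u) (at x) v
       = frechet_derivative (\<lambda>y. frechet_derivative f (at y) v) (at x) u"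
proof -
  let ?F = "\<lambda>u v y. frechet_derivative (\<lambda>y. frechet_derivative f (at y) u) (at y) v"
  have cont: "isCont (?F u v) x" for u v
    using smooth_on_imp_continuous_on[OF smooth_on_derivative[OF smooth_on_derivative[OF f]]] S
    by (simp add: continuous_on_eq_continuous_at)
  have "dist (?F u v x) (?F v u x) \<le> e" if e: "e > 0" for e
  proof -
    obtain d1 where d1: "d1 > 0" "\<And>y. dist y x < d1 \<Longrightarrow> dist (?F u v y) (?F u v x) < e / 2"
      using cont[of u v] e unfolding continuous_at_eps_delta by (metis half_gt_zero)
    obtain d2 where d2: "d2 > 0" "\<And>y. dist y x < d2 \<Longrightarrow> dist (?F v u y) (?F v u x) < e / 2"
      using cont[of v u] e unfolding continuous_at_eps_delta by (metis half_gt_zero)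
    obtain r where r: "r > 0" "ball x r \<subseteq> S" using S openE by blast
    define d where "d = min r (min d1 d2)"
    define c where "c = norm u + norm v + 1"
    \<comment> \<open>With this side length the whole parallelogram stays within
      \<open>d / 2\<close> of \<open>x\<close>; the \<open>1\<close> in \<open>c\<close> keeps it
      positive when \<open>u\<close> and \<open>v\<close> vanish.\<close>
    define h where "h = d / (2 * c)"
    have N: "c > 0" by (simp add: c_def add_nonneg_pos)
    have d: "d > 0" using d1 d2 r by (simp add: d_def)
    then have h: "h > 0" using N by (simp add: h_def)
    have near: "dist (x + s *\<^sub>R u + t *\<^sub>R v) x < d" if "0 \<le> s" "s \<le> h" "0 \<le> t" "t \<le> h" for s t
    proof -
      have "norm (s *\<^sub>R u + t *\<^sub>R v) \<le> s * norm u + t * norm v"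
        using norm_triangle_ineq[of "s *\<^sub>R u" "t *\<^sub>R v"] that by simp
      also have "\<dots> \<le> h * norm u + h * norm v"
        using that by (intro add_mono mult_right_mono) auto
      also have "\<dots> \<le> h * c" using h by (simp add: c_def distrib_left)
      also have "\<dots> = d / 2" using N by (simp add: h_def)
      also have "\<dots> < d" using d by simp
      finally show ?thesis by (simp add: dist_norm algebra_simps)
    qed
    have inS: "x + s *\<^sub>R u + t *\<^sub>R v \<in> S" if "0 \<le> s" "s \<le> h" "0 \<le> t" "t \<le> h" for s t
      using near[OF that] r by (auto simp: d_def dist_commute subset_iff)
    then have inS': "x + s *\<^sub>R v + t *\<^sub>R u \<in> S" if "0 \<le> s" "s \<le> h" "0 \<le> t" "t \<le> h" for s t
      using that by (metis add.commute add.left_commute)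
    obtain s t where st: "0 < s" "s < h" "0 < t" "t < h" and
      A: "f (x + h *\<^sub>R u + h *\<^sub>R v) - f (x + h *\<^sub>R u) - f (x + h *\<^sub>R v) + f x = h * h * ?F u v (x + s *\<^sub>R u + t *\<^sub>R v)"
      using second_difference_mean_value[OF f h inS] by blast
    obtain s' t' where st': "0 < s'" "s' < h" "0 < t'" "t' < h" and
      B: "f (x + h *\<^sub>R v + h *\<^sub>R u) - f (x + h *\<^sub>R v) - f (x + h *\<^sub>R u) + f x = h * h * ?F v u (x + s' *\<^sub>R v + t' *\<^sub>R u)"
      using second_difference_mean_value[OF f h inS'] by blast
    have "h * h * ?F u v (x + s *\<^sub>R u + t *\<^sub>R v) = h * h * ?F v u (x + s' *\<^sub>R v + t' *\<^sub>R u)"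
      using A B unfolding add.assoc[of x] add.commute[of "h *\<^sub>R v"] by linarith
    then have eq: "?F u v (x + s *\<^sub>R u + t *\<^sub>R v) = ?F v u (x + s' *\<^sub>R v + t' *\<^sub>R u)"
      using h by simp
    have "dist (x + s *\<^sub>R u + t *\<^sub>R v) x < d1" using near[of s t] st by (simp add: d_def)
    moreover have "dist (x + s' *\<^sub>R v + t' *\<^sub>R u) x < d2"
      using near[of t' s'] st' by (simp add: d_def add_ac)
    ultimately show ?thesis
      using d1(2) d2(2) eq dist_triangle_half_r[of _ "?F u v x" e "?F v u x"] by fastforce
  qed
  then show ?thesis
    by (metis dist_le_zero_iff field_le_epsilon add_0)
qed

lemma second_derivative_symmetric:
  fixes f :: "'a::real_normed_vector \<Rightarrow> 'b::euclidean_space"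
  assumes f: "smooth_on S f" and S: "open S" "x \<in> S"
  shows "frechet_derivative (\<lambda>y. frechet_derivative f (at y) u) (at x) v
       = frechet_derivative (\<lambda>y. frechet_derivative f (at y) v) (at x) u"
proof (rule euclidean_eqI)
  fix b :: 'b assume "b \<in> Basis"
  let ?f = "\<lambda>y. f y \<bullet> b"
  have sf: "smooth_on S ?f"
    by (rule smooth_on_bounded_linear[OF bounded_linear_inner_left S(1) f])
  have 1: "frechet_derivative ?f (at y) = (\<lambda>u. frechet_derivative f (at y) u \<bullet> b)" if "y \<in> S" for y
    by (intro frechet_derivative_eqI has_derivative_inner_left smooth_on_has_derivative[OF f that])
  have 2: "frechet_derivative (\<lambda>y. frechet_derivative ?f (at y) u) (at x)
      = (\<lambda>v. frechet_derivative (\<lambda>y. frechet_derivative f (at y) u) (at x) v \<bullet> b)" for u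
    by (rule frechet_derivative_eqI,
        rule has_derivative_transform_within_open[OF has_derivative_inner_left[OF
          smooth_on_has_derivative[OF smooth_on_derivative[OF f] S(2)]] S])
      (simp add: 1)
  show "frechet_derivative (\<lambda>y. frechet_derivative f (at y) u) (at x) v \<bullet> b
      = frechet_derivative (\<lambda>y. frechet_derivative f (at y) v) (at x) u \<bullet> b"
    using second_derivative_symmetric_real[OF sf S, of u v] by (simp add: 2)
qed

subsection \<open>Linear differential inequalities\<close>

text \<open>Gronwall's argument on the segment from \<open>x\<close> to \<open>y\<close>:
  \<open>exp (- L * t) * N (p t)\<close> is nonincreasing and starts at 0.\<close>

lemma zero_of_linear_derivative_bound:
  fixes N :: "'a::real_normed_vector \<Rightarrow> real"
  assumes T: "convex T" "x \<in> T" "y \<in> T"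
    and d: "\<And>y. y \<in> T \<Longrightarrow> (N has_derivative N' y) (at y)"
    and b: "\<And>y u. y \<in> T \<Longrightarrow> \<bar>N' y u\<bar> \<le> K * norm u * N y"
    and nn: "\<And>y. y \<in> T \<Longrightarrow> 0 \<le> N y" and x: "N x = 0"
  shows "N y = 0"
proof -
  define p where "p t = x + t *\<^sub>R (y - x)" for t :: real
  have p: "p t \<in> T" if "0 \<le> t" "t \<le> 1" for t
    using convexD_alt[OF T, of t] that by (simp add: p_def algebra_simps)
  define L where "L = K * norm (y - x)"
  define q where "q t = exp (- L * t) * N (p t)" for t
  have "\<exists>s. (q has_real_derivative s) (at t) \<and> s \<le> 0" if t: "0 \<le> t" "t \<le> 1" for t
  proof -
    have "((\<lambda>t. N (p t)) has_derivative (\<lambda>k. N' (p t) (k *\<^sub>R (y - x)))) (at t)"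
      by (rule has_derivative_compose[where f = p and x = t, OF _ d[OF p[OF t]]])
        (auto intro!: derivative_eq_intros simp: p_def[abs_def])
    then have dN: "((\<lambda>t. N (p t)) has_real_derivative N' (p t) (y - x)) (at t)"
      by (rule has_derivative_imp_has_field_derivative)
        (simp add: linear_scale[OF has_derivative_linear[OF d[OF p[OF t]]]])
    have "(q has_real_derivative exp (- L * t) * N' (p t) (y - x) + (exp (- L * t) * - L) * N (p t)) (at t)"
      unfolding q_def by (auto intro!: derivative_eq_intros dN)
    moreover have "N' (p t) (y - x) \<le> L * N (p t)"
      using b[OF p[OF t], of "y - x"] by (simp add: L_def)
    then have "exp (- L * t) * N' (p t) (y - x) + (exp (- L * t) * - L) * N (p t) \<le> 0"
      by (simp add: mult.assoc mult_left_mono)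
    ultimately show ?thesis by blast
  qed
  then have "q 1 \<le> q 0"
    by (intro DERIV_nonpos_imp_nonincreasing[of 0 1 q]) auto
  then have "N y \<le> 0"
    by (simp add: q_def p_def x mult_le_0_iff)
  then show ?thesis using nn[OF T(3)] by simp
qed

text \<open>The sum of norms need not be differentiable, so Gronwall is applied to the sum of
  squares; passing from one to the other costs the factor \<open>card I\<close>.\<close>

lemma zero_of_linear_system_bound:
  fixes F :: "'i \<Rightarrow> 'a::real_normed_vector \<Rightarrow> 'b::real_inner"
  assumes T: "convex T" "x \<in> T" "y \<in> T" and I: "finite I" "i \<in> I" and K: "0 \<le> K"
    and d: "\<And>i y. i \<in> I \<Longrightarrow> y \<in> T \<Longrightarrow> (F i has_derivative F' i y) (at y)"
    and b: "\<And>i y u. i \<in> I \<Longrightarrow> y \<in> T \<Longrightarrow> norm (F' i y u) \<le> K * norm u * (\<Sum>j\<in>I. norm (F j y))"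
    and x: "\<And>i. i \<in> I \<Longrightarrow> F i x = 0"
  shows "F i y = 0"
proof -
  define N where "N y = (\<Sum>i\<in>I. F i y \<bullet> F i y)" for y
  define M where "M y = (\<Sum>i\<in>I. norm (F i y))" for y
  have "N y = 0"
  proof (rule zero_of_linear_derivative_bound[OF T])
    fix y assume y: "y \<in> T"
    show "(N has_derivative (\<lambda>u. \<Sum>i\<in>I. F i y \<bullet> F' i y u + F' i y u \<bullet> F i y)) (at y)"
      unfolding N_def by (intro has_derivative_sum has_derivative_inner d y)
    show "0 \<le> N y" unfolding N_def by (intro sum_nonneg) simp
    fix u
    have "\<bar>\<Sum>i\<in>I. F i y \<bullet> F' i y u + F' i y u \<bullet> F i y\<bar> \<le> (\<Sum>i\<in>I. 2 * (norm (F i y) * (K * norm u * M y)))"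
    proof (rule order_trans[OF sum_abs], rule sum_mono)
      fix i assume i: "i \<in> I"
      have "\<bar>F i y \<bullet> F' i y u\<bar> \<le> norm (F i y) * (K * norm u * M y)"
        by (rule order_trans[OF Cauchy_Schwarz_ineq2 mult_left_mono])
          (use b[OF i y] in \<open>auto simp: M_def\<close>)
      then show "\<bar>F i y \<bullet> F' i y u + F' i y u \<bullet> F i y\<bar> \<le> 2 * (norm (F i y) * (K * norm u * M y))"
        by (simp add: inner_commute)
    qed
    also have "\<dots> = 2 * K * norm u * (M y)\<^sup>2"
      by (simp add: M_def sum_distrib_left sum_distrib_right power2_eq_square mult_ac)
    also have "\<dots> \<le> 2 * K * norm u * ((\<Sum>i\<in>I. (norm (F i y))\<^sup>2) * card I)"
      unfolding M_def using K by (intro mult_left_mono sum_squared_le_sum_of_squares) auto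
    also have "\<dots> = (2 * K * card I) * norm u * N y"
      by (simp add: N_def power2_norm_eq_inner mult_ac)
    finally show "\<bar>\<Sum>i\<in>I. F i y \<bullet> F' i y u + F' i y u \<bullet> F i y\<bar> \<le> (2 * K * card I) * norm u * N y" .
  qed (simp add: N_def x)
  then have "F i y \<bullet> F i y = 0"
    using I unfolding N_def by (subst (asm) sum_nonneg_eq_0_iff) auto
  then show ?thesis by simp
qed

lemma bilinear_field_bound:
  fixes B :: "'a::topological_space \<Rightarrow> 'b::euclidean_space \<Rightarrow> 'c::euclidean_space \<Rightarrow> 'd::real_normed_vector"
  assumes K: "compact K" and bil: "\<And>y. y \<in> K \<Longrightarrow> bilinear (B y)"
    and cont: "\<And>v w. continuous_on K (\<lambda>y. B y v w)"
  obtains C where "C \<ge> 0" "\<And>y v w. y \<in> K \<Longrightarrow> norm (B y v w) \<le> C * norm v * norm w"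
proof -
  have "\<exists>c. \<forall>y\<in>K. norm (B y a b) \<le> c" for a b
    using compact_imp_bounded[OF compact_continuous_image[OF cont[of a b] K]] by (auto simp: bounded_iff)
  then obtain c where c: "\<And>a b y. y \<in> K \<Longrightarrow> norm (B y a b) \<le> c a b" by metis
  define C where "C = (\<Sum>a\<in>Basis. \<Sum>b\<in>Basis. \<bar>c a b\<bar>)"
  show thesis
  proof (rule that[of C])
    show "C \<ge> 0" unfolding C_def by (intro sum_nonneg) simp
    fix y v w assume y: "y \<in> K"
    have t: "norm ((v \<bullet> a) *\<^sub>R (w \<bullet> b) *\<^sub>R B y a b) \<le> norm v * norm w * \<bar>c a b\<bar>"
      if "a \<in> Basis" "b \<in> Basis" for a b
      unfolding norm_scaleR mult.assoc[symmetric]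
      using that c[OF y, of a b] by (intro mult_mono) (auto simp: Basis_le_norm)
    have "norm (B y v w) \<le> (\<Sum>a\<in>Basis. \<Sum>b\<in>Basis. norm v * norm w * \<bar>c a b\<bar>)"
      by (subst bilinear_eq_sum_Basis[OF bil[OF y]]) (intro sum_norm_le t)
    also have "\<dots> = C * norm v * norm w"
      by (simp add: C_def sum_distrib_left sum_distrib_right mult_ac)
    finally show "norm (B y v w) \<le> C * norm v * norm w" .
  qed
qed

subsection \<open>Existence of integral curves\<close>

lemma smooth_locally_lipschitz:
  fixes F :: "'a::euclidean_space \<Rightarrow> 'b::real_normed_vector"
  assumes F: "smooth_on T F" and T: "open T" "y0 \<in> T"
  obtains r L where "r > 0" "L \<ge> 0" "cball y0 r \<subseteq> T"
    "\<And>y z. y \<in> cball y0 r \<Longrightarrow> z \<in> cball y0 r \<Longrightarrow> norm (F y - F z) \<le> L * norm (y - z)"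
proof -
  obtain r where r: "r > 0" "cball y0 r \<subseteq> T" using T open_contains_cball by blast
  let ?D = "\<lambda>y. frechet_derivative F (at y)"
  have "\<exists>K. \<forall>y\<in>cball y0 r. norm (?D y b) \<le> K" for b
  proof -
    have "continuous_on (cball y0 r) (\<lambda>y. ?D y b)"
      using smooth_on_imp_continuous_on[OF smooth_on_derivative[OF F]] r continuous_on_subset by blast
    then have "bounded ((\<lambda>y. ?D y b) ` cball y0 r)"
      by (intro compact_imp_bounded compact_continuous_image) auto
    then show ?thesis by (auto simp: bounded_iff)
  qed
  then obtain K where K: "\<And>b y. y \<in> cball y0 r \<Longrightarrow> norm (?D y b) \<le> K b" by metis
  have K0: "0 \<le> K b" for b using K[of y0 b] r order_trans[OF norm_ge_zero] by auto
  define L where "L = (\<Sum>b\<in>Basis. K b)"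
  have on: "onorm (?D y) \<le> L" if y: "y \<in> cball y0 r" for y
  proof (rule onorm_le)
    fix v
    have "linear (?D y)"
      using has_derivative_linear smooth_on_has_derivative[OF F] r y by blast
    then have "norm (?D y v) = norm (\<Sum>b\<in>Basis. (v \<bullet> b) *\<^sub>R ?D y b)"
      using linear_eq_sum_Basis by metis
    also have "\<dots> \<le> (\<Sum>b\<in>Basis. norm v * K b)"
      by (rule sum_norm_le)
        (auto intro!: mult_mono K[OF y] simp: Basis_le_norm)
    finally show "norm (?D y v) \<le> L * norm v" by (simp add: L_def sum_distrib_left mult.commute)
  qed
  show ?thesis
  proof (rule that[OF r(1) _ r(2)])
    show "L \<ge> 0" by (simp add: L_def sum_nonneg K0)
    show "norm (F y - F z) \<le> L * norm (y - z)" if "y \<in> cball y0 r" "z \<in> cball y0 r" for y z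
      by (rule differentiable_bound[OF convex_cball _ on that])
        (rule has_derivative_at_withinI[OF smooth_on_has_derivative[OF F subsetD[OF r(2)]]])
  qed
qed

lemma integral_increment_bound:
  fixes h :: "real \<Rightarrow> 'a::euclidean_space"
  assumes h: "continuous_on {a..b} h" and B: "\<And>t. t \<in> {a..b} \<Longrightarrow> norm (h t) \<le> B"
    and st: "s \<in> {a..b}" "t \<in> {a..b}"
  shows "norm (integral {a..t} h - integral {a..s} h) \<le> B * \<bar>t - s\<bar>"
proof -
  have "norm (integral {a..t} h - integral {a..s} h) \<le> B * norm (t - s)"
  proof (rule differentiable_bound[OF _ _ _ st(2,1)])
    show "((\<lambda>t. integral {a..t} h) has_derivative (\<lambda>k. k *\<^sub>R h t)) (at t within {a..b})"
      if "t \<in> {a..b}" for t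
      using integral_has_vector_derivative[OF h that] by (simp add: has_vector_derivative_def)
    show "onorm (\<lambda>k. k *\<^sub>R h t) \<le> B" if "t \<in> {a..b}" for t
    proof (rule onorm_le)
      show "norm (k *\<^sub>R h t) \<le> B * norm k" for k
        using mult_right_mono[OF B[OF that], of "\<bar>k\<bar>"] by (simp add: mult.commute)
    qed
  qed auto
  then show ?thesis by simp
qed

text \<open>Picard iteration as a contraction. Existence suffices, since integral curves serve only
  to realise a prescribed initial position and velocity.\<close>

lemma integral_curve_exists_lipschitz:
  fixes F :: "'a::euclidean_space \<Rightarrow> 'a"
  assumes r: "r > 0" and L: "L \<ge> 0"
    and lip: "\<And>y z. y \<in> cball y0 r \<Longrightarrow> z \<in> cball y0 r \<Longrightarrow> norm (F y - F z) \<le> L * norm (y - z)"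
  obtains e \<phi> where "e > 0" "\<phi> 0 = y0"
    "\<And>t. t \<in> {-e<..<e} \<Longrightarrow> \<phi> t \<in> cball y0 r"
    "\<And>t. t \<in> {-e<..<e} \<Longrightarrow> (\<phi> has_vector_derivative F (\<phi> t)) (at t)"
proof -
  define B where "B = norm (F y0) + L * r"
  have B0: "B \<ge> 0" using r L by (simp add: B_def)
  have B: "norm (F y) \<le> B" if "y \<in> cball y0 r" for y
  proof -
    have "norm (F y - F y0) \<le> L * norm (y - y0)" using lip that r by auto
    also have "\<dots> \<le> L * r"
      using that L by (intro mult_left_mono) (auto simp: dist_norm norm_minus_commute)
    finally show ?thesis using norm_triangle_ineq2[of "F y" "F y0"] by (simp add: B_def)
  qed
  have contF: "continuous_on (cball y0 r) F"
    unfolding continuous_on_iff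
  proof (intro ballI allI impI)
    fix x e assume x: "x \<in> cball y0 r" and e: "(e::real) > 0"
    show "\<exists>d>0. \<forall>x'\<in>cball y0 r. dist x' x < d \<longrightarrow> dist (F x') (F x) < e"
    proof (intro exI[of _ "e / (L + 1)"] conjI ballI impI)
      show "e / (L + 1) > 0" using e L by simp
      fix y assume y: "y \<in> cball y0 r" "dist y x < e / (L + 1)"
      have "dist (F y) (F x) \<le> L * dist y x" using lip[OF y(1) x] by (simp add: dist_norm)
      also have "\<dots> \<le> (L + 1) * dist y x" by (simp add: distrib_right)
      also have "\<dots> < e" using y(2) L by (simp add: field_simps)
      finally show "dist (F y) (F x) < e" .
    qed
  qed
  \<comment> \<open>The first bound keeps the iterates in the ball, the second makes the iteration
    contract by \<open>1 / 2\<close>; each added \<open>1\<close> avoids division by zero.\<close>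
  define e where "e = min (r / (B + 1)) (1 / (2 * (L + 1)))"
  have e: "e > 0" using r B0 L by (simp add: e_def)
  have eB: "B * e \<le> r"
  proof -
    have "B * e \<le> (B + 1) * (r / (B + 1))"
      using B0 e by (intro mult_mono) (auto simp: e_def)
    then show ?thesis using B0 by simp
  qed
  have eL: "L * e \<le> 1 / 2"
  proof -
    have "L * e \<le> (L + 1) * (1 / (2 * (L + 1)))"
      using L e by (intro mult_mono) (auto simp: e_def)
    also have "\<dots> = 1 / 2" using L by (simp add: field_simps)
    finally show ?thesis .
  qed
  \<comment> \<open>Clamping time turns the candidates into bounded continuous functions on all of
    \<open>real\<close>, a complete space.\<close>
  define cl where "cl t = max (- e) (min e t)" for t :: real
  have cl: "cl t \<in> {-e..e}" for t using e by (auto simp: cl_def)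
  have cl_id: "cl t = t" if "t \<in> {-e..e}" for t using that by (auto simp: cl_def)
  have contcl: "continuous_on UNIV cl" unfolding cl_def by (intro continuous_intros)
  have zero: "0 \<in> {-e..e}" using e by simp
  let ?I = "\<lambda>h t. integral {-e..t} h - integral {-e..0} h"
  define P where "P \<phi> t = y0 + ?I (\<lambda>s. F (\<phi> s)) (cl t)" for \<phi> t
  let ?X = "PiC UNIV (\<lambda>_. cball y0 r) :: (real \<Rightarrow>\<^sub>C 'a) set"
  have X: "apply_bcontfun \<phi> t \<in> cball y0 r" if "\<phi> \<in> ?X" for \<phi> t
    using that by (auto simp: mem_PiC_iff)
  have cF: "continuous_on {-e..e} (\<lambda>s. F (apply_bcontfun \<phi> s))" if "\<phi> \<in> ?X" for \<phi>
    by (rule continuous_on_compose2[OF contF]) (use X[OF that] in auto)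
  have Pball: "P (apply_bcontfun \<phi>) t \<in> cball y0 r" if "\<phi> \<in> ?X" for \<phi> t
  proof -
    have "norm (?I (\<lambda>s. F (apply_bcontfun \<phi> s)) (cl t)) \<le> B * \<bar>cl t - 0\<bar>"
      by (rule integral_increment_bound[OF cF[OF that] _ zero cl]) (use B X[OF that] in auto)
    also have "\<dots> \<le> B * e" using cl[of t] B0 by (intro mult_left_mono) auto
    finally show ?thesis using eB by (simp add: P_def dist_norm norm_minus_commute)
  qed
  have Pcont: "continuous_on UNIV (P (apply_bcontfun \<phi>))" if "\<phi> \<in> ?X" for \<phi>
  proof -
    have "continuous_on {-e..e} (\<lambda>t. integral {-e..t} (\<lambda>s. F (apply_bcontfun \<phi> s)))"
      by (intro indefinite_integral_continuous_1 integrable_continuous_real cF that)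
    then have "continuous_on UNIV (\<lambda>t. integral {-e..cl t} (\<lambda>s. F (apply_bcontfun \<phi> s)))"
      by (rule continuous_on_compose2[OF _ contcl]) (use cl in auto)
    then show ?thesis unfolding P_def by (intro continuous_intros)
  qed
  have Pb: "P (apply_bcontfun \<phi>) \<in> bcontfun" if "\<phi> \<in> ?X" for \<phi>
    using Pcont[OF that] Pball[OF that] bounded_subset[OF bounded_cball]
    by (auto simp: bcontfun_def intro!: bounded_subset[OF bounded_cball[of y0 r]])
  define Q where "Q \<phi> = Bcontfun (P (apply_bcontfun \<phi>))" for \<phi> :: "real \<Rightarrow>\<^sub>C 'a"
  have Q: "apply_bcontfun (Q \<phi>) = P (apply_bcontfun \<phi>)" if "\<phi> \<in> ?X" for \<phi>
    unfolding Q_def by (rule Bcontfun_inverse[OF Pb[OF that]])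
  have "\<exists>!\<phi>\<in>?X. Q \<phi> = \<phi>"
  proof (rule Banach_fix[where c = "1 / 2"])
    show "complete ?X"
      by (rule complete_eq_closed[THEN iffD2]) (rule closed_PiC, auto)
    have "const_bcontfun y0 \<in> ?X" using r by (simp add: mem_PiC_iff const_bcontfun.rep_eq)
    then show "?X \<noteq> {}" by blast
    show "Q ` ?X \<subseteq> ?X" using Pball by (auto simp: mem_PiC_iff Q)
    fix \<phi> \<psi> assume p: "\<phi> \<in> ?X" "\<psi> \<in> ?X"
    show "dist (Q \<phi>) (Q \<psi>) \<le> 1 / 2 * dist \<phi> \<psi>"
    proof (rule dist_bound)
      fix t
      let ?f = "\<lambda>s. F (apply_bcontfun \<phi> s)" and ?g = "\<lambda>s. F (apply_bcontfun \<psi> s)"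
      have int: "?f integrable_on {-e..t}" "?g integrable_on {-e..t}" if "t \<in> {-e..e}" for t
        using that by (auto intro!: integrable_continuous_real continuous_on_subset[OF cF[OF p(1)]]
            continuous_on_subset[OF cF[OF p(2)]])
      have "dist (Q \<phi> t) (Q \<psi> t) = norm (?I ?f (cl t) - ?I ?g (cl t))"
        by (simp add: Q p P_def dist_norm)
      also have "?I ?f (cl t) - ?I ?g (cl t) = ?I (\<lambda>s. ?f s - ?g s) (cl t)"
        using integral_diff[OF int[OF cl]] integral_diff[OF int[OF zero]] by simp
      also have "norm \<dots> \<le> (L * dist \<phi> \<psi>) * \<bar>cl t - 0\<bar>"
      proof (rule integral_increment_bound[OF _ _ zero cl])
        show "continuous_on {-e..e} (\<lambda>s. ?f s - ?g s)" by (intro continuous_intros cF p)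
        fix s
        have "norm (?f s - ?g s) \<le> L * norm (\<phi> s - \<psi> s)" by (intro lip X p)
        also have "\<dots> \<le> L * dist \<phi> \<psi>"
          using dist_bounded[of \<phi> s \<psi>] L by (intro mult_left_mono) (auto simp: dist_norm)
        finally show "norm (?f s - ?g s) \<le> L * dist \<phi> \<psi>" .
      qed
      also have "\<dots> \<le> (L * dist \<phi> \<psi>) * e"
        using cl[of t] L by (intro mult_left_mono) auto
      also have "\<dots> = (L * e) * dist \<phi> \<psi>" by simp
      also have "\<dots> \<le> 1 / 2 * dist \<phi> \<psi>" using eL by (intro mult_right_mono) auto
      finally show "dist (Q \<phi> t) (Q \<psi> t) \<le> 1 / 2 * dist \<phi> \<psi>" .
    qed
  qed auto
  then obtain \<phi> where \<phi>: "\<phi> \<in> ?X" "Q \<phi> = \<phi>" by blast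
  have fix': "apply_bcontfun \<phi> t = P (apply_bcontfun \<phi>) t" for t using Q[OF \<phi>(1)] \<phi>(2) by simp
  show ?thesis
  proof (rule that[OF e, of "apply_bcontfun \<phi>"])
    show "apply_bcontfun \<phi> 0 = y0" using fix'[of 0] by (simp add: P_def cl_id[OF zero])
    show "apply_bcontfun \<phi> t \<in> cball y0 r" for t by (rule X[OF \<phi>(1)])
    show "(apply_bcontfun \<phi> has_vector_derivative F (apply_bcontfun \<phi> t)) (at t)"
      if t: "t \<in> {-e<..<e}" for t
    proof -
      have t': "t \<in> {-e..e}" using t by auto
      have "((\<lambda>t. integral {-e..t} (\<lambda>s. F (\<phi> s))) has_vector_derivative F (\<phi> t)) (at t within {-e..e})"
        by (rule integral_has_vector_derivative[OF cF[OF \<phi>(1)] t'])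
      moreover have "at t within {-e..e} = at t"
        by (rule at_within_interior) (use t in simp)
      ultimately have "((\<lambda>t. integral {-e..t} (\<lambda>s. F (\<phi> s))) has_vector_derivative F (\<phi> t)) (at t)"
        by simp
      then have "((\<lambda>t. y0 + ?I (\<lambda>s. F (\<phi> s)) t) has_vector_derivative F (\<phi> t)) (at t)"
        by (auto intro!: derivative_eq_intros)
      then show ?thesis
      proof (rule has_vector_derivative_transform_within_open[OF _ open_greaterThanLessThan t])
        fix s assume "s \<in> {-e<..<e}"
        then show "y0 + ?I (\<lambda>s. F (\<phi> s)) s = \<phi> s"
          using fix'[of s] cl_id[of s] by (simp add: P_def)
      qed
    qed
  qed
qed

text \<open>Bootstrapping: the derivative is \<open>F\<close> composed with the curve, so each order
  of smoothness yields the next.\<close>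

lemma smooth_on_integral_curve:
  fixes F :: "'a::euclidean_space \<Rightarrow> 'a"
  assumes F: "smooth_on T F" and I: "open I" and T: "\<And>t. t \<in> I \<Longrightarrow> \<phi> t \<in> T"
    and d: "\<And>t. t \<in> I \<Longrightarrow> (\<phi> has_vector_derivative F (\<phi> t)) (at t)"
  shows "smooth_on I \<phi>"
proof -
  have "ck_on k I \<phi>" for k
  proof (induction k)
    case 0
    then show ?case
      using has_vector_derivative_continuous[OF d] by (auto intro!: continuous_at_imp_continuous_on)
  next
    case (Suc k)
    show ?case
    proof (rule ck_on_SucI[OF I])
      show "(\<phi> has_derivative (\<lambda>h. h *\<^sub>R F (\<phi> t))) (at t)" if "t \<in> I" for t
        using d[OF that] by (simp add: has_vector_derivative_def)
      show "ck_on k I (\<lambda>t. h *\<^sub>R F (\<phi> t))" for h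
        by (rule ck_on_bounded_linear[OF bounded_linear_scaleR_right I
              ck_on_compose[OF I Suc smooth_on_D[OF F] T]])
    qed
  qed
  then show ?thesis by (simp add: smooth_on_def)
qed

lemma integral_curve_exists:
  fixes F :: "'a::euclidean_space \<Rightarrow> 'a"
  assumes F: "smooth_on T F" and T: "open T" "y0 \<in> T"
  obtains e \<phi> where "e > 0" "\<phi> 0 = y0" "\<And>t. t \<in> {-e<..<e} \<Longrightarrow> \<phi> t \<in> T"
    "\<And>t. t \<in> {-e<..<e} \<Longrightarrow> (\<phi> has_vector_derivative F (\<phi> t)) (at t)"
    "smooth_on {-e<..<e} \<phi>"
proof -
  obtain r L where r: "r > 0" "L \<ge> 0" "cball y0 r \<subseteq> T"
    and lip: "\<And>y z. y \<in> cball y0 r \<Longrightarrow> z \<in> cball y0 r \<Longrightarrow> norm (F y - F z) \<le> L * norm (y - z)"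
    using smooth_locally_lipschitz[OF F T] by blast
  obtain e \<phi> where e: "e > 0" "\<phi> 0 = y0" "\<And>t. t \<in> {-e<..<e} \<Longrightarrow> \<phi> t \<in> cball y0 r"
    "\<And>t. t \<in> {-e<..<e} \<Longrightarrow> (\<phi> has_vector_derivative F (\<phi> t)) (at t)"
    using integral_curve_exists_lipschitz[OF r(1,2) lip] by blast
  have T': "\<phi> t \<in> T" if "t \<in> {-e<..<e}" for t using e(3)[OF that] r(3) by blast
  show ?thesis
    by (rule that[OF e(1,2) T' e(4) smooth_on_integral_curve[OF F open_greaterThanLessThan T' e(4)]])
qed

subsection \<open>Solutions of linear systems with smooth coefficients\<close>

text \<open>\<open>p\<close> is not assumed differentiable: \<open>q\<close> is already of first
  order at \<open>x\<close>, so convergence of \<open>p\<close> to 0 makes the product of smaller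
  order. Below, \<open>p\<close> is a component of a solution known only to be continuous.\<close>

lemma has_derivative_mult_vanishing:
  fixes q :: "'a::real_normed_vector \<Rightarrow> 'b::real_normed_vector" and p :: "'a \<Rightarrow> real"
  assumes q: "(q has_derivative q') (at x)" "q x = 0" and p: "(p \<longlongrightarrow> 0) (at x)"
  shows "((\<lambda>y. p y *\<^sub>R q y) has_derivative (\<lambda>_. 0)) (at x)"
proof -
  let ?r = "\<lambda>y. ((q y - q x) - q' (y - x)) /\<^sub>R norm (y - x)"
  have r: "(?r \<longlongrightarrow> 0) (at x)" and bl: "bounded_linear q'"
    using q(1) by (auto simp: has_derivative_at_within)
  obtain K where K: "0 \<le> K" "\<And>h. norm (q' h) \<le> norm h * K"
    using bounded_linear.nonneg_bounded[OF bl] by blast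
  have "((\<lambda>y. p y *\<^sub>R (q' (y - x) /\<^sub>R norm (y - x))) \<longlongrightarrow> 0) (at x)"
  proof (rule tendsto_0_le[OF p, of _ K], rule always_eventually, rule allI)
    fix y
    have "norm (q' (y - x) /\<^sub>R norm (y - x)) \<le> K"
      using K(2)[of "y - x"] K(1) by (cases "y = x") (simp_all add: divide_simps mult.commute)
    then show "norm (p y *\<^sub>R (q' (y - x) /\<^sub>R norm (y - x))) \<le> norm (p y) * K"
      unfolding norm_scaleR[of "p y"] real_norm_def by (rule mult_left_mono) simp
  qed
  then have "((\<lambda>y. p y *\<^sub>R ?r y + p y *\<^sub>R (q' (y - x) /\<^sub>R norm (y - x))) \<longlongrightarrow> 0 *\<^sub>R 0 + 0) (at x)"
    by (intro tendsto_add tendsto_scaleR p r)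
  moreover have "p y *\<^sub>R ?r y + p y *\<^sub>R (q' (y - x) /\<^sub>R norm (y - x))
      = ((p y *\<^sub>R q y - p x *\<^sub>R q x) - 0) /\<^sub>R norm (y - x)" for y
    using q(2) by (simp add: scaleR_diff_right mult.commute)
  ultimately show ?thesis
    unfolding has_derivative_at_within by simp
qed

text \<open>A solution \<open>u\<close> of a linear system inherits the regularity of the
  coefficients and of the right-hand side. With \<open>L y\<close> the matrix of \<open>B y\<close>,
  the increment \<open>u y - u x\<close> is the inverse of \<open>L x\<close> applied to
  \<open>m y - r y\<close>, where \<open>m\<close> is known and \<open>r\<close> is
  negligible.\<close>

lemma linear_system_solution:
  fixes B :: "'a::real_normed_vector \<Rightarrow> 'e::euclidean_space \<Rightarrow> 'e \<Rightarrow> real" and u :: "'a \<Rightarrow> 'e"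
  assumes S: "open S" "x \<in> S" and bil: "\<And>y. y \<in> S \<Longrightarrow> bilinear (B y)"
    and nd: "\<And>v. (\<And>w. B x v w = 0) \<Longrightarrow> v = 0"
    and B: "\<And>v w. isCont (\<lambda>y. B y v w) x"
    and k: "\<And>w. isCont (\<lambda>y. B y (u y) w) x"
  shows linear_system_solution_continuous: "isCont u x"
    and linear_system_solution_differentiable:
      "(\<And>v w. (\<lambda>y. B y v w) differentiable (at x)) \<Longrightarrow>
       (\<And>w. (\<lambda>y. B y (u y) w) differentiable (at x)) \<Longrightarrow> u differentiable (at x)"
proof -
  define L where "L y v = (\<Sum>b\<in>Basis. B y v b *\<^sub>R b)" for y v
  have linL: "linear (L y)" if "y \<in> S" for y
    unfolding L_def
    by (rule linearI)
      (simp_all add: bilinear_ladd[OF bil[OF that]] bilinear_lmul[OF bil[OF that]] scaleR_add_left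
        sum.distrib scaleR_sum_right)
  have "inj (L x)"
    unfolding linear_injective_0[OF linL[OF S(2)]]
  proof (intro allI impI nd)
    fix v w assume v: "L x v = 0"
    have b: "B x v b = 0" if "b \<in> Basis" for b
      using arg_cong[OF v, of "\<lambda>z. z \<bullet> b"] that by (simp add: L_def)
    have "linear (B x v)" using bil[OF S(2)] by (simp add: bilinear_def)
    then show "B x v w = 0"
      using linear_eq_sum_Basis[of "B x v" w] b by simp
  qed
  then obtain c where c: "c > 0" "\<And>v. c * norm v \<le> norm (L x v)"
    using linear_inj_bounded_below_pos[OF linL[OF S(2)]] by blast
  obtain Li where Li: "linear Li" "\<And>v. Li (L x v) = v"
    using linear_injective_left_inverse[OF linL[OF S(2)] \<open>inj (L x)\<close>] by (auto simp: fun_eq_iff)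
  define M where "M y = (\<Sum>b\<in>Basis. \<Sum>a\<in>Basis. \<bar>B y a b - B x a b\<bar>)" for y
  have "(M \<longlongrightarrow> (\<Sum>b\<in>Basis. \<Sum>a\<in>(Basis::'e set). \<bar>B x a b - B x a b\<bar>)) (at x)"
    unfolding M_def using B by (intro tendsto_intros) (simp add: isCont_def)
  then have M0: "(M \<longlongrightarrow> 0) (at x)" by simp
  have diffL: "L y v - L x v = (\<Sum>b\<in>Basis. \<Sum>a\<in>Basis. ((v \<bullet> a) * (B y a b - B x a b)) *\<^sub>R b)"
    if "y \<in> S" for y v
  proof -
    have "B z v b = (\<Sum>a\<in>Basis. (v \<bullet> a) * B z a b)" if "z \<in> S" for z b
      using linear_eq_sum_Basis[of "\<lambda>v. B z v b" v] bil[OF that] by (simp add: bilinear_def)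
    then show ?thesis
      unfolding L_def using that S(2)
      by (simp add: sum_subtractf[symmetric] scaleR_sum_left scaleR_diff_left[symmetric] right_diff_distrib)
  qed
  have bound: "norm (L y v - L x v) \<le> norm v * M y" if "y \<in> S" for y v
    unfolding diffL[OF that] M_def sum_distrib_left
    by (intro sum_norm_le) (simp add: abs_mult mult_right_mono Basis_le_norm)
  have ev: "\<forall>\<^sub>F y in at x. y \<in> S \<and> M y < c / 2"
    by (rule eventually_conj[OF eventually_at_in_open'[OF S(1,2)] order_tendstoD(2)[OF M0]])
      (use c in simp)
  define m where "m y = L y (u y) - L y (u x)" for y
  \<comment> \<open>Where \<open>M y < c / 2\<close>, the lower bound \<open>c\<close> of
    \<open>L x\<close> leaves the lower bound \<open>c / 2\<close> for \<open>L y\<close>.\<close>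
  have um: "norm (u y - u x) \<le> 2 / c * norm (m y)" if y: "y \<in> S" "M y < c / 2" for y
  proof -
    let ?v = "u y - u x"
    have "c * norm ?v \<le> norm (L y ?v) + norm (L y ?v - L x ?v)"
      using c(2)[of ?v] norm_triangle_ineq4[of "L y ?v" "L y ?v - L x ?v"] by simp
    also have "\<dots> \<le> norm (L y ?v) + norm ?v * (c / 2)"
      using bound[OF y(1), of ?v] y(2) mult_left_mono[of "M y" "c / 2" "norm ?v"] by simp
    finally have "norm ?v * (c / 2) \<le> norm (L y ?v)" by (simp add: algebra_simps)
    then show ?thesis
      using c(1) by (simp add: m_def linear_diff[OF linL[OF y(1)], symmetric] field_simps)
  qed
  have "isCont m x"
    unfolding m_def L_def by (intro continuous_intros B k)
  then have m0: "(m \<longlongrightarrow> 0) (at x)"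
    by (simp add: isCont_def m_def)
  have "((\<lambda>y. u y - u x) \<longlongrightarrow> 0) (at x)"
    by (rule tendsto_0_le[OF m0, of _ "2 / c"], rule eventually_mono[OF ev])
      (use um in \<open>auto simp: mult.commute\<close>)
  then show cont: "isCont u x"
    by (simp add: isCont_def LIM_zero_iff)
  assume dB: "\<And>v w. (\<lambda>y. B y v w) differentiable (at x)"
    and dk: "\<And>w. (\<lambda>y. B y (u y) w) differentiable (at x)"
  have dm: "(\<lambda>y. m y) differentiable (at x)"
    unfolding m_def L_def
    using dB dk by (intro differentiable_diff differentiable_sum differentiable_scaleR) auto
  \<comment> \<open>The error of replacing \<open>L y\<close> by \<open>L x\<close> on the
    increment. In every summand one factor tends to 0 by continuity of \<open>u\<close> and the
    other is differentiable and vanishes at \<open>x\<close>, so the derivative of \<open>r\<close>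
    is 0.\<close>
  define r where "r y = (\<Sum>b\<in>Basis. \<Sum>a\<in>Basis. (((u y - u x) \<bullet> a) * (B y a b - B x a b)) *\<^sub>R b)" for y
  have "((\<lambda>y. (((u y - u x) \<bullet> a) *\<^sub>R (B y a b - B x a b)) *\<^sub>R b) has_derivative (\<lambda>_. 0 *\<^sub>R b)) (at x)" for a b
  proof (intro has_derivative_scaleR_left has_derivative_mult_vanishing)
    show "((\<lambda>y. B y a b - B x a b) has_derivative (\<lambda>h. frechet_derivative (\<lambda>y. B y a b) (at x) h - 0)) (at x)"
      by (intro has_derivative_diff has_derivative_frechet dB has_derivative_const)
    show "((\<lambda>y. (u y - u x) \<bullet> a) \<longlongrightarrow> 0) (at x)"
      using tendsto_inner[OF \<open>((\<lambda>y. u y - u x) \<longlongrightarrow> 0) (at x)\<close> tendsto_const[of a]] by simp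
  qed simp
  then have "(\<lambda>y. (((u y - u x) \<bullet> a) * (B y a b - B x a b)) *\<^sub>R b) differentiable (at x)" for a b
    by (auto simp: differentiable_def)
  then have dr: "r differentiable (at x)"
    unfolding r_def by (intro differentiable_sum) auto
  have "bounded_linear Li" using Li(1) by (rule linear_conv_bounded_linear[THEN iffD1])
  then have d: "(\<lambda>y. u x + Li (m y - r y)) differentiable (at x)"
    using bounded_linear.has_derivative[of Li] has_derivative_frechet[OF differentiable_diff[OF dm dr]]
    by (intro differentiable_add differentiable_const) (auto simp: differentiable_def)
  have "u y = u x + Li (m y - r y)" if "y \<in> S" for y
  proof -
    have "m y = L y (u y - u x)" by (simp add: m_def linear_diff[OF linL[OF that]])
    moreover have "r y = L y (u y - u x) - L x (u y - u x)" by (simp add: r_def diffL[OF that])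
    ultimately have "m y - r y = L x (u y - u x)" by simp
    then show ?thesis using Li(2)[of "u y - u x"] by simp
  qed
  then show "u differentiable (at x)"
    by (rule frechet_derivative_cong_open(1)[OF S]) (assumption, rule d)
qed

text \<open>Differentiating the system shows that a directional derivative of \<open>u\<close>
  solves a system with the same \<open>B\<close>, whose right-hand side involves only
  \<open>u\<close> and derivatives of known functions. Hence the induction over the order, for all
  \<open>u\<close> at once.\<close>

lemma smooth_on_linear_system_solution:
  fixes B :: "'a::real_normed_vector \<Rightarrow> 'e::euclidean_space \<Rightarrow> 'e \<Rightarrow> real" and u :: "'a \<Rightarrow> 'e"
  assumes S: "open S" and bil: "\<And>y. y \<in> S \<Longrightarrow> bilinear (B y)"
    and nd: "\<And>y v. y \<in> S \<Longrightarrow> (\<And>w. B y v w = 0) \<Longrightarrow> v = 0"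
    and B: "\<And>v w. smooth_on S (\<lambda>y. B y v w)"
    and k: "\<And>w. smooth_on S (\<lambda>y. B y (u y) w)"
  shows "smooth_on S u"
proof -
  have cB: "isCont (\<lambda>y. B y v w) x" if "x \<in> S" for x v w
    using smooth_on_imp_continuous_on[OF B] S that by (simp add: continuous_on_eq_continuous_at)
  have "ck_on n S u" if "\<And>w. ck_on n S (\<lambda>y. B y (u y) w)" for n u
    using that
  proof (induction n arbitrary: u)
    case 0
    have "isCont u x" if x: "x \<in> S" for x
    proof (rule linear_system_solution_continuous[OF S x bil nd[OF x] cB[OF x]])
      show "isCont (\<lambda>y. B y (u y) w) x" for w
        using 0[of w] S x by (simp add: continuous_on_eq_continuous_at)
    qed
    then show ?case by (simp add: continuous_at_imp_continuous_on)
  next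
    case (Suc n)
    let ?D = "\<lambda>v w x. frechet_derivative (\<lambda>y. B y v w) (at x)"
    have du: "u differentiable (at x)" if x: "x \<in> S" for x
    proof (rule linear_system_solution_differentiable[OF S x bil nd[OF x] cB[OF x]])
      show "isCont (\<lambda>y. B y (u y) w) x" for w
        using ck_on_imp_continuous_on[OF Suc.prems] S x by (simp add: continuous_on_eq_continuous_at)
      show "(\<lambda>y. B y v w) differentiable (at x)" for v w
        using smooth_on_has_derivative[OF B x] by (auto simp: differentiable_def)
      show "(\<lambda>y. B y (u y) w) differentiable (at x)" for w using Suc.prems x by simp
    qed
    show ?case
    proof (rule ck_on_SucI[OF S has_derivative_frechet[OF du]])
      fix z
      have cu: "ck_on n S u" by (rule Suc.IH) (use Suc.prems ck_on_Suc_D in blast)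
      show "ck_on n S (\<lambda>x. frechet_derivative u (at x) z)"
      proof (rule Suc.IH)
        fix w
        have e: "B x (frechet_derivative u (at x) z) w =
            frechet_derivative (\<lambda>y. B y (u y) w) (at x) z - (\<Sum>a\<in>Basis. (u x \<bullet> a) *\<^sub>R ?D a w x z)"
          if x: "x \<in> S" for x
        proof -
          have "((\<lambda>y. B y (u y) w) has_derivative
              (\<lambda>z. (\<Sum>a\<in>Basis. (u x \<bullet> a) *\<^sub>R ?D a w x z + (frechet_derivative u (at x) z \<bullet> a) *\<^sub>R B x a w))) (at x)"
            (is "(_ has_derivative ?E) _")
          proof (rule has_derivative_transform_within_open[OF _ S x])
            show "((\<lambda>y. \<Sum>a\<in>Basis. (u y \<bullet> a) *\<^sub>R B y a w) has_derivative ?E) (at x)"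
              by (intro has_derivative_sum has_derivative_scaleR has_derivative_inner_left
                  has_derivative_frechet[OF du[OF x]] smooth_on_has_derivative[OF B x])
            fix y assume "y \<in> S"
            then have "linear (\<lambda>v. B y v w)" using bil by (simp add: bilinear_def)
            then show "(\<Sum>a\<in>Basis. (u y \<bullet> a) *\<^sub>R B y a w) = B y (u y) w"
              using linear_eq_sum_Basis[of "\<lambda>v. B y v w" "u y"] by simp
          qed
          moreover have "linear (\<lambda>v. B x v w)" using bil[OF x] by (simp add: bilinear_def)
          ultimately show ?thesis
            using linear_eq_sum_Basis[of "\<lambda>v. B x v w" "frechet_derivative u (at x) z"]
            by (simp add: frechet_derivative_eqI sum.distrib)
        qed
        have "ck_on n S (\<lambda>x. frechet_derivative (\<lambda>y. B y (u y) w) (at x) z)"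
          using Suc.prems[of w] by simp
        moreover have "ck_on n S (\<lambda>x. (u x \<bullet> a) *\<^sub>R ?D a w x z)" for a
          by (rule ck_on_bilinear[OF bounded_bilinear_scaleR S
                ck_on_bounded_linear[OF bounded_linear_inner_left S cu]
                smooth_on_D[OF smooth_on_derivative[OF B]]])
        ultimately have "ck_on n S (\<lambda>x. frechet_derivative (\<lambda>y. B y (u y) w) (at x) z
            + - 1 *\<^sub>R (\<Sum>a\<in>Basis. (u x \<bullet> a) *\<^sub>R ?D a w x z))"
          by (intro ck_on_add ck_on_sum S ck_on_bounded_linear[OF bounded_linear_scaleR_right])
        then show "ck_on n S (\<lambda>x. B x (frechet_derivative u (at x) z) w)"
          by (rule ck_on_cong[OF S, rotated]) (simp add: e)
      qed
    qed
  qed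
  then show ?thesis using k by (simp add: smooth_on_def)
qed

section \<open>Hermitian forms\<close>

definition complex_linear :: "(complex ^ 'n \<Rightarrow> complex ^ 'm) \<Rightarrow> bool" where
  "complex_linear T \<longleftrightarrow> (\<forall>v w. T (v + w) = T v + T w) \<and> (\<forall>c v. T (c *s v) = c *s T v)"

text \<open>No positivity is asked, as the metrics have arbitrary signature.\<close>

definition hermitian_form :: "(complex ^ 'n \<Rightarrow> complex ^ 'n \<Rightarrow> complex) \<Rightarrow> bool" where
  "hermitian_form h \<longleftrightarrow>
     (\<forall>u v w. h (u + v) w = h u w + h v w) \<and> (\<forall>c v w. h (c *s v) w = c * h v w) \<and>
     (\<forall>v w. h w v = cnj (h v w))"

definition nondegenerate_form :: "(complex ^ 'n \<Rightarrow> complex ^ 'n \<Rightarrow> complex) \<Rightarrow> bool" where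
  "nondegenerate_form h \<longleftrightarrow> (\<forall>v. (\<forall>w. h v w = 0) \<longrightarrow> v = 0)"

definition complex_trace :: "(complex ^ 'n \<Rightarrow> complex ^ 'n) \<Rightarrow> complex" where
  "complex_trace T = (\<Sum>i\<in>UNIV. T (axis i 1) $ i)"

lemma scaleR_eq_of_real_scale: "r *\<^sub>R (v :: complex ^ 'n) = of_real r *s v"
  by (simp add: vec_eq_iff complex_eq_iff)

lemma complex_linear_add: "complex_linear T \<Longrightarrow> T (v + w) = T v + T w"
  and complex_linear_scale: "complex_linear T \<Longrightarrow> T (c *s v) = c *s T v"
  by (simp_all add: complex_linear_def)

lemma complex_linear_imp_linear: "complex_linear T \<Longrightarrow> linear T"
  by (rule linearI) (simp_all add: complex_linear_def scaleR_eq_of_real_scale)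

lemma complex_linear_sum: "complex_linear T \<Longrightarrow> T (\<Sum>i\<in>I. f i) = (\<Sum>i\<in>I. T (f i))"
  by (rule linear_sum[OF complex_linear_imp_linear])

lemma complex_linear_compose: "complex_linear S \<Longrightarrow> complex_linear T \<Longrightarrow> complex_linear (\<lambda>v. S (T v))"
  by (simp add: complex_linear_def)

lemma vec_eq_sum_axis: "(v :: complex ^ 'n) = (\<Sum>i\<in>UNIV. v $ i *s axis i 1)"
  by (simp add: vec_eq_iff axis_def if_distrib[of "\<lambda>x. _ * x"] cong: if_cong)

lemma complex_linear_eq_sum_axis:
  assumes "complex_linear T"
  shows "T v = (\<Sum>i\<in>UNIV. v $ i *s T (axis i 1))"
proof -
  have "T v = T (\<Sum>i\<in>UNIV. v $ i *s axis i 1)" using vec_eq_sum_axis[of v] by simp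
  then show ?thesis using assms by (simp add: complex_linear_sum complex_linear_scale)
qed

lemma complex_trace_commute:
  fixes S T :: "complex ^ 'n \<Rightarrow> complex ^ 'n"
  assumes "complex_linear S" "complex_linear T"
  shows "complex_trace (\<lambda>v. S (T v)) = complex_trace (\<lambda>v. T (S v))"
proof -
  have e: "F (G (axis i 1)) $ i = (\<Sum>j\<in>UNIV. G (axis i 1) $ j * F (axis j 1) $ i)"
    if "complex_linear F" for F G :: "complex ^ 'n \<Rightarrow> complex ^ 'n" and i
    using complex_linear_eq_sum_axis[OF that, of "G (axis i 1)"] by simp
  show ?thesis
    unfolding complex_trace_def e[OF assms(1)] e[OF assms(2)]
    by (subst sum.swap) (simp add: mult.commute)
qed

context
  fixes h :: "complex ^ 'n \<Rightarrow> complex ^ 'n \<Rightarrow> complex"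
  assumes h: "hermitian_form h"
begin

lemma hermitian_form_cnj: "cnj (h v w) = h w v"
  using h unfolding hermitian_form_def by metis

lemma hermitian_form_add_left: "h (u + v) w = h u w + h v w"
  and hermitian_form_scale_left: "h (c *s v) w = c * h v w"
  using h unfolding hermitian_form_def by blast+

lemma hermitian_form_add_right: "h w (u + v) = h w u + h w v"
  and hermitian_form_scale_right: "h w (c *s v) = cnj c * h w v"
  using hermitian_form_add_left[of u v w] hermitian_form_scale_left[of c v w] hermitian_form_cnj
  by (metis complex_cnj_add, metis complex_cnj_mult)

lemma hermitian_form_minus_left: "h (- v) w = - h v w"
  using hermitian_form_scale_left[of "-1" v w] by simp

lemma hermitian_form_diff_left: "h (u - v) w = h u w - h v w"
  using hermitian_form_add_left[of u "- v" w] by (simp add: hermitian_form_minus_left)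

lemma hermitian_form_zero_left: "h 0 w = 0"
  using hermitian_form_scale_left[of 0 0 w] by simp

lemma hermitian_form_zero_right: "h w 0 = 0"
  using hermitian_form_scale_right[of w 0 0] by simp

lemma hermitian_form_sum_left: "h (\<Sum>i\<in>I. f i) w = (\<Sum>i\<in>I. h (f i) w)"
  by (induction I rule: infinite_finite_induct) (simp_all add: hermitian_form_add_left hermitian_form_zero_left)

lemma hermitian_form_eq_sum_axis_left: "h v w = (\<Sum>i\<in>UNIV. v $ i * h (axis i 1) w)"
proof -
  have "h v w = h (\<Sum>i\<in>UNIV. v $ i *s axis i 1) w" using vec_eq_sum_axis[of v] by simp
  then show ?thesis by (simp add: hermitian_form_sum_left hermitian_form_scale_left)
qed

end

context
  fixes h :: "complex ^ 'n \<Rightarrow> complex ^ 'n \<Rightarrow> complex"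
  assumes h: "hermitian_form h" and nd: "nondegenerate_form h"
begin

lemma nondegenerate_eqI:
  assumes "\<And>w. h u w = h v w"
  shows "u = v"
proof -
  have "\<forall>w. h (u - v) w = 0" by (simp add: hermitian_form_diff_left[OF h] assms)
  then have "u - v = 0" using nd unfolding nondegenerate_form_def by blast
  then show ?thesis by simp
qed

lemma nondegenerate_eqI_right:
  assumes "\<And>w. h w u = h w v"
  shows "u = v"
  by (rule nondegenerate_eqI) (metis assms hermitian_form_cnj[OF h])

text \<open>\<open>Re h\<close> is a nondegenerate real form, so \<open>dual_vector_unique\<close>
  represents \<open>Re f\<close>; evaluation at \<open>\<i> *s v\<close> recovers the imaginary
  part.\<close>

lemma riesz_representation:
  assumes add: "\<And>v w. f (v + w) = f v + f w" and scale: "\<And>c v. f (c *s v) = c * f v"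
  shows "\<exists>u. \<forall>v. f v = h v u"
proof -
  have "bilinear (\<lambda>v w. Re (h v w))"
    unfolding bilinear_def
    by (auto intro!: linearI simp: hermitian_form_add_left[OF h] hermitian_form_add_right[OF h]
        scaleR_eq_of_real_scale hermitian_form_scale_left[OF h] hermitian_form_scale_right[OF h])
  moreover have "v = 0" if v: "\<And>w. Re (h v w) = 0" for v
  proof -
    have "h v w = 0" for w
      using v[of w] v[of "\<i> *s w"] by (simp add: hermitian_form_scale_right[OF h] complex_eq_iff)
    then show ?thesis using nd by (simp add: nondegenerate_form_def)
  qed
  moreover have "linear (\<lambda>v. Re (f v))"
    by (rule linearI) (simp_all add: add scale scaleR_eq_of_real_scale)
  ultimately obtain u where u: "\<And>v. Re (h u v) = Re (f v)"
    using dual_vector_unique by blast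
  have "f v = h v u" for v
  proof (rule complex_eqI)
    have Re: "Re (f w) = Re (h w u)" for w
      using u[of w] arg_cong[OF hermitian_form_cnj[OF h, of w u], of Re] by simp
    show "Re (f v) = Re (h v u)" by (rule Re)
    show "Im (f v) = Im (h v u)"
      using Re[of "\<i> *s v"] by (simp add: scale hermitian_form_scale_left[OF h])
  qed
  then show ?thesis by blast
qed

lemma representing_endomorphism:
  assumes p: "hermitian_form p"
  obtains q where "complex_linear q" "\<And>v w. p v w = h (q v) w"
proof -
  have "\<exists>u. \<forall>w. p w v = h w u" for v
    by (rule riesz_representation)
      (simp_all add: hermitian_form_add_left[OF p] hermitian_form_scale_left[OF p])
  then obtain q where q: "\<And>v w. p w v = h w (q v)" by metis
  then have q': "p v w = h (q v) w" for v w
    by (metis hermitian_form_cnj[OF h] hermitian_form_cnj[OF p])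
  have "complex_linear q"
    unfolding complex_linear_def
    by (intro conjI allI; rule nondegenerate_eqI)
      (simp_all add: q'[symmetric] hermitian_form_add_left[OF p] hermitian_form_scale_left[OF p]
        hermitian_form_add_left[OF h] hermitian_form_scale_left[OF h])
  then show thesis using q' by (rule that)
qed

text \<open>If \<open>h _ y\<close> vanished wherever \<open>h _ u\<close> does, it would be a
  multiple of it, and nondegeneracy would make \<open>y\<close> a multiple of \<open>u\<close>. As
  \<open>u\<close> may be null, an auxiliary \<open>w0\<close> with \<open>h w0 u = 1\<close> takes
  the place of orthogonal projection along \<open>u\<close>.\<close>

lemma separating_vector:
  assumes "\<And>c. y \<noteq> c *s u"
  obtains w where "h w u = 0" "h w y = 1"
proof -
  have "\<exists>w. h w u = 0 \<and> h w y \<noteq> 0"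
  proof (rule ccontr)
    assume "\<not> ?thesis"
    then have c: "h w y = 0" if "h w u = 0" for w using that by blast
    have "u \<noteq> 0"
    proof
      assume "u = 0"
      then have "y = 0"
        using c by (intro nondegenerate_eqI_right)
          (simp add: hermitian_form_zero_right[OF h])
      then show False using assms[of 0] by simp
    qed
    then obtain w1 where w1: "h w1 u \<noteq> 0"
      using nondegenerate_eqI_right[of u 0] by (auto simp: hermitian_form_zero_right[OF h])
    define w0 where "w0 = (1 / h w1 u) *s w1"
    have w0: "h w0 u = 1" using w1 by (simp add: w0_def hermitian_form_scale_left[OF h])
    have "h w y = h w (cnj (h w0 y) *s u)" for w
      using c[of "w - h w u *s w0"] w0
      by (simp add: hermitian_form_diff_left[OF h] hermitian_form_scale_left[OF h] hermitian_form_scale_right[OF h])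
    then have "y = cnj (h w0 y) *s u" by (rule nondegenerate_eqI_right)
    then show False using assms by blast
  qed
  then obtain w where w: "h w u = 0" "h w y \<noteq> 0" by blast
  show thesis
    by (rule that[of "(1 / h w y) *s w"]) (use w in \<open>simp_all add: hermitian_form_scale_left[OF h]\<close>)
qed

text \<open>The Gram map \<open>K\<close> carries \<open>h\<close> to the standard form and
  conjugates \<open>T\<close> into \<open>S\<close>, the conjugate transpose of \<open>T'\<close>;
  conjugation preserves the trace.\<close>

lemma complex_trace_adjoint:
  assumes T: "complex_linear T" and adj: "\<And>v w. h (T v) w = h v (T' w)"
  shows "complex_trace T' = cnj (complex_trace T)"
proof -
  define K where "K v = (\<chi> i. h v (axis i 1))" for v
  have K: "complex_linear K"
    by (simp add: complex_linear_def K_def vec_eq_iff hermitian_form_add_left[OF h] hermitian_form_scale_left[OF h])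
  have hK: "h v w = (\<Sum>i\<in>UNIV. K v $ i * cnj (w $ i))" for v w
    using arg_cong[OF hermitian_form_eq_sum_axis_left[OF h, of w v], of cnj]
    by (simp add: K_def hermitian_form_cnj[OF h] mult.commute)
  have "inj K"
    unfolding linear_injective_0[OF complex_linear_imp_linear[OF K]]
    using nd hK by (simp add: nondegenerate_form_def)
  then have bij: "bij K"
    using linear_inj_imp_surj[OF complex_linear_imp_linear[OF K]] by (simp add: bij_def)
  define L where "L = inv K"
  have KL: "K (L v) = v" and LK: "L (K v) = v" for v
    using bij by (simp_all add: L_def bij_is_surj surj_f_inv_f bij_is_inj inv_f_f)
  have L: "complex_linear L"
    unfolding complex_linear_def
    by (intro conjI allI; rule injD[OF \<open>inj K\<close>])
      (simp_all add: KL complex_linear_add[OF K] complex_linear_scale[OF K])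
  define S where "S x = (\<chi> j. \<Sum>i\<in>UNIV. x $ i * cnj (T' (axis j 1) $ i))" for x :: "complex ^ 'n"
  have S: "complex_linear S"
    by (simp add: complex_linear_def S_def vec_eq_iff sum.distrib sum_distrib_left distrib_right mult.assoc)
  have KT: "K (T v) = S (K v)" for v
    by (simp add: vec_eq_iff S_def hK[symmetric]) (simp add: K_def adj)
  have "complex_trace T = complex_trace (\<lambda>v. L (S (K v)))"
    by (simp add: KT[symmetric] LK)
  also have "\<dots> = complex_trace (\<lambda>v. S (K (L v)))"
    by (rule complex_trace_commute[OF L complex_linear_compose[OF S K]])
  also have "\<dots> = (\<Sum>j\<in>UNIV. cnj (T' (axis j 1) $ j))"
    by (simp add: KL complex_trace_def S_def axis_def if_distrib[of "\<lambda>x. x * _"] cong: if_cong)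
  finally show ?thesis by (simp add: complex_trace_def)
qed

end

section \<open>The pointwise argument\<close>

text \<open>Two axis vectors share their eigenvalue because their sum is an eigenvector too.\<close>

lemma scalar_if_eigenvectors:
  assumes "complex_linear a" and ev: "\<And>u. \<exists>c. a u = c *s u"
  shows "\<exists>c. \<forall>u. a u = c *s u"
proof -
  obtain f where f: "\<And>u. a u = f u *s u" using ev by metis
  have fi: "f (axis i 1) = f (axis j 1)" for i j :: 'a
  proof (cases "i = j")
    case False
    let ?e = "axis i 1 :: complex ^ 'a" and ?d = "axis j 1 :: complex ^ 'a"
    have eq: "f (?e + ?d) *s (?e + ?d) = f ?e *s ?e + f ?d *s ?d"
      using complex_linear_add[OF assms(1), of ?e ?d] by (simp add: f)
    show ?thesis
      using arg_cong[OF eq, of "\<lambda>v. v $ i"] arg_cong[OF eq, of "\<lambda>v. v $ j"] False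
      by (simp add: axis_def)
  qed simp
  define c where "c = f (axis undefined 1)"
  have c: "f (axis i 1) = c" for i unfolding c_def by (rule fi)
  have "a u = c *s u" for u
  proof -
    have "a u = (\<Sum>i\<in>UNIV. u $ i *s a (axis i 1))"
      by (rule complex_linear_eq_sum_axis[OF assms(1)])
    also have "\<dots> = c *s (\<Sum>i\<in>UNIV. u $ i *s axis i 1)"
      unfolding f c by (simp add: vec.scale_sum_right vector_smult_assoc mult.commute)
    finally show ?thesis unfolding vec_eq_sum_axis[of u, symmetric] .
  qed
  then show ?thesis by blast
qed

text \<open>\<open>WA\<close> is \<open>W3\<close> rewritten with \<open>h1 = h(A _, _)\<close>; its trace over \<open>w\<close> gives \<open>pA\<close>. As \<open>a\<close> can be moved
  between the first two slots of \<open>W\<close>, the right-hand side of \<open>WA\<close> at \<open>(a u, v)\<close> and at \<open>(u, a v)\<close>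
  agrees (\<open>key\<close>), which leaves only scalar \<open>q\<close>.\<close>

lemma hermitian_forms_proportional:
  fixes W :: "complex ^ 'n \<Rightarrow> complex ^ 'n \<Rightarrow> complex ^ 'n \<Rightarrow> complex ^ 'n"
  assumes h1: "hermitian_form h1" "nondegenerate_form h1" and h2: "hermitian_form h2"
    and h: "hermitian_form h" "nondegenerate_form h" and p: "hermitian_form p"
    and Wlin: "\<And>u v. complex_linear (W u v)" and Wsym: "\<And>u v w. W u v w = W u w v"
    and W1: "\<And>u v w z. h1 (W u v w) z = h1 w (W v u z)"
    and W2: "\<And>u v w z. h2 (W u v w) z = h2 w (W v u z)"
    and W3: "\<And>u v w z. h (W u v w) z - h w (W v u z) = p v z * h w u - p w u * h v z"
    and np: "\<And>k::real. \<exists>v w. h2 v w \<noteq> of_real k * h1 v w"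
  shows "\<exists>\<alpha>::real. \<forall>v w. p v w = of_real \<alpha> * h v w"
proof -
  obtain A where A: "complex_linear A" "\<And>v w. h1 v w = h (A v) w"
    using representing_endomorphism[OF h h1(1)] by blast
  obtain q where q: "complex_linear q" "\<And>v w. p v w = h (q v) w"
    using representing_endomorphism[OF h p] by blast
  obtain a where a: "complex_linear a" "\<And>v w. h2 v w = h1 (a v) w"
    using representing_endomorphism[OF h1 h2] by blast
  have A': "h v (A w) = h1 v w" for v w
    by (metis A(2) hermitian_form_cnj[OF h(1)] hermitian_form_cnj[OF h1(1)])
  have Asa: "h1 (A v) w = h1 v (A w)" for v w by (metis A(2) A')
  have asa: "h1 (a v) w = h1 v (a w)" for v w
    by (metis a(2) hermitian_form_cnj[OF h1(1)] hermitian_form_cnj[OF h2])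
  \<comment> \<open>Inserting \<open>A w\<close> and \<open>A z\<close> into \<open>W3\<close> turns
    each \<open>h\<close> into \<open>h1\<close>, whose adjoint rule \<open>W1\<close> is exact;
    \<open>A\<close> is never inverted.\<close>
  have WA0: "h1 (W u v (A w) - A (W u v w)) z = h1 (h1 w u *s q v - p (A w) u *s v) z" for u v w z
  proof -
    have "h (W u v (A w)) (A z) - h (A w) (W v u (A z)) = p v (A z) * h (A w) u - p (A w) u * h v (A z)"
      by (rule W3)
    moreover have "h (A w) (W v u (A z)) = h1 (A (W u v w)) z"
      unfolding A(2)[symmetric] Asa W1 ..
    moreover have "p v (A z) = h1 (q v) z" unfolding q(2) A' ..
    ultimately show ?thesis
      by (simp add: A' A(2)[symmetric] hermitian_form_diff_left[OF h1(1)] hermitian_form_scale_left[OF h1(1)])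
  qed
  have WA: "W u v (A w) - A (W u v w) = h1 w u *s q v - p (A w) u *s v" for u v w
    by (rule nondegenerate_eqI[OF h1 WA0])
  \<comment> \<open>The left side of \<open>WA\<close> is a commutator in \<open>w\<close>, so its
    trace vanishes; what remains says that \<open>q\<close> and \<open>A\<close> commute.\<close>
  have pA: "p (A v) u = h1 (q v) u" for u v
  proof -
    have "0 = complex_trace (\<lambda>w. W u v (A w)) - complex_trace (\<lambda>w. A (W u v w))"
      using complex_trace_commute[OF Wlin A(1)] by simp
    also have "\<dots> = (\<Sum>i\<in>UNIV. (W u v (A (axis i 1)) - A (W u v (axis i 1))) $ i)"
      by (simp add: complex_trace_def sum_subtractf)
    also have "\<dots> = (\<Sum>i\<in>UNIV. q v $ i * h1 (axis i 1) u) - (\<Sum>i\<in>UNIV. v $ i * p (A (axis i 1)) u)"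
      unfolding WA by (simp add: sum_subtractf mult.commute)
    also have "(\<Sum>i\<in>UNIV. q v $ i * h1 (axis i 1) u) = h1 (q v) u"
      by (rule hermitian_form_eq_sum_axis_left[OF h1(1), symmetric])
    also have "(\<Sum>i\<in>UNIV. v $ i * p (A (axis i 1)) u) = p (\<Sum>i\<in>UNIV. v $ i *s A (axis i 1)) u"
      by (simp add: hermitian_form_sum_left[OF p] hermitian_form_scale_left[OF p])
    also have "(\<Sum>i\<in>UNIV. v $ i *s A (axis i 1)) = A v"
      by (rule complex_linear_eq_sum_axis[OF A(1), symmetric])
    finally show ?thesis by simp
  qed
  \<comment> \<open>Both \<open>h1\<close> and \<open>h2 = h1 (a _) _\<close> make
    \<open>W u v\<close> adjoint to \<open>W v u\<close>, so \<open>a\<close> commutes with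
    \<open>W u v\<close>; the symmetry of \<open>W\<close> then moves \<open>a\<close> to the second
    slot.\<close>
  have aW: "a (W u v w) = W u v (a w)" for u v w
  proof (rule nondegenerate_eqI[OF h1])
    show "h1 (a (W u v w)) z = h1 (W u v (a w)) z" for z
      using W2[of u v w z] by (simp add: a(2) W1)
  qed
  have aW2: "W u (a v) w = a (W u v w)" for u v w
    using aW[of u w v] Wsym by metis
  \<comment> \<open>Passing to the adjoint exchanges the first two slots, so the rule for the second
    slot gives the one for the first.\<close>
  have aW1: "W (a u) v w = a (W u v w)" for u v w
  proof (rule nondegenerate_eqI[OF h1])
    show "h1 (W (a u) v w) z = h1 (a (W u v w)) z" for z
      using W1[of "a u" v w z] W1[of u v w "a z"] aW[of v u z] aW2[of v u z] asa[of w "W v u z"] asa[of "W u v w" z]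
        aW[of u v w] W1[of u v "a w" z] by simp
  qed
  have key: "h1 w (a u) *s q v - h1 (q w) (a u) *s v = h1 w u *s q (a v) - h1 (q w) u *s a v" for u v w
  proof -
    have "h1 w (a u) *s q v - p (A w) (a u) *s v = h1 w u *s q (a v) - p (A w) u *s a v"
      unfolding WA[symmetric] aW1 aW2 ..
    then show ?thesis by (simp add: pA)
  qed
  \<comment> \<open>Otherwise \<open>a\<close> is a scalar, real because \<open>a\<close> is
    self-adjoint, against \<open>np\<close>.\<close>
  have "\<exists>u. \<forall>c. a u \<noteq> c *s u"
  proof (rule ccontr)
    assume "\<not> ?thesis"
    then have "\<exists>c. a u = c *s u" for u by blast
    from scalar_if_eigenvectors[OF a(1) this] obtain c where c: "\<And>u. a u = c *s u" by blast
    obtain v where "v \<noteq> (0 :: complex ^ 'n)" using axis_eq_0_iff[of undefined 1] by (metis zero_neq_one)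
    then obtain w where w: "h1 v w \<noteq> 0" using h1(2) by (auto simp: nondegenerate_form_def)
    have "c = cnj c"
      using asa[of v w] w by (simp add: c hermitian_form_scale_left[OF h1(1)] hermitian_form_scale_right[OF h1(1)])
    then have "c = of_real (Re c)" by (simp add: complex_eq_iff)
    then have "h2 v w = of_real (Re c) * h1 v w" for v w
      by (simp add: a(2) c hermitian_form_scale_left[OF h1(1)])
    then show False using np by blast
  qed
  then obtain u where u: "\<And>c. a u \<noteq> c *s u" by blast
  \<comment> \<open>For this \<open>w\<close>, \<open>key\<close> loses its term
    \<open>q (a v)\<close> and expresses \<open>q v\<close> by \<open>v\<close> and
    \<open>a v\<close> with coefficients independent of \<open>v\<close>.\<close>
  obtain w where w: "h1 w u = 0" "h1 w (a u) = 1"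
    using separating_vector[OF h1 u] by blast
  define \<alpha> where "\<alpha> = h1 (q w) (a u)"
  define \<beta> where "\<beta> = - h1 (q w) u"
  have q': "q v = \<alpha> *s v + \<beta> *s a v" for v
    using key[of w u v] w by (simp add: \<alpha>_def \<beta>_def algebra_simps)
  \<comment> \<open>Computing \<open>h1 (q w) u\<close> from \<open>q'\<close> gives
    \<open>\<beta>\<close>, since \<open>h1 (a w) u = h1 w (a u) = 1\<close>, while by definition it
    is \<open>- \<beta>\<close>.\<close>
  have "\<beta> = 0"
  proof (rule ccontr)
    assume \<beta>: "\<beta> \<noteq> 0"
    have aw: "h1 (a w) u = 1" using asa[of w u] w by simp
    have qwu: "h1 (q w) u = \<beta>" and qwa: "h1 (q w) (a u) = \<alpha> + \<beta> * h1 (a w) (a u)"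
      using w aw by (simp_all add: q' hermitian_form_add_left[OF h1(1)] hermitian_form_scale_left[OF h1(1)])
    show False using qwu \<beta> by (simp add: \<beta>_def)
  qed
  then have q'': "q v = \<alpha> *s v" for v by (simp add: q')
  obtain v where "v \<noteq> (0 :: complex ^ 'n)" using axis_eq_0_iff[of undefined 1] by (metis zero_neq_one)
  then obtain w where w: "h v w \<noteq> 0" using h(2) by (auto simp: nondegenerate_form_def)
  have ph: "p v w = \<alpha> * h v w" for v w by (simp add: q(2) q'' hermitian_form_scale_left[OF h(1)])
  have "\<alpha> = cnj \<alpha>"
    using ph[of v w] ph[of w v] hermitian_form_cnj[OF p, of v w] hermitian_form_cnj[OF h(1), of v w] w
    by (metis complex_cnj_mult complex_cnj_zero_iff mult_cancel_right)
  then have "\<alpha> = of_real (Re \<alpha>)" by (simp add: complex_eq_iff)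
  then show ?thesis using ph by metis
qed

section \<open>Kaehler metrics in a complex chart\<close>

definition mixed_curvature ::
    "(complex ^ 'n \<Rightarrow> complex ^ 'n \<Rightarrow> complex ^ 'n \<Rightarrow> complex ^ 'n) \<Rightarrow> complex ^ 'n
      \<Rightarrow> complex ^ 'n \<Rightarrow> complex ^ 'n \<Rightarrow> complex ^ 'n \<Rightarrow> complex ^ 'n" where
  "mixed_curvature G x u v w =
     (1 / 2) *s (frechet_derivative (\<lambda>y. G y v w) (at x) u
                 + \<i> *s frechet_derivative (\<lambda>y. G y v w) (at x) (\<i> *s u))"

text \<open>Normalised so that it is the form subtracted in the Weyl tensor; the Ricci tensor is
  \<open>- 2 (n + 1)\<close> times its real part.\<close>

definition ricci_form ::
    "(complex ^ 'n \<Rightarrow> complex ^ 'n \<Rightarrow> complex ^ 'n \<Rightarrow> complex ^ 'n) \<Rightarrow> complex ^ 'n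
      \<Rightarrow> complex ^ 'n \<Rightarrow> complex ^ 'n \<Rightarrow> complex" where
  "ricci_form G x v u = complex_trace (mixed_curvature G x u v) / (of_nat CARD('n) + 1)"

text \<open>The c-projective Weyl tensor. In the trace over \<open>w\<close> the subtracted terms
  contribute \<open>n\<close> copies and one copy of \<open>ricci_form\<close>, which explains the
  divisor \<open>n + 1\<close> there.\<close>

definition weyl ::
    "(complex ^ 'n \<Rightarrow> complex ^ 'n \<Rightarrow> complex ^ 'n \<Rightarrow> complex ^ 'n) \<Rightarrow> complex ^ 'n
      \<Rightarrow> complex ^ 'n \<Rightarrow> complex ^ 'n \<Rightarrow> complex ^ 'n \<Rightarrow> complex ^ 'n" where
  "weyl G x u v w = mixed_curvature G x u v w - ricci_form G x v u *s w - ricci_form G x w u *s v"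

lemma hermitian_form_bilinear:
  assumes "hermitian_form h"
  shows "bilinear h"
  unfolding bilinear_def
  by (auto intro!: linearI simp: hermitian_form_add_left[OF assms] hermitian_form_add_right[OF assms]
      scaleR_eq_of_real_scale hermitian_form_scale_left[OF assms] hermitian_form_scale_right[OF assms]
      scaleR_conv_of_real)

lemma bounded_linear_complex_scale: "bounded_linear (\<lambda>v :: complex ^ 'n. c *s v)"
  by (rule linear_conv_bounded_linear[THEN iffD1], rule linearI)
    (simp_all add: vec.scale_right_distrib scaleR_eq_of_real_scale vector_smult_assoc mult.commute)

lemma bounded_linear_complex_scale_left: "bounded_linear (\<lambda>c. c *s (v :: complex ^ 'n))"
  by (rule linear_conv_bounded_linear[THEN iffD1], rule linearI)
    (simp_all add: vec.scale_left_distrib scaleR_eq_of_real_scale vector_smult_assoc scaleR_conv_of_real)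

text \<open>A Kaehler metric seen in one complex chart: \<open>deriv_h\<close> is metric
  compatibility of the Christoffel map, and complex linearity of \<open>G x v\<close> stands for the
  parallel complex structure.\<close>

locale kaehler_chart =
  fixes S :: "(complex ^ 'n) set" and h :: "complex ^ 'n \<Rightarrow> complex ^ 'n \<Rightarrow> complex ^ 'n \<Rightarrow> complex"
    and G :: "complex ^ 'n \<Rightarrow> complex ^ 'n \<Rightarrow> complex ^ 'n \<Rightarrow> complex ^ 'n"
  assumes open_S: "open S"
    and herm: "x \<in> S \<Longrightarrow> hermitian_form (h x)"
    and nondeg: "x \<in> S \<Longrightarrow> nondegenerate_form (h x)"
    and smooth_h: "smooth_on S (\<lambda>x. h x v w)"
    and clin_G: "x \<in> S \<Longrightarrow> complex_linear (G x v)"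
    and sym_G: "x \<in> S \<Longrightarrow> G x v w = G x w v"
    and smooth_G: "smooth_on S (\<lambda>x. G x v w)"
    and deriv_h: "x \<in> S \<Longrightarrow> frechet_derivative (\<lambda>y. h y v w) (at x) z = h x (G x z v) w + h x v (G x z w)"
begin

lemma clin_G': "x \<in> S \<Longrightarrow> complex_linear (\<lambda>v. G x v w)"
  using clin_G[of x w] sym_G[of x] by (simp add: complex_linear_def)

lemma bilinear_G: "x \<in> S \<Longrightarrow> bilinear (G x)"
  unfolding bilinear_def using complex_linear_imp_linear[OF clin_G] complex_linear_imp_linear[OF clin_G'] by blast

definition DG where "DG x u v w = frechet_derivative (\<lambda>y. G y v w) (at x) u"

lemma has_derivative_G: "x \<in> S \<Longrightarrow> ((\<lambda>y. G y v w) has_derivative (\<lambda>u. DG x u v w)) (at x)"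
  unfolding DG_def by (rule smooth_on_has_derivative[OF smooth_G])

lemma has_derivative_h:
  "x \<in> S \<Longrightarrow> ((\<lambda>y. h y v w) has_derivative (\<lambda>z. h x (G x z v) w + h x v (G x z w))) (at x)"
  using smooth_on_has_derivative[OF smooth_h, of x v w] by (simp add: ext[OF deriv_h])

lemma DG_eqI:
  assumes "x \<in> S" "(F has_derivative F') (at x)" "\<And>y. y \<in> S \<Longrightarrow> F y = G y v w"
  shows "DG x u v w = F' u"
  using has_derivative_unique[OF has_derivative_G[OF assms(1)]
      has_derivative_transform_within_open[OF assms(2) open_S assms(1,3)]] by metis

lemma DG_sym: "x \<in> S \<Longrightarrow> DG x u v w = DG x u w v"
  by (rule DG_eqI[OF _ has_derivative_G]) (simp_all add: sym_G[of _ v w])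

lemma clin_DG: "x \<in> S \<Longrightarrow> complex_linear (DG x u v)"
  unfolding complex_linear_def
proof (intro conjI allI)
  assume x: "x \<in> S"
  show "DG x u v (w + w') = DG x u v w + DG x u v w'" for w w'
    by (rule DG_eqI[OF x has_derivative_add[OF has_derivative_G[OF x] has_derivative_G[OF x]]])
      (simp add: complex_linear_add[OF clin_G])
  show "DG x u v (c *s w) = c *s DG x u v w" for c w
    by (rule DG_eqI[OF x bounded_linear.has_derivative[OF bounded_linear_complex_scale has_derivative_G[OF x]]])
      (simp add: complex_linear_scale[OF clin_G])
qed

lemma clin_DG': "x \<in> S \<Longrightarrow> complex_linear (\<lambda>v. DG x u v w)"
  using clin_DG[of x u w] DG_sym[of x] by (simp add: complex_linear_def)

lemma linear_DG: "x \<in> S \<Longrightarrow> linear (\<lambda>u. DG x u v w)"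
  using has_derivative_G has_derivative_linear by blast

definition curv where
  "curv x u z v = DG x u z v - DG x z u v + G x u (G x z v) - G x z (G x u v)"

text \<open>Metric compatibility is differentiated once more. Second derivatives of
  \<open>h y v w\<close> commute, and the products with one \<open>G\<close> in each slot of
  \<open>h\<close> cancel on antisymmetrising in \<open>u\<close> and \<open>z\<close>.\<close>

lemma curv_skew:
  assumes x: "x \<in> S"
  shows "h x (curv x u z v) w + h x v (curv x u z w) = 0"
proof -
  define F where "F u z = h x (G x u (G x z v)) w + h x (G x z v) (G x u w) + h x (DG x u z v) w
        + (h x (G x u v) (G x z w) + h x v (G x u (G x z w)) + h x v (DG x u z w))" for u z
  have F: "frechet_derivative (\<lambda>y. frechet_derivative (\<lambda>y. h y v w) (at y) z) (at x) = (\<lambda>u. F u z)" for z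
  proof (rule frechet_derivative_eqI)
    have 1: "((\<lambda>y. h y (G y z v) w) has_derivative
        (\<lambda>u. h x (G x u (G x z v)) w + h x (G x z v) (G x u w) + h x (DG x u z v) w + h x (G x z v) 0)) (at x)"
      by (rule has_derivative_bilinear_field[where B = h and f = "\<lambda>y. G y z v" and g = "\<lambda>_. w"
            and D = "\<lambda>z a b. h x (G x z a) b + h x a (G x z b)",
            OF open_S x hermitian_form_bilinear[OF herm] has_derivative_h[OF x] has_derivative_G[OF x] has_derivative_const])
    have 2: "((\<lambda>y. h y v (G y z w)) has_derivative
        (\<lambda>u. h x (G x u v) (G x z w) + h x v (G x u (G x z w)) + h x 0 (G x z w) + h x v (DG x u z w))) (at x)"
      by (rule has_derivative_bilinear_field[where B = h and f = "\<lambda>_. v" and g = "\<lambda>y. G y z w"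
            and D = "\<lambda>z a b. h x (G x z a) b + h x a (G x z b)",
            OF open_S x hermitian_form_bilinear[OF herm] has_derivative_h[OF x] has_derivative_const has_derivative_G[OF x]])
    have "((\<lambda>y. h y (G y z v) w + h y v (G y z w)) has_derivative (\<lambda>u. F u z)) (at x)"
      using has_derivative_add[OF 1 2]
      by (simp add: F_def hermitian_form_zero_left[OF herm[OF x]] hermitian_form_zero_right[OF herm[OF x]])
    then show "((\<lambda>y. frechet_derivative (\<lambda>y. h y v w) (at y) z) has_derivative (\<lambda>u. F u z)) (at x)"
      by (rule has_derivative_transform_within_open[OF _ open_S x]) (simp add: deriv_h)
  qed
  have diff_right: "h x a (b - c) = h x a b - h x a c" for a b c
    using bilinear_rsub[OF hermitian_form_bilinear[OF herm[OF x]]] .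
  show ?thesis
    using second_derivative_symmetric[OF smooth_h open_S x, of v w z u]
    unfolding F F_def curv_def
    by (simp add: hermitian_form_add_left[OF herm[OF x]] hermitian_form_add_right[OF herm[OF x]]
        hermitian_form_diff_left[OF herm[OF x]] diff_right algebra_simps)
qed

lemma mixed_curvature_eq: "mixed_curvature G x u v w = (1 / 2) *s (DG x u v w + \<i> *s DG x (\<i> *s u) v w)"
  by (simp add: mixed_curvature_def DG_def)

lemma imaginary_unit_scale_twice: "\<i> *s (\<i> *s v) = - (v :: complex ^ 'm)"
  by (simp add: vector_smult_assoc vec_eq_iff)

lemma DG_minus_direction: "x \<in> S \<Longrightarrow> DG x (- u) v w = - DG x u v w"
  using linear_neg[OF linear_DG] by blast

text \<open>The combination in \<open>1\<close> projects \<open>curv x u v\<close> to its part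
  antilinear in \<open>u\<close> and linear in \<open>v\<close>. Moved to the second slot of
  \<open>h\<close>, its coefficients are conjugated, so \<open>2\<close> projects to the opposite
  type; skewness relates the two.\<close>

lemma mixed_curvature_adjoint:
  assumes x: "x \<in> S"
  shows "h x (mixed_curvature G x u v w) z = h x w (mixed_curvature G x v u z)"
proof -
  note l = complex_linear_scale[OF clin_G[OF x]] complex_linear_scale[OF clin_G'[OF x]]
    complex_linear_scale[OF clin_DG[OF x]] complex_linear_scale[OF clin_DG'[OF x]] DG_minus_direction[OF x]
  have 1: "curv x u v w + curv x (\<i> *s u) (\<i> *s v) w + \<i> *s curv x (\<i> *s u) v w - \<i> *s curv x u (\<i> *s v) w
      = 4 *s mixed_curvature G x u v w"
    unfolding mixed_curvature_eq curv_def l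
    by (simp add: vec_eq_iff algebra_simps)
  have 2: "curv x u v z + curv x (\<i> *s u) (\<i> *s v) z - \<i> *s curv x (\<i> *s u) v z + \<i> *s curv x u (\<i> *s v) z
      = - (4 *s mixed_curvature G x v u z)"
    unfolding mixed_curvature_eq curv_def l
    by (simp add: vec_eq_iff algebra_simps)
  note H = hermitian_form_add_left[OF herm[OF x]] hermitian_form_add_right[OF herm[OF x]]
    hermitian_form_scale_left[OF herm[OF x]] hermitian_form_scale_right[OF herm[OF x]]
    hermitian_form_diff_left[OF herm[OF x]] bilinear_rsub[OF hermitian_form_bilinear[OF herm[OF x]]]
    bilinear_rneg[OF hermitian_form_bilinear[OF herm[OF x]]]
  have "h x (4 *s mixed_curvature G x u v w) z + h x w (- (4 *s mixed_curvature G x v u z)) = 0"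
    unfolding 1[symmetric] 2[symmetric]
    using curv_skew[OF x, of u v w z] curv_skew[OF x, of "\<i> *s u" "\<i> *s v" w z]
      curv_skew[OF x, of "\<i> *s u" v w z] curv_skew[OF x, of u "\<i> *s v" w z]
    by (simp add: H) algebra
  then show ?thesis by (simp add: H)
qed

text \<open>The part of \<open>curv_skew\<close> that is complex linear in both directions; the mixed part gives
  \<open>mixed_curvature_adjoint\<close>.\<close>

lemma pure_curvature_vanishes:
  assumes x: "x \<in> S"
  shows "(1 / 2) *s (DG x u v w - \<i> *s DG x (\<i> *s u) v w) - (1 / 2) *s (DG x v u w - \<i> *s DG x (\<i> *s v) u w)
      + G x u (G x v w) - G x v (G x u w) = 0"
proof -
  note l = complex_linear_scale[OF clin_G[OF x]] complex_linear_scale[OF clin_G'[OF x]]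
    complex_linear_scale[OF clin_DG[OF x]] complex_linear_scale[OF clin_DG'[OF x]] DG_minus_direction[OF x]
  let ?R3 = "curv x u v w - curv x (\<i> *s u) (\<i> *s v) w - \<i> *s curv x (\<i> *s u) v w - \<i> *s curv x u (\<i> *s v) w"
  have 1: "?R3 = 4 *s ((1 / 2) *s (DG x u v w - \<i> *s DG x (\<i> *s u) v w)
      - (1 / 2) *s (DG x v u w - \<i> *s DG x (\<i> *s v) u w) + G x u (G x v w) - G x v (G x u w))"
    unfolding curv_def l by (simp add: vec_eq_iff algebra_simps)
  \<comment> \<open>The projection to the part antilinear in both \<open>u\<close> and
    \<open>v\<close>, which is zero because every term of \<open>curv\<close> is complex linear in
    one of them.\<close>
  have 2: "curv x u v z - curv x (\<i> *s u) (\<i> *s v) z + \<i> *s curv x (\<i> *s u) v z + \<i> *s curv x u (\<i> *s v) z = 0"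
    for z
    unfolding curv_def l by (simp add: vec_eq_iff algebra_simps)
  note H = hermitian_form_add_left[OF herm[OF x]] hermitian_form_add_right[OF herm[OF x]]
    hermitian_form_scale_left[OF herm[OF x]] hermitian_form_scale_right[OF herm[OF x]]
    hermitian_form_diff_left[OF herm[OF x]] bilinear_rsub[OF hermitian_form_bilinear[OF herm[OF x]]]
    bilinear_rneg[OF hermitian_form_bilinear[OF herm[OF x]]]
  have "?R3 = 0"
  proof (rule nondegenerate_eqI[OF herm[OF x] nondeg[OF x]])
    fix z
    have "h x ?R3 z + h x w (curv x u v z - curv x (\<i> *s u) (\<i> *s v) z
        + \<i> *s curv x (\<i> *s u) v z + \<i> *s curv x u (\<i> *s v) z) = 0"
      using curv_skew[OF x, of u v w z] curv_skew[OF x, of "\<i> *s u" "\<i> *s v" w z]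
        curv_skew[OF x, of "\<i> *s u" v w z] curv_skew[OF x, of u "\<i> *s v" w z]
      by (simp add: H) algebra
    then show "h x ?R3 z = h x 0 z"
      unfolding 2 by (simp add: hermitian_form_zero_left[OF herm[OF x]] hermitian_form_zero_right[OF herm[OF x]])
  qed
  then show ?thesis unfolding 1 vec.scale_eq_0_iff by (rule disjE) (simp, assumption)
qed

lemma curv_eq_mixed:
  assumes x: "x \<in> S"
  shows "curv x u v w = mixed_curvature G x u v w - mixed_curvature G x v u w"
  using pure_curvature_vanishes[OF x, of u v w] unfolding curv_def mixed_curvature_eq
  by (simp add: vec_eq_iff field_simps)

lemma mixed_curvature_sym: "x \<in> S \<Longrightarrow> mixed_curvature G x u v w = mixed_curvature G x u w v"
  unfolding mixed_curvature_eq by (simp add: DG_sym[of x _ v w])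

lemma clin_mixed_curvature: "x \<in> S \<Longrightarrow> complex_linear (mixed_curvature G x u v)"
  using clin_DG[of x] unfolding mixed_curvature_eq complex_linear_def
  by (simp add: vec_eq_iff algebra_simps)

text \<open>Conjugate symmetry is the trace of \<open>mixed_curvature_adjoint\<close>: adjoint
  endomorphisms have conjugate traces.\<close>

lemma hermitian_ricci_form:
  assumes x: "x \<in> S"
  shows "hermitian_form (ricci_form G x)"
  unfolding hermitian_form_def
proof (intro conjI allI)
  have clin': "complex_linear (\<lambda>v. mixed_curvature G x u v w)" for u w
    using clin_mixed_curvature[OF x, of u w] mixed_curvature_sym[OF x] by (simp add: complex_linear_def)
  show "ricci_form G x (u + v) w = ricci_form G x u w + ricci_form G x v w" for u v w
    by (simp add: ricci_form_def complex_trace_def complex_linear_add[OF clin'] sum.distrib add_divide_distrib)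
  show "ricci_form G x (c *s v) w = c * ricci_form G x v w" for c v w
    by (simp add: ricci_form_def complex_trace_def complex_linear_scale[OF clin'] sum_distrib_left)
  show "ricci_form G x w v = cnj (ricci_form G x v w)" for v w
    using complex_trace_adjoint[OF herm[OF x] nondeg[OF x] clin_mixed_curvature[OF x, of w v],
        of "mixed_curvature G x v w"] mixed_curvature_adjoint[OF x, of w v]
    by (simp add: ricci_form_def)
qed

lemma weyl_sym: "x \<in> S \<Longrightarrow> weyl G x u v w = weyl G x u w v"
  by (simp add: weyl_def mixed_curvature_sym[of x u v w])

lemma clin_weyl:
  assumes x: "x \<in> S"
  shows "complex_linear (weyl G x u v)"
  using clin_mixed_curvature[OF x, of u v]
  by (simp add: complex_linear_def weyl_def vec_eq_iff algebra_simps
      hermitian_form_add_left[OF hermitian_ricci_form[OF x]] hermitian_form_scale_left[OF hermitian_ricci_form[OF x]])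

text \<open>The trace terms with \<open>h x w z\<close> cancel because the Ricci form is Hermitian,
  the other two form the defect. It vanishes when the Ricci form is a multiple of
  \<open>h x\<close>, which is how the Einstein condition enters.\<close>

lemma weyl_adjoint_defect:
  assumes x: "x \<in> S"
  shows "h x (weyl G x u v w) z - h x w (weyl G x v u z)
      = ricci_form G x v z * h x w u - ricci_form G x w u * h x v z"
  unfolding weyl_def
  using mixed_curvature_adjoint[OF x, of u v w z]
  by (simp add: hermitian_form_diff_left[OF herm[OF x]] hermitian_form_scale_left[OF herm[OF x]]
      bilinear_rsub[OF hermitian_form_bilinear[OF herm[OF x]]] hermitian_form_scale_right[OF herm[OF x]]
      hermitian_form_cnj[OF hermitian_ricci_form[OF x]])

end

section \<open>Real and complex traces, and the Ricci form as a derivative\<close>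

lemma sum_Basis_complex_vec:
  "(\<Sum>b\<in>(Basis :: (complex ^ 'n) set). f b) = (\<Sum>i\<in>UNIV. f (axis i 1) + f (axis i \<i>))"
proof -
  have B: "(Basis :: (complex ^ 'n) set) = (\<lambda>(i, c). axis i c) ` (UNIV \<times> {1, \<i>})"
    by (auto simp: Basis_vec_def Basis_complex_def)
  have inj: "inj_on (\<lambda>(i :: 'n, c). axis i c) (UNIV \<times> {1, \<i>})"
    by (auto simp: inj_on_def axis_eq_axis)
  have "(\<Sum>b\<in>(Basis :: (complex ^ 'n) set). f b) = (\<Sum>(i, c)\<in>UNIV \<times> {1, \<i>}. f (axis i c))"
    unfolding B sum.reindex[OF inj] by (simp add: case_prod_unfold comp_def)
  also have "\<dots> = (\<Sum>i\<in>UNIV. \<Sum>c\<in>{1, \<i>}. f (axis i c))"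
    by (rule sum.cartesian_product[symmetric])
  finally show ?thesis by (simp add: complex_eq_iff)
qed

lemma endo_trace_complex:
  fixes T :: "complex ^ 'n \<Rightarrow> complex ^ 'n"
  shows "endo_trace T = (\<Sum>i\<in>UNIV. Re (T (axis i 1) $ i) + Im (T (axis i \<i>) $ i))"
proof -
  have "T v \<bullet> axis i c = (T v $ i) \<bullet> c" for v i c
    by (simp add: inner_axis)
  then show ?thesis by (simp add: endo_trace_def sum_Basis_complex_vec complex_inner_1 inner_complex_def)
qed

context kaehler_chart
begin

lemma mixed_curvature_antilinear:
  assumes x: "x \<in> S"
  shows "mixed_curvature G x (\<i> *s u) v w = - (\<i> *s mixed_curvature G x u v w)"
  unfolding mixed_curvature_eq imaginary_unit_scale_twice DG_minus_direction[OF x]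
  by (simp add: vec_eq_iff algebra_simps)

text \<open>Of the two terms of \<open>curv_eq_mixed\<close>, the one antilinear in \<open>u\<close>
  has real trace zero, and the complex linear one has twice the real part of its complex
  trace.\<close>

lemma endo_trace_curv:
  assumes x: "x \<in> S"
  shows "endo_trace (\<lambda>u. curv x u v w) = - 2 * (real CARD('n) + 1) * Re (ricci_form G x w v)"
proof -
  have ax: "axis i \<i> = \<i> *s axis i (1 :: complex)" for i :: 'n
    by (simp add: vec_eq_iff axis_def)
  have clin: "complex_linear (\<lambda>u. mixed_curvature G x v u w)"
    using clin_mixed_curvature[OF x, of v w] mixed_curvature_sym[OF x] by (simp add: complex_linear_def)
  have "endo_trace (\<lambda>u. curv x u v w) = (\<Sum>i\<in>UNIV. - 2 * Re (mixed_curvature G x v w (axis i 1) $ i))"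
    unfolding endo_trace_complex
  proof (rule sum.cong[OF refl])
    fix i :: 'n
    show "Re (curv x (axis i 1) v w $ i) + Im (curv x (axis i \<i>) v w $ i)
        = - 2 * Re (mixed_curvature G x v w (axis i 1) $ i)"
      unfolding curv_eq_mixed[OF x] ax mixed_curvature_antilinear[OF x]
        complex_linear_scale[OF clin] mixed_curvature_sym[OF x, of v "axis i 1" w]
      by simp
  qed
  also have "\<dots> = - 2 * Re (complex_trace (mixed_curvature G x v w))"
    by (simp add: complex_trace_def sum_distrib_left sum_negf)
  also have "complex_trace (mixed_curvature G x v w) = of_real (real CARD('n) + 1) * ricci_form G x w v"
  proof -
    have "(of_nat CARD('n) + 1 :: complex) \<noteq> 0"
      using of_nat_neq_0[of "CARD('n)", where 'a = complex] by (simp add: add.commute)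
    then show ?thesis by (simp add: ricci_form_def)
  qed
  finally show ?thesis by (simp add: algebra_simps)
qed

text \<open>The holomorphic derivative of the logarithm of the determinant of the Hermitian matrix
  of the metric.\<close>

definition ctr where "ctr x v = complex_trace (G x v)"
definition dctr where "dctr x u v = complex_trace (DG x u v)"

lemma has_derivative_ctr:
  "x \<in> S \<Longrightarrow> ((\<lambda>y. ctr y v) has_derivative (\<lambda>u. dctr x u v)) (at x)"
  unfolding ctr_def dctr_def complex_trace_def
  by (intro has_derivative_sum bounded_linear.has_derivative[OF bounded_linear_vec_nth] has_derivative_G)

lemma smooth_ctr: "smooth_on S (\<lambda>y. ctr y v)"
  unfolding ctr_def complex_trace_def
  by (intro smooth_on_sum open_S smooth_on_bounded_linear[OF bounded_linear_vec_nth] smooth_G)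

lemma ctr_add: "x \<in> S \<Longrightarrow> ctr x (v + w) = ctr x v + ctr x w"
  and ctr_scale: "x \<in> S \<Longrightarrow> ctr x (c *s v) = c * ctr x v"
  by (simp_all add: ctr_def complex_trace_def complex_linear_add[OF clin_G'] complex_linear_scale[OF clin_G']
      sum.distrib sum_distrib_left)

lemma dctr_scale: "x \<in> S \<Longrightarrow> dctr x u (c *s v) = c * dctr x u v"
  by (simp add: dctr_def complex_trace_def complex_linear_scale[OF clin_DG'] sum_distrib_left)

lemma dctr_minus_direction: "x \<in> S \<Longrightarrow> dctr x (- u) v = - dctr x u v"
  by (simp add: dctr_def complex_trace_def DG_minus_direction sum_negf)

text \<open>The Ricci form as the antiholomorphic derivative of \<open>ctr\<close>, up to
  normalisation; this form makes its antiholomorphic derivatives commute in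
  \<open>ricci_factor_locally_constant\<close>.\<close>

lemma ricci_form_eq_dctr:
  "x \<in> S \<Longrightarrow> ricci_form G x v u = (dctr x u v + \<i> * dctr x (\<i> *s u) v) / (2 * (of_nat CARD('n) + 1))"
  by (simp add: ricci_form_def mixed_curvature_eq dctr_def complex_trace_def sum.distrib sum_distrib_left
      sum_divide_distrib[symmetric] field_simps)

lemma smooth_ricci_form: "smooth_on S (\<lambda>x. ricci_form G x v u)"
proof (rule smooth_on_cong[OF _ open_S ricci_form_eq_dctr])
  have s: "smooth_on S (\<lambda>x. dctr x u v)" for u
    unfolding dctr_def complex_trace_def DG_def
    by (intro smooth_on_sum open_S smooth_on_bounded_linear[OF bounded_linear_vec_nth]
        smooth_on_derivative smooth_G)
  show "smooth_on S (\<lambda>x. (dctr x u v + \<i> * dctr x (\<i> *s u) v) / (2 * (of_nat CARD('n) + 1)))"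
    by (intro smooth_on_bounded_linear[OF bounded_linear_divide] smooth_on_add
        smooth_on_bounded_linear[OF bounded_linear_mult_right] s open_S)
qed

end

section \<open>Symmetric complex bilinear maps sending each diagonal pair into its own line\<close>

lemma complex_independent:
  fixes v w :: "complex ^ 'n"
  assumes "v \<noteq> 0" "\<And>c. w \<noteq> c *s v" "a *s v + b *s w = 0"
  shows "a = 0" "b = 0"
proof -
  show "b = 0"
  proof (rule ccontr)
    assume b: "b \<noteq> 0"
    have "w = (1 / b) *s (b *s w)" using b by (simp add: vector_smult_assoc)
    also have "b *s w = - (a *s v)" using assms(3) by (metis add.commute eq_neg_iff_add_eq_0)
    finally have "w = (- a / b) *s v" by (simp add: vec_eq_iff)
    then show False using assms(2) by blast
  qed
  then show "a = 0" using assms(1,3) by (simp add: vec_eq_iff) metis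
qed

lemma exists_complex_independent:
  fixes v :: "complex ^ 'n"
  assumes "CARD('n) \<ge> 2" "v \<noteq> 0"
  obtains w where "\<And>c. w \<noteq> c *s v"
proof -
  obtain i where i: "v $ i \<noteq> 0" using assms(2) by (auto simp: vec_eq_iff)
  have "\<exists>j. j \<noteq> i"
  proof (rule ccontr)
    assume "\<not> ?thesis"
    then have "(UNIV :: 'n set) \<subseteq> {i}" by auto
    then have "CARD('n) \<le> card {i}" by (intro card_mono) auto
    then show False using assms(1) by simp
  qed
  then obtain j where j: "j \<noteq> i" by blast
  have "axis j 1 \<noteq> c *s v" for c
  proof
    assume e: "axis j 1 = c *s v"
    have "c = 0" using arg_cong[OF e, of "\<lambda>z. z $ i"] i j by (simp add: axis_def)
    then show False using arg_cong[OF e, of "\<lambda>z. z $ j"] by simp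
  qed
  then show thesis by (rule that)
qed

text \<open>Polarisation of \<open>D v v = (2 * f v) *s v\<close>, where nothing is known about the
  chosen \<open>f\<close>. The trace then identifies \<open>f\<close>, so its linearity needs no
  separate proof.\<close>

lemma symmetric_bilinear_diagonal:
  fixes D :: "complex ^ 'n \<Rightarrow> complex ^ 'n \<Rightarrow> complex ^ 'n"
  assumes lin: "\<And>v. complex_linear (D v)" and sym: "\<And>v w. D v w = D w v"
    and diag: "\<And>v. \<exists>c. D v v = c *s v"
  shows "D v w = (complex_trace (D v) / (of_nat CARD('n) + 1)) *s w
                 + (complex_trace (D w) / (of_nat CARD('n) + 1)) *s v"
proof -
  have n: "(of_nat CARD('n) + 1 :: complex) \<noteq> 0"
    using of_nat_neq_0[of "CARD('n)", where 'a = complex] by (simp add: add.commute)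
  have lin': "complex_linear (\<lambda>v. D v w)" for w
    using lin[of w] sym by (simp add: complex_linear_def)
  note l = complex_linear_add[OF lin] complex_linear_scale[OF lin]
    complex_linear_add[OF lin'] complex_linear_scale[OF lin']
  have "\<exists>c. D v v = (2 * c) *s v" for v
    using diag[of v] by (metis mult.commute nonzero_eq_divide_eq zero_neq_numeral)
  then obtain f where f: "\<And>v. D v v = (2 * f v) *s v" by metis
  have indep: "D v w = f v *s w + f w *s v" if v: "v \<noteq> 0" and w: "\<And>c. w \<noteq> c *s v" for v w
  proof -
    have p: "(2 * f (v + w)) *s (v + w) = (2 * f v) *s v + (2 * f w) *s w + 2 *s D v w"
      using f[of "v + w"] unfolding l unfolding f sym[of w v]
      by (simp add: vec_eq_iff algebra_simps)
    have m: "(2 * f (v + - 1 *s w)) *s (v + - 1 *s w) = (2 * f v) *s v + (2 * f w) *s w - 2 *s D v w"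
      using f[of "v + - 1 *s w"] unfolding l unfolding f sym[of w v]
      by (simp add: vec_eq_iff algebra_simps)
    \<comment> \<open>Adding \<open>p\<close> and \<open>m\<close> eliminates \<open>D v w\<close>;
      independence of \<open>v\<close> and \<open>w\<close> then yields additivity of
      \<open>f\<close> on this pair.\<close>
    have s: "(2 * f (v + w) + 2 * f (v + - 1 *s w) - 4 * f v) *s v
        + (2 * f (v + w) - 2 * f (v + - 1 *s w) - 4 * f w) *s w = 0"
      unfolding vec_eq_iff
    proof
      fix i
      show "((2 * f (v + w) + 2 * f (v + - 1 *s w) - 4 * f v) *s v
        + (2 * f (v + w) - 2 * f (v + - 1 *s w) - 4 * f w) *s w) $ i = 0 $ i"
        using arg_cong[OF p, of "\<lambda>z. z $ i"] arg_cong[OF m, of "\<lambda>z. z $ i"]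
        unfolding vector_add_component vector_minus_component vector_smult_component zero_index
        by algebra
    qed
    have "2 * f (v + w) + 2 * f (v + - 1 *s w) - 4 * f v = 0"
      "2 * f (v + w) - 2 * f (v + - 1 *s w) - 4 * f w = 0"
      using complex_independent[OF v w s] by auto
    then have "f (v + w) = f v + f w" by algebra
    then have "2 *s D v w = 2 *s (f v *s w + f w *s v)"
      using p by (simp add: vec_eq_iff algebra_simps)
    then show ?thesis unfolding vec.scale_cancel_left by simp
  qed
  have in_span: "\<exists>c. D v w = f v *s w + c *s v" if v: "v \<noteq> 0" for v w
  proof (cases "\<exists>c. w = c *s v")
    case True
    then obtain c where c: "w = c *s v" by blast
    have "D v w = f v *s w + (c * f v) *s v"
      unfolding c l f by (simp add: vec_eq_iff)
    then show ?thesis by blast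
  next
    case False
    then show ?thesis using indep[OF v] by blast
  qed
  \<comment> \<open>\<open>D v\<close> minus \<open>f v\<close> times the identity has its image in
    the line of \<open>v\<close> and multiplies \<open>v\<close> by \<open>f v\<close>, so its trace
    is \<open>f v\<close>; the subtracted identity accounts for the other \<open>n\<close>
    copies.\<close>
  have tr: "complex_trace (D v) = (of_nat CARD('n) + 1) * f v" if v: "v \<noteq> 0" for v
  proof -
    obtain j where j: "v $ j \<noteq> 0" using v by (auto simp: vec_eq_iff)
    define R where "R w = D v w - f v *s w" for w
    have R: "complex_linear R"
      by (simp add: complex_linear_def R_def l vec_eq_iff algebra_simps)
    have Rw: "R w $ i = (R w $ j / v $ j) * v $ i" for w i
      using in_span[OF v, of w] j by (auto simp: R_def)
    have "complex_trace R = (\<Sum>i\<in>UNIV. v $ i * R (axis i 1) $ j) / v $ j"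
      unfolding complex_trace_def by (subst Rw) (simp add: sum_divide_distrib mult.commute)
    also have "(\<Sum>i\<in>UNIV. v $ i * R (axis i 1) $ j) = R v $ j"
      using arg_cong[OF complex_linear_eq_sum_axis[OF R, of v], of "\<lambda>z. z $ j"] by simp
    also have "R v $ j / v $ j = f v" using j by (simp add: R_def f)
    finally have "complex_trace R = f v" .
    moreover have "complex_trace R = complex_trace (D v) - of_nat CARD('n) * f v"
      by (simp add: complex_trace_def R_def sum_subtractf)
    ultimately show ?thesis by (simp add: algebra_simps)
  qed
  have z: "D 0 w = 0" "complex_trace (D 0) = 0" for w
  proof -
    show z: "D 0 w = 0" for w using complex_linear_scale[OF lin', of 0 0 w] by simp
    show "complex_trace (D 0) = 0" by (simp add: complex_trace_def z)
  qed
  show ?thesis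
  proof (cases "v = 0 \<or> w = 0")
    case True
    then show ?thesis using z sym[of v w] by auto
  next
    case False
    then have vw: "v \<noteq> 0" "w \<noteq> 0" by auto
    show ?thesis
    proof (cases "\<exists>c. w = c *s v")
      case True
      then obtain c where c: "w = c *s v" by blast
      then have c0: "c \<noteq> 0" using vw by auto
      have "complex_trace (D w) = c * complex_trace (D v)"
        by (simp add: complex_trace_def c l sum_distrib_left)
      then have fw: "f w = c * f v" using tr[OF vw(1)] tr[OF vw(2)] n by simp
      have "D v w = f v *s w + f w *s v"
        unfolding fw unfolding c l f by (simp add: vec_eq_iff)
      then show ?thesis using tr[OF vw(1)] tr[OF vw(2)] n by simp
    next
      case False
      then show ?thesis using indep[OF vw(1)] tr[OF vw(1)] tr[OF vw(2)] n by auto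
    qed
  qed
qed

section \<open>C-projectively related metrics in a chart\<close>

lemma hermitian_form_norm_bound:
  assumes e: "hermitian_form (e :: complex ^ 'n \<Rightarrow> complex ^ 'n \<Rightarrow> complex)"
  shows "norm (e a b) \<le> norm a * norm b * (\<Sum>i\<in>UNIV. \<Sum>j\<in>UNIV. norm (e (axis i 1) (axis j 1)))"
proof -
  have right: "e v b = (\<Sum>j\<in>UNIV. cnj (b $ j) * e v (axis j 1))" for v
  proof -
    have "e v b = cnj (\<Sum>j\<in>UNIV. b $ j * e (axis j 1) v)"
      using hermitian_form_eq_sum_axis_left[OF e, of b v] hermitian_form_cnj[OF e, of b v] by simp
    then show ?thesis by (simp add: hermitian_form_cnj[OF e])
  qed
  have "e a b = (\<Sum>i\<in>UNIV. a $ i * e (axis i 1) b)"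
    by (rule hermitian_form_eq_sum_axis_left[OF e])
  also have "\<dots> = (\<Sum>i\<in>UNIV. \<Sum>j\<in>UNIV. a $ i * (cnj (b $ j) * e (axis i 1) (axis j 1)))"
    by (intro sum.cong refl) (subst right, rule sum_distrib_left)
  also have "norm \<dots> \<le> (\<Sum>i\<in>UNIV. \<Sum>j\<in>UNIV. norm a * norm b * norm (e (axis i 1) (axis j 1)))"
    unfolding norm_mult mult.assoc[symmetric]
    by (intro sum_norm_le order_trans[OF norm_sum] sum_mono)
      (simp add: norm_mult mult.assoc[symmetric] mult_mono mult_right_mono Finite_Cartesian_Product.norm_nth_le)
  finally show ?thesis by (simp add: sum_distrib_left)
qed

text \<open>\<open>diagonal\<close> says that geodesics of the first metric have, for the second
  one, acceleration in the complex line of their velocity; this is all that is used of c-projective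
  equivalence.\<close>

locale c_projective_charts =
  K1: kaehler_chart S h1 G1 + K2: kaehler_chart S h2 G2
  for S :: "(complex ^ 'n) set" and h1 G1 h2 G2 +
  assumes diagonal: "x \<in> S \<Longrightarrow> \<exists>c. G2 x v v - G1 x v v = c *s v"
begin

text \<open>Defined by traces because the scalars in \<open>diagonal\<close> are chosen pointwise
  and carry no smoothness.\<close>

definition Ups :: "complex ^ 'n \<Rightarrow> complex ^ 'n \<Rightarrow> complex" where
  "Ups x v = (K2.ctr x v - K1.ctr x v) / (of_nat CARD('n) + 1)"

definition dUps :: "complex ^ 'n \<Rightarrow> complex ^ 'n \<Rightarrow> complex ^ 'n \<Rightarrow> complex" where
  "dUps x u v = (K2.dctr x u v - K1.dctr x u v) / (of_nat CARD('n) + 1)"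

lemma card_nonzero: "(of_nat CARD('n) + 1 :: complex) \<noteq> 0"
  using of_nat_neq_0[of "CARD('n)", where 'a = complex] by (simp add: add.commute)

lemma has_derivative_Ups: "x \<in> S \<Longrightarrow> ((\<lambda>y. Ups y v) has_derivative (\<lambda>u. dUps x u v)) (at x)"
  unfolding Ups_def dUps_def
  by (intro bounded_linear.has_derivative[OF bounded_linear_divide] has_derivative_diff
      K1.has_derivative_ctr K2.has_derivative_ctr)

lemma smooth_Ups: "smooth_on S (\<lambda>y. Ups y v)"
  unfolding Ups_def
  by (intro smooth_on_bounded_linear[OF bounded_linear_divide] smooth_on_diff
      K1.smooth_ctr K2.smooth_ctr K1.open_S)

lemma Ups_add: "x \<in> S \<Longrightarrow> Ups x (v + w) = Ups x v + Ups x w"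
  and Ups_scale: "x \<in> S \<Longrightarrow> Ups x (c *s v) = c * Ups x v"
  by (simp_all add: Ups_def K1.ctr_add K2.ctr_add K1.ctr_scale K2.ctr_scale field_simps
      add_divide_distrib diff_divide_distrib)

lemma dUps_scale: "x \<in> S \<Longrightarrow> dUps x u (c *s v) = c * dUps x u v"
  by (simp add: dUps_def K1.dctr_scale K2.dctr_scale right_diff_distrib)

lemma G2_eq:
  assumes x: "x \<in> S"
  shows "G2 x v w = G1 x v w + Ups x v *s w + Ups x w *s v"
proof -
  define D where "D v w = G2 x v w - G1 x v w" for v w
  have tr: "complex_trace (D v) = K2.ctr x v - K1.ctr x v" for v
    by (simp add: complex_trace_def D_def K1.ctr_def K2.ctr_def sum_subtractf)
  have "D v w = (complex_trace (D v) / (of_nat CARD('n) + 1)) *s w + (complex_trace (D w) / (of_nat CARD('n) + 1)) *s v"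
  proof (rule symmetric_bilinear_diagonal)
    show "complex_linear (D v)" for v
      using K1.clin_G[OF x, of v] K2.clin_G[OF x, of v]
      by (simp add: complex_linear_def D_def vec_eq_iff algebra_simps)
    show "D v w = D w v" for v w
      unfolding D_def K1.sym_G[OF x, of v w] K2.sym_G[OF x, of v w] ..
    show "\<exists>c. D v v = c *s v" for v using diagonal[OF x] by (simp add: D_def)
  qed
  then have "D v w = Ups x v *s w + Ups x w *s v" unfolding tr Ups_def .
  then show ?thesis by (simp add: D_def algebra_simps)
qed

lemma DG2_eq:
  assumes x: "x \<in> S"
  shows "K2.DG x u v w = K1.DG x u v w + dUps x u v *s w + dUps x u w *s v"
  by (rule K2.DG_eqI[OF x has_derivative_add[OF has_derivative_add[OF K1.has_derivative_G[OF x]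
            bounded_linear.has_derivative[OF bounded_linear_complex_scale_left has_derivative_Ups[OF x]]]
          bounded_linear.has_derivative[OF bounded_linear_complex_scale_left has_derivative_Ups[OF x]]]])
    (simp add: G2_eq)

definition dbar_Ups where "dbar_Ups x u v = (dUps x u v + \<i> * dUps x (\<i> *s u) v) / 2"

lemma mixed_curvature_relation:
  assumes x: "x \<in> S"
  shows "mixed_curvature G2 x u v w = mixed_curvature G1 x u v w + dbar_Ups x u v *s w + dbar_Ups x u w *s v"
  unfolding K1.mixed_curvature_eq K2.mixed_curvature_eq DG2_eq[OF x] dbar_Ups_def
  by (simp add: vec_eq_iff field_simps)

lemma ricci_form_relation:
  assumes x: "x \<in> S"
  shows "ricci_form G2 x v u = ricci_form G1 x v u + dbar_Ups x u v"
proof -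
  have "(a + \<i> * b) / (2 * N) = (c + \<i> * d) / (2 * N) + ((a - c) / N + \<i> * ((b - d) / N)) / 2"
    if "N \<noteq> 0" for a b c d N :: complex
    using that by (simp add: field_simps)
  from this[OF card_nonzero] show ?thesis
    unfolding K1.ricci_form_eq_dctr[OF x] K2.ricci_form_eq_dctr[OF x] dbar_Ups_def dUps_def by blast
qed

lemma weyl_relation: "x \<in> S \<Longrightarrow> weyl G2 x u v w = weyl G1 x u v w"
  by (simp add: weyl_def mixed_curvature_relation ricci_form_relation vec_eq_iff algebra_simps)

text \<open>Both metrics satisfy \<open>pure_curvature_vanishes\<close>. The difference of the two
  identities involves only the defect \<open>B\<close> of the claim, and the vector identity
  \<open>id\<close> forces \<open>B = 0\<close> in complex dimension at least 2.\<close>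

lemma pure_dUps:
  assumes x: "x \<in> S" and n: "CARD('n) \<ge> 2"
  shows "(dUps x u v - \<i> * dUps x (\<i> *s u) v) / 2 = Ups x (G1 x u v) + Ups x u * Ups x v"
proof -
  define B where "B u v = (dUps x u v - \<i> * dUps x (\<i> *s u) v) / 2 - Ups x (G1 x u v) - Ups x u * Ups x v" for u v
  note l = complex_linear_add[OF K1.clin_G[OF x]] complex_linear_scale[OF K1.clin_G[OF x]]
    complex_linear_add[OF K1.clin_G'[OF x]] complex_linear_scale[OF K1.clin_G'[OF x]]
    Ups_add[OF x] Ups_scale[OF x]
  have id: "(B u v - B v u) *s w + B u w *s v - B v w *s u = 0" for u v w
  proof -
    note P2 = K2.pure_curvature_vanishes[OF x, of u v w, unfolded DG2_eq[OF x] G2_eq[OF x] l K1.sym_G[OF x, of v u] vec_eq_iff]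
    note P1 = K1.pure_curvature_vanishes[OF x, of u v w, unfolded K1.sym_G[OF x, of v u] vec_eq_iff]
    show ?thesis
      unfolding vec_eq_iff
    proof
    fix i
    show "((B u v - B v u) *s w + B u w *s v - B v w *s u) $ i = 0 $ i"
      using P2[THEN spec, of i] P1[THEN spec, of i] by (simp add: B_def K1.sym_G[OF x, of v u] field_simps) algebra
    qed
  qed
  have Bs: "B u (c *s v) = c * B u v" for c u v
    by (simp add: B_def dUps_scale[OF x] l field_simps)
  \<comment> \<open>The case \<open>w = u\<close> of \<open>id\<close>. Exchanging \<open>u\<close>
    and \<open>v\<close> then gives \<open>B u v = 4 * B u v\<close> for independent
    vectors.\<close>
  have key: "B u u = 0 \<and> B u v = 2 * B v u" if "u \<noteq> 0" "\<And>c. v \<noteq> c *s u" for u v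
  proof -
    have "(B u v - 2 * B v u) *s u + B u u *s v = 0"
      using id[of u v u] by (simp add: vec_eq_iff algebra_simps)
    from complex_independent[OF that this] show ?thesis by auto
  qed
  have "B u v = 0"
  proof (cases "u = 0 \<or> v = 0")
    case True
    have "dUps x 0 v = 0"
      using K1.dctr_minus_direction[OF x, of 0 v] K2.dctr_minus_direction[OF x, of 0 v] by (simp add: dUps_def)
    moreover have "G1 x 0 v = 0" "Ups x 0 = 0"
      using complex_linear_scale[OF K1.clin_G'[OF x], of 0 0 v] Ups_scale[OF x, of 0 0] by auto
    ultimately have "B 0 v = 0" by (simp add: B_def)
    moreover have "B u 0 = 0" using Bs[of u 0 0] by simp
    ultimately show ?thesis using True by auto
  next
    case False
    then have uv: "u \<noteq> 0" "v \<noteq> 0" by auto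
    show ?thesis
    proof (cases "\<exists>c. v = c *s u")
      case True
      then obtain c where c: "v = c *s u" by blast
      obtain w where "\<And>c. w \<noteq> c *s u" using exists_complex_independent[OF n uv(1)] by blast
      then have "B u u = 0" using key[OF uv(1)] by blast
      then show ?thesis by (simp add: c Bs)
    next
      case False
      moreover have "\<And>c. u \<noteq> c *s v"
      proof
        fix c assume c: "u = c *s v"
        then have "c \<noteq> 0" using uv by auto
        then have "v = (1 / c) *s u" using c by (simp add: vector_smult_assoc)
        then show False using False by blast
      qed
      ultimately have "B u v = 2 * B v u" "B v u = 2 * B u v"
        using key[OF uv(1), of v] key[OF uv(2), of u] by auto
      then show ?thesis by simp
    qed
  qed
  then show ?thesis by (simp add: B_def algebra_simps)
qed

text \<open>The derivative is the sum of its parts complex linear and antilinear in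
  \<open>u\<close>: the first is \<open>pure_dUps\<close>, the second the difference of the Ricci
  forms.\<close>

lemma dUps_eq:
  assumes x: "x \<in> S" and n: "CARD('n) \<ge> 2"
  shows "dUps x u v = Ups x (G1 x u v) + Ups x u * Ups x v + (ricci_form G2 x v u - ricci_form G1 x v u)"
  using pure_dUps[OF x n, of u v] unfolding ricci_form_relation[OF x] dbar_Ups_def by (simp add: field_simps)

text \<open>The components of \<open>h2 - k h1\<close> and \<open>Ups\<close> form a closed linear system: \<open>dE\<close> and \<open>dU\<close>, the latter
  because both metrics are Einstein.\<close>

lemma proportionality_spreads:
  assumes n: "CARD('n) \<ge> 2"
    and ric1: "\<And>x v u. x \<in> S \<Longrightarrow> ricci_form G1 x v u = of_real b1 * h1 x v u"
    and ric2: "\<And>x v u. x \<in> S \<Longrightarrow> ricci_form G2 x v u = of_real b2 * h2 x v u"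
    and B: "cball a r \<subseteq> S" "y0 \<in> ball a r" "y \<in> ball a r"
    and multiple: "\<And>v w. h2 y0 v w = of_real k * h1 y0 v w" and U0: "\<And>v. Ups y0 v = 0"
    and bk: "b2 * k = b1"
  shows "h2 y v w = of_real k * h1 y v w"
proof -
  have inS: "x \<in> S" if "x \<in> ball a r" for x using B(1) that by auto
  define E where "E y v w = h2 y v w - of_real k * h1 y v w" for y v w
  have hE: "hermitian_form (E x)" if "x \<in> S" for x
    unfolding hermitian_form_def E_def
    by (simp add: hermitian_form_add_left[OF K1.herm[OF that]] hermitian_form_add_left[OF K2.herm[OF that]]
        hermitian_form_scale_left[OF K1.herm[OF that]] hermitian_form_scale_left[OF K2.herm[OF that]]
        hermitian_form_cnj[OF K1.herm[OF that]] hermitian_form_cnj[OF K2.herm[OF that]] algebra_simps)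
  define dE where "dE x z v w = E x (G1 x z v) w + E x v (G1 x z w)
      + (Ups x z * h2 x v w + Ups x v * h2 x z w + cnj (Ups x z) * h2 x v w + cnj (Ups x w) * h2 x v z)"
    for x z v w
  have dE: "((\<lambda>y. E y v w) has_derivative (\<lambda>z. dE x z v w)) (at x)" if x: "x \<in> S" for x v w
  proof -
    have "((\<lambda>y. E y v w) has_derivative (\<lambda>z. h2 x (G2 x z v) w + h2 x v (G2 x z w)
        - of_real k * (h1 x (G1 x z v) w + h1 x v (G1 x z w)))) (at x)"
      unfolding E_def
      by (intro has_derivative_diff has_derivative_mult_right K1.has_derivative_h K2.has_derivative_h x)
    then show ?thesis
      unfolding dE_def E_def G2_eq[OF x]
      by (simp add: hermitian_form_add_left[OF K2.herm[OF x]] hermitian_form_add_right[OF K2.herm[OF x]]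
          hermitian_form_scale_left[OF K2.herm[OF x]] hermitian_form_scale_right[OF K2.herm[OF x]] algebra_simps)
  qed
  \<comment> \<open>Here \<open>bk\<close> turns the Ricci difference \<open>b2 h2 - b1 h1\<close>
    into \<open>b2 * E\<close>, so the right-hand side vanishes together with \<open>E\<close> and
    \<open>Ups\<close>.\<close>
  have dU: "dUps x u v = Ups x (G1 x u v) + Ups x u * Ups x v + of_real b2 * E x v u" if x: "x \<in> S" for x u v
    unfolding dUps_eq[OF x n] ric1[OF x] ric2[OF x] bk[symmetric] E_def by (simp add: algebra_simps)
  obtain CG where CG: "CG \<ge> 0" "\<And>y v w. y \<in> cball a r \<Longrightarrow> norm (G1 y v w) \<le> CG * norm v * norm w"
    using bilinear_field_bound[of "cball a r" G1] B(1) K1.bilinear_G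
      continuous_on_subset[OF smooth_on_imp_continuous_on[OF K1.smooth_G] B(1)] by (metis compact_cball subsetD)
  obtain CH where CH: "CH \<ge> 0" "\<And>y v w. y \<in> cball a r \<Longrightarrow> norm (h2 y v w) \<le> CH * norm v * norm w"
    using bilinear_field_bound[of "cball a r" h2] B(1) hermitian_form_bilinear[OF K2.herm]
      continuous_on_subset[OF smooth_on_imp_continuous_on[OF K2.smooth_h] B(1)] by (metis compact_cball subsetD)
  \<comment> \<open>A dummy real argument makes the linear field bilinear, so that
    \<open>bilinear_field_bound\<close> applies.\<close>
  have bU: "bilinear (\<lambda>v (c::real). c *\<^sub>R Ups x v)" if "x \<in> S" for x
    unfolding bilinear_def
    by (auto intro!: linearI simp: Ups_add[OF that] Ups_scale[OF that] scaleR_eq_of_real_scale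
        scaleR_conv_of_real algebra_simps)
  obtain CU where CU: "CU \<ge> 0" "\<And>y v (c::real). y \<in> cball a r \<Longrightarrow> norm (c *\<^sub>R Ups y v) \<le> CU * norm v * norm c"
    using bilinear_field_bound[of "cball a r" "\<lambda>y v (c::real). c *\<^sub>R Ups y v"] B(1) bU
      continuous_on_scaleR[OF continuous_on_const
        continuous_on_subset[OF smooth_on_imp_continuous_on[OF smooth_Ups] B(1)]]
    by (metis (no_types, lifting) compact_cball subsetD)
  have CU': "norm (Ups y v) \<le> CU * norm v" if "y \<in> cball a r" for y v
    using CU(2)[OF that, of 1 v] by simp
  define F where "F p y = (case p of Inl (i, j) \<Rightarrow> E y (axis i 1) (axis j 1) | Inr i \<Rightarrow> Ups y (axis i 1))"
    for p :: "('n \<times> 'n) + 'n" and y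
  define F' where "F' p y z = (case p of Inl (i, j) \<Rightarrow> dE y z (axis i 1) (axis j 1) | Inr i \<Rightarrow> dUps y z (axis i 1))"
    for p :: "('n \<times> 'n) + 'n" and y z
  define M where "M y = (\<Sum>p\<in>UNIV. norm (F p y))" for y
  have M: "M y = (\<Sum>i\<in>UNIV. \<Sum>j\<in>UNIV. norm (E y (axis i 1) (axis j 1))) + (\<Sum>i\<in>UNIV. norm (Ups y (axis i 1)))" for y
    unfolding M_def UNIV_Plus_UNIV[symmetric]
    by (subst sum.Plus) (simp_all add: F_def UNIV_Times_UNIV[symmetric] sum.cartesian_product comp_def
        case_prod_unfold del: UNIV_Times_UNIV)
  have M0: "M y \<ge> 0" for y unfolding M_def by (intro sum_nonneg) simp
  have EM: "norm (E y v w) \<le> norm v * norm w * M y" if "y \<in> S" for y v w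
    by (rule order_trans[OF hermitian_form_norm_bound[OF hE[OF that]]])
      (auto simp: M intro!: mult_left_mono sum_nonneg)
  have UM: "norm (Ups y v) \<le> norm v * M y" if y: "y \<in> S" for y v
  proof -
    have "Ups y v = Ups y (\<Sum>i\<in>UNIV. v $ i *s axis i 1)" using vec_eq_sum_axis[of v] by simp
    also have "\<dots> = (\<Sum>i\<in>UNIV. v $ i * Ups y (axis i 1))"
    proof -
      have "linear (Ups y)"
        by (rule linearI) (simp_all add: Ups_add[OF y] Ups_scale[OF y] scaleR_eq_of_real_scale scaleR_conv_of_real)
      then show ?thesis by (simp add: linear_sum Ups_scale[OF y])
    qed
    also have "norm \<dots> \<le> (\<Sum>i\<in>UNIV. norm v * norm (Ups y (axis i 1)))"
      by (rule sum_norm_le) (simp add: norm_mult mult_right_mono Finite_Cartesian_Product.norm_nth_le)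
    also have "\<dots> \<le> norm v * M y"
      unfolding sum_distrib_left[symmetric] M by (auto intro!: mult_left_mono sum_nonneg)
    finally show ?thesis .
  qed
  \<comment> \<open>\<open>2 * CG + 4 * CH\<close> bounds the two Christoffel terms and the four
    \<open>Ups\<close>-\<open>h2\<close> products of \<open>dE\<close>, the rest bounds
    \<open>dUps\<close>. Its quadratic term counts as linear because one factor is bounded by
    \<open>CU\<close> on the ball.\<close>
  define K where "K = 2 * CG + 4 * CH + CG + CU + \<bar>b2\<bar>"
  have K0: "0 \<le> K" using CG CH CU by (simp add: K_def)
  have bound: "norm (F' p x z) \<le> K * norm z * (\<Sum>q\<in>UNIV. norm (F q x))" if x': "x \<in> ball a r" for p x z
  proof -
    have x: "x \<in> S" "x \<in> cball a r" using x' inS by auto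
    have zM: "0 \<le> norm z * M x" using M0 by simp
    have mono: "c * (norm z * M x) \<le> K * norm z * M x" if "c \<le> K" for c
      using mult_right_mono[OF that zM] by (simp add: mult.assoc)
    have EG: "norm (E x (G1 x z v) w) \<le> CG * (norm z * M x)" "norm (E x v (G1 x z w)) \<le> CG * (norm z * M x)"
      if "norm v = 1" "norm w = 1" for v w
    proof -
      have "norm (E x (G1 x z v) w) \<le> (CG * norm z * norm v) * norm w * M x"
        by (rule order_trans[OF EM[OF x(1)]]) (intro mult_right_mono CG(2) x M0 norm_ge_zero)
      then show "norm (E x (G1 x z v) w) \<le> CG * (norm z * M x)" using that by (simp add: mult.assoc)
      have "norm (E x v (G1 x z w)) \<le> norm v * (CG * norm z * norm w) * M x"
        by (rule order_trans[OF EM[OF x(1)]]) (intro mult_right_mono mult_left_mono CG(2) x M0 norm_ge_zero)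
      then show "norm (E x v (G1 x z w)) \<le> CG * (norm z * M x)" using that by (simp add: mult.assoc)
    qed
    have UH: "norm (Ups x s * h2 x t t') \<le> CH * (norm z * M x)"
      "norm (cnj (Ups x s) * h2 x t t') \<le> CH * (norm z * M x)"
      if "norm s * (norm t * norm t') = norm z" for s t t'
    proof -
      have "norm (Ups x s) * norm (h2 x t t') \<le> (norm s * M x) * (CH * norm t * norm t')"
        by (intro mult_mono UM CH(2) x) (simp_all add: M0)
      also have "\<dots> = CH * ((norm s * (norm t * norm t')) * M x)" by (simp add: mult_ac)
      finally show "norm (Ups x s * h2 x t t') \<le> CH * (norm z * M x)"
        "norm (cnj (Ups x s) * h2 x t t') \<le> CH * (norm z * M x)"
        unfolding that by (simp_all add: norm_mult)
    qed
    show ?thesis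
    proof (cases p)
      case (Inl ij)
      obtain i j where ij: "ij = (i, j)" by (cases ij)
      let ?v = "axis i 1 :: complex ^ 'n" and ?w = "axis j 1 :: complex ^ 'n"
      have nv: "norm ?v = 1" "norm ?w = 1" by auto
      have "norm (dE x z ?v ?w) \<le> CG * (norm z * M x) + CG * (norm z * M x)
          + (CH * (norm z * M x) + CH * (norm z * M x) + CH * (norm z * M x) + CH * (norm z * M x))"
        unfolding dE_def by (intro norm_triangle_mono EG UH nv) (simp_all add: nv)
      also have "\<dots> = (2 * CG + 4 * CH) * (norm z * M x)" by (simp add: algebra_simps)
      also have "\<dots> \<le> K * norm z * M x" by (rule mono) (use CG CU in \<open>simp add: K_def\<close>)
      finally show ?thesis by (simp add: Inl ij F'_def M_def)
    next
      case (Inr i)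
      let ?v = "axis i 1 :: complex ^ 'n"
      have nv: "norm ?v = 1" by simp
      have "norm (Ups x (G1 x z ?v)) \<le> (CG * norm z * norm ?v) * M x"
        by (rule order_trans[OF UM[OF x(1)]]) (intro mult_right_mono CG(2) x M0)
      moreover have "norm (Ups x z * Ups x ?v) \<le> (norm z * M x) * (CU * norm ?v)"
        unfolding norm_mult by (intro mult_mono UM CU' x) (simp_all add: M0)
      moreover have "norm (of_real b2 * E x ?v z) \<le> \<bar>b2\<bar> * (norm ?v * norm z * M x)"
        unfolding norm_mult norm_of_real by (intro mult_left_mono EM x) auto
      ultimately have "norm (dUps x z ?v) \<le> (CG * norm z * norm ?v) * M x + (norm z * M x) * (CU * norm ?v)
          + \<bar>b2\<bar> * (norm ?v * norm z * M x)"
        unfolding dU[OF x(1)] by (intro norm_triangle_mono)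
      also have "\<dots> = (CG + CU + \<bar>b2\<bar>) * (norm z * M x)" by (simp add: algebra_simps)
      also have "\<dots> \<le> K * norm z * M x" by (rule mono) (use CG CH in \<open>simp add: K_def\<close>)
      finally show ?thesis by (simp add: Inr F'_def M_def)
    qed
  qed
  have z: "F p y = 0" for p
  proof (rule zero_of_linear_system_bound[where F = F and F' = F' and I = UNIV and K = K, OF convex_ball B(2,3)])
    show "(F p has_derivative F' p x) (at x)" if "x \<in> ball a r" for p x
      using dE[OF inS[OF that]] has_derivative_Ups[OF inS[OF that]]
      by (cases p) (auto simp: F_def[abs_def] F'_def[abs_def])
    show "F p y0 = 0" for p
      by (cases p) (auto simp: F_def E_def multiple U0)
  qed (use bound K0 in auto)
  have "E y (axis i 1) (axis j 1) = 0" for i j using z[of "Inl (i, j)"] by (simp add: F_def)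
  then have "norm (E y v w) \<le> 0"
    using hermitian_form_norm_bound[OF hE[OF inS[OF B(3)]], of v w] by simp
  then show ?thesis by (simp add: E_def)
qed

end

section \<open>Consequences of proportionality on an open set\<close>

lemma nondegenerate_nonzero_value:
  assumes "nondegenerate_form (h :: complex ^ 'n \<Rightarrow> complex ^ 'n \<Rightarrow> complex)"
  obtains v w where "h v w \<noteq> 0"
proof -
  have "axis undefined 1 \<noteq> (0 :: complex ^ 'n)" by (simp add: axis_eq_0_iff)
  then show thesis using assms that unfolding nondegenerate_form_def by metis
qed

lemma hermitian_forms_ratio_real:
  assumes p: "hermitian_form p" and h: "hermitian_form h" "nondegenerate_form h"
    and ph: "\<And>v w. p v w = c * h v w"
  shows "c = of_real (Re c)"
proof -
  obtain v w where w: "h v w \<noteq> 0" using nondegenerate_nonzero_value[OF h(2)] by blast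
  have "p w v = cnj c * h w v"
    using arg_cong[OF ph[of v w], of cnj] by (simp add: hermitian_form_cnj[OF p] hermitian_form_cnj[OF h(1)])
  then have "cnj c * h w v = c * h w v" using ph[of w v] by metis
  moreover have "h w v \<noteq> 0" using w hermitian_form_cnj[OF h(1), of w v] by auto
  ultimately have "cnj c = c" using mult_right_cancel by blast
  then show ?thesis by (simp add: complex_eq_iff)
qed

context c_projective_charts
begin

text \<open>Differentiating \<open>h2 = f h1\<close> holomorphically along \<open>z\<close> gives
  \<open>2 f (Ups z v + Ups v z) = \<phi> v\<close> as vectors. A direction \<open>z\<close>
  independent of \<open>v\<close> makes \<open>Ups\<close> vanish at \<open>v\<close>. This supplies
  the initial values and the relation of constants required by
  \<open>proportionality_spreads\<close>.\<close>

lemma proportional_on_open: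
  assumes n: "CARD('n) \<ge> 2"
    and ric1: "\<And>x v u. x \<in> S \<Longrightarrow> ricci_form G1 x v u = of_real b1 * h1 x v u"
    and ric2: "\<And>x v u. x \<in> S \<Longrightarrow> ricci_form G2 x v u = of_real b2 * h2 x v u"
    and U: "open U" "U \<subseteq> S" "y0 \<in> U"
    and multiple: "\<And>y. y \<in> U \<Longrightarrow> \<exists>k::real. \<forall>v w. h2 y v w = of_real k * h1 y v w"
  shows "\<exists>k::real. (\<forall>v w. h2 y0 v w = of_real k * h1 y0 v w) \<and> (\<forall>v. Ups y0 v = 0) \<and> b2 * k = b1"
proof -
  obtain k where k: "\<And>y v w. y \<in> U \<Longrightarrow> h2 y v w = of_real (k y :: real) * h1 y v w"
    using multiple by metis
  have Ups0: "Ups x v = 0" if x: "x \<in> U" for x v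
  proof (cases "v = 0")
    case True
    then show ?thesis using Ups_scale[of x 0 0] U x by auto
  next
    case False
    have xS: "x \<in> S" using U x by auto
    note H1 = K1.herm[OF xS] and H2 = K2.herm[OF xS]
    obtain p q where pq: "h1 x p q \<noteq> 0" using nondegenerate_nonzero_value[OF K1.nondeg[OF xS]] by blast
    define U' where "U' = {y \<in> U. h1 y p q \<noteq> 0}"
    have "continuous_on U (\<lambda>y. h1 y p q)"
      using continuous_on_subset[OF smooth_on_imp_continuous_on[OF K1.smooth_h] U(2)] .
    then have U': "open U'" "x \<in> U'"
      using continuous_open_preimage[OF _ U(1), of "\<lambda>y. h1 y p q" "- {0}"] x pq
      by (auto simp: U'_def vimage_def Int_def)
    \<comment> \<open>The factor \<open>k\<close> was chosen pointwise; as a quotient of components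
      it becomes differentiable near \<open>x\<close>.\<close>
    define f where "f y = h2 y p q / h1 y p q" for y
    have f: "h2 y v w = f y * h1 y v w" if "y \<in> U'" for y v w
      using that k[of y] by (auto simp: U'_def f_def)
    define f' where "f' = frechet_derivative f (at x)"
    have "f differentiable (at x)"
      unfolding f_def using pq
      by (intro differentiable_divide differentiableI[OF K1.has_derivative_h[OF xS]]
          differentiableI[OF K2.has_derivative_h[OF xS]])
    then have f': "(f has_derivative f') (at x)"
      unfolding f'_def by (rule has_derivative_frechet)
    have D: "h2 x (G2 x z v) w + h2 x v (G2 x z w)
        = f x * (h1 x (G1 x z v) w + h1 x v (G1 x z w)) + f' z * h1 x v w" for z v w
    proof -
      have "((\<lambda>y. h2 y v w) has_derivative
          (\<lambda>z. f x * (h1 x (G1 x z v) w + h1 x v (G1 x z w)) + f' z * h1 x v w)) (at x)"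
        by (rule has_derivative_transform_within_open[OF has_derivative_mult[OF f' K1.has_derivative_h[OF xS]] U'])
          (simp add: f)
      from fun_cong[OF has_derivative_unique[OF K2.has_derivative_h[OF xS] this], of z] show ?thesis .
    qed
    have fx: "f x \<noteq> 0"
    proof
      assume "f x = 0"
      then have "h2 x p q = 0" for p q using f[OF U'(2)] by simp
      then show False using nondegenerate_nonzero_value[OF K2.nondeg[OF xS]] by metis
    qed
    obtain z where z: "\<And>c. z \<noteq> c *s v" using exists_complex_independent[OF n False] by blast
    \<comment> \<open>Twice the holomorphic derivative of \<open>f\<close>. The same combination of
      \<open>D\<close> at \<open>z\<close> and at \<open>\<i> *s z\<close> removes the terms with
      \<open>G\<close> in the second slot, which are antilinear in \<open>z\<close>.\<close>
    define \<phi> where "\<phi> = f' z - \<i> * f' (\<i> *s z)"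
    have e: "2 * h2 x (G2 x z v) w = 2 * f x * h1 x (G1 x z v) w + \<phi> * h1 x v w" for w
    proof -
      have "h2 x (G2 x (\<i> *s z) v) w + h2 x v (G2 x (\<i> *s z) w) = \<i> * h2 x (G2 x z v) w - \<i> * h2 x v (G2 x z w)"
        by (simp add: complex_linear_scale[OF K2.clin_G'[OF xS]] hermitian_form_scale_left[OF H2]
            hermitian_form_scale_right[OF H2])
      moreover have "h1 x (G1 x (\<i> *s z) v) w + h1 x v (G1 x (\<i> *s z) w) = \<i> * h1 x (G1 x z v) w - \<i> * h1 x v (G1 x z w)"
        by (simp add: complex_linear_scale[OF K1.clin_G'[OF xS]] hermitian_form_scale_left[OF H1]
            hermitian_form_scale_right[OF H1])
      ultimately have i: "\<i> * h2 x (G2 x z v) w - \<i> * h2 x v (G2 x z w)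
          = f x * (\<i> * h1 x (G1 x z v) w - \<i> * h1 x v (G1 x z w)) + f' (\<i> *s z) * h1 x v w"
        using D[of "\<i> *s z" v w] by simp
      have ii: "\<i> * \<i> = -1" by simp
      show ?thesis unfolding \<phi>_def using D[of z v w] i ii by algebra
    qed
    have "(2 * f x) *s (Ups x z *s v + Ups x v *s z) = \<phi> *s v"
    proof (rule nondegenerate_eqI[OF H1 K1.nondeg[OF xS]])
      fix w
      show "h1 x ((2 * f x) *s (Ups x z *s v + Ups x v *s z)) w = h1 x (\<phi> *s v) w"
        using e[of w] unfolding f[OF U'(2)] G2_eq[OF xS]
        by (simp add: hermitian_form_add_left[OF H1] hermitian_form_scale_left[OF H1] algebra_simps)
    qed
    then have "(2 * f x * Ups x z - \<phi>) *s v + (2 * f x * Ups x v) *s z = 0"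
      by (simp add: vec_eq_iff algebra_simps)
    from complex_independent(2)[OF False z this] show ?thesis using fx by simp
  qed
  have yS: "y0 \<in> S" using U by auto
  \<comment> \<open>\<open>Ups\<close> vanishes on a neighbourhood, so its derivative does too; the
    Ricci forms then agree at \<open>y0\<close>, and comparing them ties \<open>b1\<close> to
    \<open>b2\<close>.\<close>
  have "dUps y0 u v = 0" for u v
  proof -
    have "((\<lambda>y. Ups y v) has_derivative (\<lambda>u. 0)) (at y0)"
      by (rule has_derivative_transform_within_open[OF has_derivative_const U(1,3)]) (simp add: Ups0)
    from fun_cong[OF has_derivative_unique[OF has_derivative_Ups[OF yS] this], of u] show ?thesis .
  qed
  then have ric: "ricci_form G2 y0 v u = ricci_form G1 y0 v u" for u v
    by (simp add: ricci_form_relation[OF yS] dbar_Ups_def)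
  obtain p q where pq: "h1 y0 p q \<noteq> 0" using nondegenerate_nonzero_value[OF K1.nondeg[OF yS]] by blast
  have "of_real (b2 * k y0) * h1 y0 p q = of_real b1 * h1 y0 p q"
    using ric[of p q] unfolding ric1[OF yS] ric2[OF yS] k[OF U(3)] by simp
  then have "b2 * k y0 = b1" using pq by (simp only: mult_cancel_right of_real_eq_iff) simp
  then show ?thesis using k[OF U(3)] Ups0[OF U(3)] by blast
qed

end

section \<open>A Schur lemma for the factor of the Ricci form\<close>

context kaehler_chart
begin

text \<open>The Ricci form is an antiholomorphic derivative of \<open>ctr\<close>, so a second one
  is symmetric in the two directions. Applied to \<open>\<alpha> h\<close>, this symmetry leaves
  only the derivative of \<open>\<alpha>\<close>, which must vanish when there are two independent
  directions.\<close>

lemma ricci_factor_locally_constant: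
  assumes n: "CARD('n) \<ge> 2" and B: "ball a r \<subseteq> S"
    and ric: "\<And>x v u. x \<in> ball a r \<Longrightarrow> ricci_form G x v u = of_real (\<alpha> x) * h x v u"
    and xy: "x \<in> ball a r" "y \<in> ball a r"
  shows "\<alpha> x = \<alpha> y"
proof -
  have "(\<alpha> has_derivative (\<lambda>z. 0)) (at x)" if xB: "x \<in> ball a r" for x
  proof -
    have x: "x \<in> S" using B xB by auto
    note H = herm[OF x]
    obtain p q where pq: "h x p q \<noteq> 0" using nondegenerate_nonzero_value[OF nondeg[OF x]] by blast
    define U where "U = {y \<in> ball a r. h y p q \<noteq> 0}"
    have "continuous_on (ball a r) (\<lambda>y. h y p q)"
      using continuous_on_subset[OF smooth_on_imp_continuous_on[OF smooth_h] B] .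
    then have U: "open U" "x \<in> U"
      using continuous_open_preimage[OF _ open_ball, of a r "\<lambda>y. h y p q" "- {0}"] xB pq
      by (auto simp: U_def vimage_def Int_def)
    have "(\<lambda>y. ricci_form G y p q / h y p q) differentiable (at x)"
      using pq
      by (intro differentiable_divide differentiableI[OF has_derivative_h[OF x]]
          differentiableI[OF smooth_on_has_derivative[OF smooth_ricci_form x]])
    then have "((\<lambda>y. Re (ricci_form G y p q / h y p q)) has_derivative
        (\<lambda>z. Re (frechet_derivative (\<lambda>y. ricci_form G y p q / h y p q) (at x) z))) (at x)"
      by (intro bounded_linear.has_derivative[OF bounded_linear_Re] has_derivative_frechet)
    then obtain \<alpha>' where "((\<lambda>y. Re (ricci_form G y p q / h y p q)) has_derivative \<alpha>') (at x)" by blast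
    then have \<alpha>': "(\<alpha> has_derivative \<alpha>') (at x)"
      by (rule has_derivative_transform_within_open[OF _ U]) (simp add: U_def ric)
    define H2 where "H2 z u v = frechet_derivative (\<lambda>y. frechet_derivative (\<lambda>y. ctr y v) (at y) u) (at x) z" for z u v
    have H2sym: "H2 z u v = H2 u z v" for z u v
      unfolding H2_def by (rule second_derivative_symmetric[OF smooth_ctr open_S x])
    let ?N = "2 * (of_nat CARD('n) + 1) :: complex"
    have d1: "((\<lambda>y. ricci_form G y v u) has_derivative (\<lambda>z. (H2 z u v + \<i> * H2 z (\<i> *s u) v) / ?N)) (at x)" for v u
    proof -
      have "((\<lambda>y. frechet_derivative (\<lambda>y. ctr y v) (at y) u) has_derivative (\<lambda>z. H2 z u v)) (at x)" for u
        unfolding H2_def by (rule smooth_on_has_derivative[OF smooth_on_derivative[OF smooth_ctr] x])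
      then have "((\<lambda>y. (frechet_derivative (\<lambda>y. ctr y v) (at y) u
            + \<i> * frechet_derivative (\<lambda>y. ctr y v) (at y) (\<i> *s u)) / ?N) has_derivative
          (\<lambda>z. (H2 z u v + \<i> * H2 z (\<i> *s u) v) / ?N)) (at x)"
        by (intro bounded_linear.has_derivative[OF bounded_linear_divide] has_derivative_add
            has_derivative_mult_right)
      then show ?thesis
        by (rule has_derivative_transform_within_open[OF _ open_S x])
          (simp add: ricci_form_eq_dctr frechet_derivative_eqI[OF has_derivative_ctr])
    qed
    have d2: "(H2 z u v + \<i> * H2 z (\<i> *s u) v) / ?N
        = of_real (\<alpha> x) * (h x (G x z v) u + h x v (G x z u)) + of_real (\<alpha>' z) * h x v u" for z u v
    proof -
      have "((\<lambda>y. of_real (\<alpha> y) * h y v u) has_derivative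
          (\<lambda>z. of_real (\<alpha> x) * (h x (G x z v) u + h x v (G x z u)) + of_real (\<alpha>' z) * h x v u)) (at x)"
        by (intro has_derivative_mult has_derivative_h[OF x] has_derivative_of_real \<alpha>')
      then have "((\<lambda>y. ricci_form G y v u) has_derivative
          (\<lambda>z. of_real (\<alpha> x) * (h x (G x z v) u + h x v (G x z u)) + of_real (\<alpha>' z) * h x v u)) (at x)"
        by (rule has_derivative_transform_within_open[OF _ open_ball xB]) (simp add: ric)
      from fun_cong[OF has_derivative_unique[OF d1[of v u] this], of z] show ?thesis .
    qed
    \<comment> \<open>Twice the antiholomorphic derivative of the factor; as \<open>\<alpha>\<close>
      is real, \<open>\<beta> z = 0\<close> already gives \<open>\<alpha>' z = 0\<close>.\<close>
    define \<beta> where "\<beta> z = of_real (\<alpha>' z) + \<i> * of_real (\<alpha>' (\<i> *s z))" for z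
    have e: "(H2 z u v + \<i> * H2 z (\<i> *s u) v + \<i> * H2 (\<i> *s z) u v - H2 (\<i> *s z) (\<i> *s u) v) / ?N
        = \<beta> z * h x v u + 2 * of_real (\<alpha> x) * h x v (G x z u)" for z u v
    proof -
      have "(H2 z u v + \<i> * H2 z (\<i> *s u) v + \<i> * H2 (\<i> *s z) u v - H2 (\<i> *s z) (\<i> *s u) v) / ?N
          = (H2 z u v + \<i> * H2 z (\<i> *s u) v) / ?N + \<i> * ((H2 (\<i> *s z) u v + \<i> * H2 (\<i> *s z) (\<i> *s u) v) / ?N)"
        by (simp add: add_divide_distrib diff_divide_distrib distrib_left)
      then show ?thesis
        unfolding d2 \<beta>_def complex_linear_scale[OF clin_G'[OF x]] hermitian_form_scale_left[OF H]
          hermitian_form_scale_right[OF H]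
        by (simp add: algebra_simps)
    qed
    \<comment> \<open>In \<open>e\<close> the left side is symmetric in \<open>z\<close> and
      \<open>u\<close> by \<open>H2sym\<close>, and so is the term with
      \<open>G x z u\<close>.\<close>
    have sym: "\<beta> z * h x v u = \<beta> u * h x v z" for z u v
      using e[of z u v] e[of u z v] sym_G[OF x, of z u] H2sym[of z u v] H2sym[of "\<i> *s z" "\<i> *s u" v]
        H2sym[of z "\<i> *s u" v] H2sym[of "\<i> *s z" u v]
      by (simp add: algebra_simps)
    have "\<beta> z = 0" if z: "z \<noteq> 0" for z
    proof -
      obtain u where u: "\<And>c. u \<noteq> c *s z" using exists_complex_independent[OF n z] by blast
      have "cnj (\<beta> z) *s u = cnj (\<beta> u) *s z"
        by (rule nondegenerate_eqI_right[OF H nondeg[OF x]])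
          (simp add: hermitian_form_scale_right[OF H] sym[of z _ u])
      then have "(- cnj (\<beta> u)) *s z + cnj (\<beta> z) *s u = 0" by (simp add: vec_eq_iff)
      from complex_independent(2)[OF z u this] show ?thesis by simp
    qed
    then have "\<alpha>' z = 0" if "z \<noteq> 0" for z
      using that by (force simp: \<beta>_def complex_eq_iff)
    moreover have "\<alpha>' 0 = 0" using linear_0[OF has_derivative_linear[OF \<alpha>']] .
    ultimately have "\<alpha>' = (\<lambda>z. 0)" by metis
    then show ?thesis using \<alpha>' by simp
  qed
  then have "\<exists>c. \<forall>x\<in>ball a r. \<alpha> x = c"
    by (intro has_derivative_zero_constant[OF convex_ball]) (auto intro: has_derivative_at_withinI)
  then show ?thesis using xy by metis
qed

end

section \<open>The Ricci form of the third metric\<close>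

lemma ricci_proportional_at_point:
  fixes h1 h2 h :: "complex ^ 'n \<Rightarrow> complex ^ 'n \<Rightarrow> complex ^ 'n \<Rightarrow> complex"
  assumes c2: "c_projective_charts S h1 G1 h2 G2" and c: "c_projective_charts S h1 G1 h G" and x: "x \<in> S"
    and ric1: "\<And>v u. ricci_form G1 x v u = of_real b1 * h1 x v u"
    and ric2: "\<And>v u. ricci_form G2 x v u = of_real b2 * h2 x v u"
    and np: "\<And>k::real. \<exists>v w. h2 x v w \<noteq> of_real k * h1 x v w"
  shows "\<exists>\<alpha>::real. \<forall>v u. ricci_form G x v u = of_real \<alpha> * h x v u"
proof -
  interpret c2: c_projective_charts S h1 G1 h2 G2 by fact
  interpret c: c_projective_charts S h1 G1 h G by fact
  show ?thesis
  proof (rule hermitian_forms_proportional[where W = "weyl G1 x"])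
    show "h1 x (weyl G1 x u v w) z = h1 x w (weyl G1 x v u z)" for u v w z
      using c2.K1.weyl_adjoint_defect[OF x, of u v w z] unfolding ric1 by simp
    show "h2 x (weyl G1 x u v w) z = h2 x w (weyl G1 x v u z)" for u v w z
      using c2.K2.weyl_adjoint_defect[OF x, of u v w z] unfolding ric2 c2.weyl_relation[OF x] by simp
    show "h x (weyl G1 x u v w) z - h x w (weyl G1 x v u z)
        = ricci_form G x v z * h x w u - ricci_form G x w u * h x v z" for u v w z
      using c.K2.weyl_adjoint_defect[OF x, of u v w z] unfolding c.weyl_relation[OF x] .
  qed (use x np in \<open>auto intro: c2.K1.herm c2.K1.nondeg c.K2.herm c.K2.nondeg c2.K2.herm
      c.K2.hermitian_ricci_form c2.K1.clin_weyl c2.K1.weyl_sym\<close>)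
qed

text \<open>Proportionality to \<open>h\<close> is the vanishing of the two-by-two minors
  \<open>D\<close>. These are continuous, so an open set with a nonzero minor would contain a point
  covered by \<open>ricci_proportional_at_point\<close>.\<close>

lemma ricci_proportional_by_density:
  fixes h1 h2 h :: "complex ^ 'n \<Rightarrow> complex ^ 'n \<Rightarrow> complex ^ 'n \<Rightarrow> complex"
  assumes c2: "c_projective_charts S h1 G1 h2 G2" and c: "c_projective_charts S h1 G1 h G" and x: "x \<in> S"
    and ric1: "\<And>x v u. x \<in> S \<Longrightarrow> ricci_form G1 x v u = of_real b1 * h1 x v u"
    and ric2: "\<And>x v u. x \<in> S \<Longrightarrow> ricci_form G2 x v u = of_real b2 * h2 x v u"
    and dense: "\<And>U. open U \<Longrightarrow> U \<subseteq> S \<Longrightarrow> U \<noteq> {} \<Longrightarrow>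
      \<exists>y\<in>U. \<forall>k::real. \<exists>v w. h2 y v w \<noteq> of_real k * h1 y v w"
  shows "\<exists>\<alpha>::real. \<forall>v u. ricci_form G x v u = of_real \<alpha> * h x v u"
proof -
  interpret c2: c_projective_charts S h1 G1 h2 G2 by fact
  interpret c: c_projective_charts S h1 G1 h G by fact
  have z: "ricci_form G x v u * h x v' u' = ricci_form G x v' u' * h x v u" for v u v' u'
  proof (rule ccontr)
    assume ne: "\<not> ?thesis"
    define D where "D y = ricci_form G y v u * h y v' u' - ricci_form G y v' u' * h y v u" for y
    have "continuous_on S D"
      unfolding D_def
      by (intro continuous_intros smooth_on_imp_continuous_on c.K2.smooth_ricci_form c.K2.smooth_h)
    then have "open {y \<in> S. D y \<noteq> 0}"
      using continuous_open_preimage[OF _ c2.K1.open_S, of D "- {0}"] by (auto simp: vimage_def Int_def)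
    moreover have "x \<in> {y \<in> S. D y \<noteq> 0}" using ne x by (simp add: D_def)
    ultimately obtain y where y: "y \<in> S" "D y \<noteq> 0" "\<forall>k::real. \<exists>v w. h2 y v w \<noteq> of_real k * h1 y v w"
      using dense[of "{y \<in> S. D y \<noteq> 0}"] by blast
    obtain \<alpha> :: real where "\<And>v u. ricci_form G y v u = of_real \<alpha> * h y v u"
      using ricci_proportional_at_point[OF c2 c y(1) ric1[OF y(1)] ric2[OF y(1)]] y(3) by blast
    then have "D y = 0" by (simp add: D_def)
    then show False using y(2) by simp
  qed
  obtain p q where pq: "h x p q \<noteq> 0" using nondegenerate_nonzero_value[OF c.K2.nondeg[OF x]] by blast
  define \<alpha> where "\<alpha> = ricci_form G x p q / h x p q"
  have a: "ricci_form G x v u = \<alpha> * h x v u" for v u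
    using z[of v u p q] pq by (simp add: \<alpha>_def field_simps)
  have "\<alpha> = of_real (Re \<alpha>)"
    by (rule hermitian_forms_ratio_real[OF c.K2.hermitian_ricci_form[OF x] c.K2.herm[OF x] c.K2.nondeg[OF x] a])
  then show ?thesis using a by metis
qed

section \<open>Kaehler metrics on a complex manifold\<close>

text \<open>The sign of the imaginary part makes the form complex linear in its first
  argument.\<close>

definition hermitian_of :: "(complex ^ 'n \<Rightarrow> complex ^ 'n \<Rightarrow> real) \<Rightarrow> complex ^ 'n \<Rightarrow> complex ^ 'n \<Rightarrow> complex" where
  "hermitian_of B v w = Complex (B v w) (B v (\<i> *s w))"

lemma complex_scale_eq: "c *s (v :: complex ^ 'n) = Re c *\<^sub>R v + Im c *\<^sub>R (\<i> *s v)"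
  by (simp add: vec_eq_iff complex_eq_iff)

lemma complex_linear_iff:
  "complex_linear T \<longleftrightarrow> linear T \<and> (\<forall>v. T (\<i> *s v) = \<i> *s T v)"
proof safe
  assume T: "linear T" "\<forall>v. T (\<i> *s v) = \<i> *s T v"
  show "complex_linear T"
    unfolding complex_linear_def
  proof (intro conjI allI)
    show "T (v + w) = T v + T w" for v w by (rule linear_add[OF T(1)])
    show "T (c *s v) = c *s T v" for c v
      unfolding complex_scale_eq[of c] by (simp add: linear_add[OF T(1)] linear_scale[OF T(1)] T(2))
  qed
qed (auto simp: complex_linear_imp_linear complex_linear_scale)

lemma smooth_manifold_chart:
  assumes "smooth_manifold X A" "c \<in> A"
  shows "openin X (fst c)" "open (chart_image c)"
    "homeomorphic_map (subtopology X (fst c)) (top_of_set (chart_image c)) (snd c)"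
    "topspace (subtopology X (fst c)) = fst c" "inj_on (snd c) (fst c)"
proof -
  show 1: "openin X (fst c)" and "open (chart_image c)"
    and 2: "homeomorphic_map (subtopology X (fst c)) (top_of_set (chart_image c)) (snd c)"
    using assms by (auto simp: smooth_manifold_def)
  show 3: "topspace (subtopology X (fst c)) = fst c" using openin_subset[OF 1] by auto
  show "inj_on (snd c) (fst c)" using homeomorphic_imp_injective_map[OF 2] 3 by simp
qed

lemma pseudo_riemannian_chart:
  assumes "pseudo_riemannian A g" "c \<in> A"
  shows "smooth_on (chart_image c) (\<lambda>x. g c x v w)"
    and "x \<in> chart_image c \<Longrightarrow> bilinear (g c x)"
    and "x \<in> chart_image c \<Longrightarrow> g c x v w = g c x w v"
    and "x \<in> chart_image c \<Longrightarrow> (\<And>w. g c x v w = 0) \<Longrightarrow> v = 0"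
  using assms unfolding pseudo_riemannian_def by blast+

lemma levi_civita_christoffel:
  assumes "smooth_manifold X A" "pseudo_riemannian A g" "c \<in> A" "x \<in> chart_image c"
  shows "levi_civita_at g c x (christoffel g c x)"
  unfolding christoffel_def
  by (rule theI'[OF levi_civita_unique[OF assms(2-4) smooth_manifold_chart(2)[OF assms(1,3)]]])

lemma christoffel_eqI:
  assumes "smooth_manifold X A" "pseudo_riemannian A g" "c \<in> A" "x \<in> chart_image c" "levi_civita_at g c x G"
  shows "christoffel g c x = G"
  unfolding christoffel_def
  by (rule the1_equality[OF levi_civita_unique[OF assms(2-4) smooth_manifold_chart(2)[OF assms(1,3)]]]) (rule assms(5))

text \<open>By Koszul's formula the Christoffel map solves a linear system with matrix
  \<open>g c\<close> and smooth right-hand side, so its smoothness is that of such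
  solutions.\<close>

lemma smooth_on_christoffel:
  assumes X: "smooth_manifold X A" and g: "pseudo_riemannian A g" and c: "c \<in> A"
  shows "smooth_on (chart_image c) (\<lambda>x. christoffel g c x v w)"
proof (rule smooth_on_linear_system_solution[where B = "g c"])
  note S = smooth_manifold_chart(2)[OF X c]
  let ?D = "\<lambda>z v w x. frechet_derivative (\<lambda>y. g c y v w) (at x) z"
  show "open (chart_image c)" by (rule S)
  show "smooth_on (chart_image c) (\<lambda>y. g c y (christoffel g c y v w) z)" for z
  proof (rule smooth_on_cong[OF _ S])
    have s: "smooth_on (chart_image c) (?D z v w)" for z v w
      by (rule smooth_on_derivative[OF pseudo_riemannian_chart(1)[OF g c]])
    show "smooth_on (chart_image c) (\<lambda>x. (1 / 2) *\<^sub>R (?D v w z x + ?D w v z x - ?D z v w x))"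
      by (intro smooth_on_bounded_linear[OF bounded_linear_scaleR_right] smooth_on_diff smooth_on_add s S)
    fix x assume x: "x \<in> chart_image c"
    note lc = levi_civita_christoffel[OF X g c x, unfolded levi_civita_at_def]
    let ?G = "christoffel g c x"
    have sym: "?G a b = ?G b a" for a b using lc by blast
    have D: "?D z a b x = g c x (?G z a) b + g c x (?G z b) a" for z a b
      using lc pseudo_riemannian_chart(3)[OF g c x, of a "?G z b"] by auto
    show "g c x (?G v w) z = (1 / 2) *\<^sub>R (?D v w z x + ?D w v z x - ?D z v w x)"
      unfolding D sym[of w v] sym[of z v] sym[of z w] by simp
  qed
qed (use pseudo_riemannian_chart[OF g c] in auto)

text \<open>The complex structure is constant in a complex chart, so its covariant derivative is
  just the commutator of the Christoffel map with multiplication by the imaginary unit.\<close>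

lemma christoffel_complex_linear:
  assumes X: "smooth_manifold X A" and g: "kaehler A complex_structure g" and c: "c \<in> A"
    and x: "x \<in> chart_image c"
  shows "complex_linear (christoffel g c x v)"
  unfolding complex_linear_iff
proof (intro conjI allI)
  have pr: "pseudo_riemannian A g" using g by (simp add: kaehler_def)
  show "linear (christoffel g c x v)"
    using levi_civita_christoffel[OF X pr c x] by (simp add: levi_civita_at_def bilinear_def)
  show "christoffel g c x v (\<i> *s w) = \<i> *s christoffel g c x v w" for w
  proof -
    have "nabla_endo g complex_structure c x v w = 0" using g c x by (simp add: kaehler_def)
    then show ?thesis by (simp add: nabla_endo_def complex_structure_def frechet_derivative_const)
  qed
qed

lemma hermitian_of_form:
  assumes B: "bilinear B" and sym: "\<And>v w. B v w = B w v" and J: "\<And>v w. B (\<i> *s v) (\<i> *s w) = B v w"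
  shows "hermitian_form (hermitian_of B)"
proof -
  have i: "\<i> *s (\<i> *s v) = - (v :: complex ^ 'a)" for v
    by (simp add: vector_smult_assoc vec_eq_iff)
  have J': "B (\<i> *s v) w = - B v (\<i> *s w)" for v w
    using J[of "\<i> *s v" w] by (simp add: i bilinear_lneg[OF B])
  show ?thesis
    unfolding hermitian_form_def
  proof (intro conjI allI)
    show "hermitian_of B (u + v) w = hermitian_of B u w + hermitian_of B v w" for u v w
      by (simp add: hermitian_of_def bilinear_ladd[OF B] complex_eq_iff)
    show "hermitian_of B (c *s v) w = c * hermitian_of B v w" for c v w
      unfolding complex_scale_eq[of c]
      by (simp add: hermitian_of_def bilinear_ladd[OF B] bilinear_lmul[OF B] complex_eq_iff J' i bilinear_rneg[OF B])
    show "hermitian_of B w v = cnj (hermitian_of B v w)" for v w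
      using J'[of w v] sym[of "\<i> *s w" v] sym[of w v] by (simp add: hermitian_of_def complex_eq_iff)
  qed
qed

text \<open>Compatibility extends from \<open>g\<close> to the imaginary part of the Hermitian form
  because the Christoffel map commutes with the imaginary unit.\<close>

lemma kaehler_imp_kaehler_chart:
  assumes X: "smooth_manifold X A" and g: "kaehler A complex_structure g" and c: "c \<in> A"
  shows "kaehler_chart (chart_image c) (\<lambda>x. hermitian_of (g c x)) (christoffel g c)"
proof
  have pr: "pseudo_riemannian A g" using g by (simp add: kaehler_def)
  note S = smooth_manifold_chart(2)[OF X c] and prc = pseudo_riemannian_chart[OF pr c]
  show "open (chart_image c)" by (rule S)
  show "smooth_on (chart_image c) (\<lambda>x. christoffel g c x v w)" for v w
    by (rule smooth_on_christoffel[OF X pr c])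
  have hc: "hermitian_of B v w = of_real (B v w) + \<i> * of_real (B v (\<i> *s w))"
    for B and v w :: "complex ^ 'b"
    by (simp add: hermitian_of_def complex_eq_iff)
  show "smooth_on (chart_image c) (\<lambda>x. hermitian_of (g c x) v w)" for v w
    unfolding hc
    by (intro smooth_on_add S smooth_on_bounded_linear[OF bounded_linear_of_real]
        smooth_on_bounded_linear[OF bounded_linear_mult_right] prc)
  fix x assume x: "x \<in> chart_image c"
  note lc = levi_civita_christoffel[OF X pr c x, unfolded levi_civita_at_def]
  show "hermitian_form (hermitian_of (g c x))"
    using g c x by (intro hermitian_of_form prc) (auto simp: kaehler_def complex_structure_def)
  show "nondegenerate_form (hermitian_of (g c x))"
    using prc(4)[OF x] by (auto simp: nondegenerate_form_def hermitian_of_def complex_eq_iff)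
  show clin: "complex_linear (christoffel g c x v)" for v
    by (rule christoffel_complex_linear[OF X g c x])
  show "christoffel g c x v w = christoffel g c x w v" for v w using lc by blast
  show "frechet_derivative (\<lambda>y. hermitian_of (g c y) v w) (at x) z
      = hermitian_of (g c x) (christoffel g c x z v) w + hermitian_of (g c x) v (christoffel g c x z w)" for v w z
  proof -
    have d: "((\<lambda>y. g c y v w) has_derivative (\<lambda>z. g c x (christoffel g c x z v) w + g c x v (christoffel g c x z w))) (at x)"
      for v w
    proof -
      have "frechet_derivative (\<lambda>y. g c y v w) (at x)
          = (\<lambda>z. g c x (christoffel g c x z v) w + g c x v (christoffel g c x z w))"
        using lc by blast
      then show ?thesis using smooth_on_has_derivative[OF prc(1)[of v w] x] by simp
    qed
    have "((\<lambda>y. hermitian_of (g c y) v w) has_derivative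
      (\<lambda>z. of_real (g c x (christoffel g c x z v) w + g c x v (christoffel g c x z w))
        + \<i> * of_real (g c x (christoffel g c x z v) (\<i> *s w) + g c x v (christoffel g c x z (\<i> *s w))))) (at x)"
      unfolding hc by (intro has_derivative_add has_derivative_mult_right has_derivative_of_real d)
    then show ?thesis
      by (simp add: frechet_derivative_eqI hc complex_linear_scale[OF clin] algebra_simps)
  qed
qed

subsection \<open>Changes of charts\<close>

locale chart_pair =
  fixes X :: "'p topology" and A :: "('p, complex ^ 'n) chart set" and c d :: "('p, complex ^ 'n) chart"
  assumes M: "complex_manifold X A" and c: "c \<in> A" and d: "d \<in> A"
begin

lemma is_smooth_manifold: "smooth_manifold X A" using M by (simp add: complex_manifold_def)

lemma open_overlap: "open (chart_overlap c d)"
proof -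
  have "openin (subtopology X (fst c)) (fst c \<inter> fst d)"
    using smooth_manifold_chart(1)[OF is_smooth_manifold c] smooth_manifold_chart(1)[OF is_smooth_manifold d] openin_subtopology_Int2
    by (metis Int_commute)
  then have "openin (top_of_set (chart_image c)) (snd c ` (fst c \<inter> fst d))"
    using homeomorphic_map_openness_eq[OF smooth_manifold_chart(3)[OF is_smooth_manifold c]] by blast
  then show ?thesis
    using openin_open_trans smooth_manifold_chart(2)[OF is_smooth_manifold c] by (auto simp: chart_overlap_def)
qed

lemma overlap_subset: "chart_overlap c d \<subseteq> chart_image c"
  by (auto simp: chart_overlap_def chart_image_def)

lemma smooth_transition: "smooth_on (chart_overlap c d) (transition c d)"
  using is_smooth_manifold c d by (auto simp: smooth_manifold_def)

lemma transition_point: "P \<in> fst c \<Longrightarrow> transition c d (snd c P) = snd d P"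
  by (simp add: transition_def inv_into_f_f[OF smooth_manifold_chart(5)[OF is_smooth_manifold c]])

lemma transition_in: "x \<in> chart_overlap c d \<Longrightarrow> transition c d x \<in> chart_overlap d c"
  unfolding chart_overlap_def using transition_point by (auto simp: chart_overlap_def)

lemma transition_in_image: "x \<in> chart_overlap c d \<Longrightarrow> transition c d x \<in> chart_image d"
  using transition_in by (auto simp: chart_overlap_def chart_image_def)

lemma transition_inverse: "x \<in> chart_overlap c d \<Longrightarrow> transition d c (transition c d x) = x"
proof -
  assume "x \<in> chart_overlap c d"
  then obtain P where P: "x = snd c P" "P \<in> fst c" "P \<in> fst d" by (auto simp: chart_overlap_def)
  interpret dc: chart_pair X A d c by unfold_locales (rule M c d)+
  show ?thesis using P
    by (simp add: transition_def inv_into_f_f[OF smooth_manifold_chart(5)[OF is_smooth_manifold c]]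
        inv_into_f_f[OF smooth_manifold_chart(5)[OF is_smooth_manifold d]])
qed

lemma has_derivative_transition:
  "x \<in> chart_overlap c d \<Longrightarrow> (transition c d has_derivative dtransition c d x) (at x)"
  unfolding dtransition_def by (rule smooth_on_has_derivative[OF smooth_transition])

lemma linear_dtransition: "x \<in> chart_overlap c d \<Longrightarrow> linear (dtransition c d x)"
  using has_derivative_transition has_derivative_linear by blast

lemma clin_dtransition: "x \<in> chart_overlap c d \<Longrightarrow> complex_linear (dtransition c d x)"
  using M c d linear_dtransition
  by (simp add: complex_linear_iff complex_manifold_def complex_structure_def)

lemma smooth_dtransition: "smooth_on (chart_overlap c d) (\<lambda>x. dtransition c d x v)"
  unfolding dtransition_def by (rule smooth_on_derivative[OF smooth_transition])

definition d2transition where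
  "d2transition x u v = frechet_derivative (\<lambda>y. dtransition c d y v) (at x) u"

lemma has_derivative_dtransition:
  "x \<in> chart_overlap c d \<Longrightarrow> ((\<lambda>y. dtransition c d y v) has_derivative (\<lambda>u. d2transition x u v)) (at x)"
  unfolding d2transition_def by (rule smooth_on_has_derivative[OF smooth_dtransition])

lemma d2transition_sym: "x \<in> chart_overlap c d \<Longrightarrow> d2transition x u v = d2transition x v u"
  unfolding d2transition_def dtransition_def
  by (rule second_derivative_symmetric[OF smooth_transition open_overlap])

text \<open>Differentiating the complex linearity of \<open>dtransition\<close> gives the claim in
  the second slot; symmetry of second derivatives moves it to the first.\<close>

lemma d2transition_i:
  assumes x: "x \<in> chart_overlap c d"
  shows "d2transition x (\<i> *s u) v = \<i> *s d2transition x u v"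
proof -
  have "((\<lambda>y. dtransition c d y (\<i> *s u)) has_derivative (\<lambda>v. \<i> *s d2transition x v u)) (at x)"
    by (rule has_derivative_transform_within_open[OF bounded_linear.has_derivative[OF bounded_linear_complex_scale
            has_derivative_dtransition[OF x]] open_overlap x])
      (simp add: complex_linear_scale[OF clin_dtransition])
  from fun_cong[OF has_derivative_unique[OF has_derivative_dtransition[OF x] this], of v]
  show ?thesis using d2transition_sym[OF x] by metis
qed

lemma bilinear_d2transition:
  assumes x: "x \<in> chart_overlap c d"
  shows "bilinear (d2transition x)"
proof -
  have l: "linear (\<lambda>u. d2transition x u v)" for v
    using has_derivative_dtransition[OF x] has_derivative_linear by blast
  then have "linear (\<lambda>v. d2transition x u v)" for u
    using l[of u] d2transition_sym[OF x] by simp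
  then show ?thesis using l by (simp add: bilinear_def)
qed

lemma dtransition_inverse:
  assumes x: "x \<in> chart_overlap c d"
  shows "dtransition d c (transition c d x) (dtransition c d x v) = v"
proof -
  interpret dc: chart_pair X A d c by unfold_locales (rule M c d)+
  have "((\<lambda>y. transition d c (transition c d y)) has_derivative
      (\<lambda>v. dtransition d c (transition c d x) (dtransition c d x v))) (at x)"
    by (rule has_derivative_compose[where f = "transition c d" and g = "transition d c",
          OF has_derivative_transition[OF x] dc.has_derivative_transition[OF transition_in[OF x]]])
  moreover have "((\<lambda>y. transition d c (transition c d y)) has_derivative (\<lambda>v. v)) (at x)"
    by (rule has_derivative_transform_within_open[OF has_derivative_ident open_overlap x])
      (simp add: transition_inverse)
  ultimately show ?thesis using has_derivative_unique by metis
qed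

lemma dtransition_inverse':
  assumes x: "x \<in> chart_overlap c d"
  shows "dtransition c d x (dtransition d c (transition c d x) v) = v"
proof -
  interpret dc: chart_pair X A d c by unfold_locales (rule M c d)+
  show ?thesis
    using dc.dtransition_inverse[OF transition_in[OF x]] transition_inverse[OF x] by simp
qed

lemma metric_transition:
  assumes "pseudo_riemannian A g" "x \<in> chart_overlap c d"
  shows "g c x v w = g d (transition c d x) (dtransition c d x v) (dtransition c d x w)"
  using assms c d unfolding pseudo_riemannian_def by blast

text \<open>The map \<open>G\<close> obtained by solving the transformation law for the chart
  \<open>c\<close> satisfies \<open>levi_civita_at\<close> there, so uniqueness identifies it; no
  coordinate formula is needed.\<close>

lemma christoffel_transition:
  assumes g: "pseudo_riemannian A g" and x: "x \<in> chart_overlap c d"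
  shows "dtransition c d x (christoffel g c x v w)
    = christoffel g d (transition c d x) (dtransition c d x v) (dtransition c d x w) + d2transition x v w"
proof -
  interpret dc: chart_pair X A d c by unfold_locales (rule M c d)+
  let ?x = "transition c d x" and ?L = "dtransition c d x" and ?L' = "dtransition d c (transition c d x)"
  have xc: "x \<in> chart_image c" and xd: "?x \<in> chart_image d"
    using overlap_subset transition_in_image x by auto
  note lcd = levi_civita_christoffel[OF is_smooth_manifold g d xd, unfolded levi_civita_at_def]
  let ?Gd = "christoffel g d ?x"
  have bGd: "bilinear ?Gd" and sGd: "?Gd a b = ?Gd b a" for a b using lcd by blast+
  define G where "G z v = ?L' (?Gd (?L z) (?L v) + d2transition x z v)" for z v
  have LG: "?L (G z v) = ?Gd (?L z) (?L v) + d2transition x z v" for z v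
    unfolding G_def by (rule dtransition_inverse'[OF x])
  have lin: "linear ?L" "linear ?L'"
    using linear_dtransition[OF x] dc.linear_dtransition[OF transition_in[OF x]] by auto
  have "levi_civita_at g c x G"
    unfolding levi_civita_at_def
  proof (intro conjI allI)
    show "bilinear G"
      unfolding bilinear_def G_def
      by (auto intro!: linearI simp: linear_add[OF lin(1)] linear_add[OF lin(2)] linear_scale[OF lin(1)]
          linear_scale[OF lin(2)] bilinear_ladd[OF bGd] bilinear_radd[OF bGd] bilinear_lmul[OF bGd] bilinear_rmul[OF bGd]
          bilinear_ladd[OF bilinear_d2transition[OF x]] bilinear_radd[OF bilinear_d2transition[OF x]]
          bilinear_lmul[OF bilinear_d2transition[OF x]] bilinear_rmul[OF bilinear_d2transition[OF x]] scaleR_add_right)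
    show "G v w = G w v" for v w
      unfolding G_def sGd[of "?L v"] d2transition_sym[OF x, of v] ..
    show "frechet_derivative (\<lambda>y. g c y v w) (at x) z = g c x (G z v) w + g c x v (G z w)" for z v w
    proof -
      have Dg: "((\<lambda>y. g d (transition c d y) a b) has_derivative
          (\<lambda>z. g d ?x (?Gd (?L z) a) b + g d ?x a (?Gd (?L z) b))) (at x)" for a b
      proof -
        have "frechet_derivative (\<lambda>y. g d y a b) (at ?x) = (\<lambda>z. g d ?x (?Gd z a) b + g d ?x a (?Gd z b))"
          using lcd by blast
        then have "((\<lambda>y. g d y a b) has_derivative (\<lambda>z. g d ?x (?Gd z a) b + g d ?x a (?Gd z b))) (at ?x)"
          using smooth_on_has_derivative[OF pseudo_riemannian_chart(1)[OF g d] xd, of a b] by simp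
        from has_derivative_compose[where f = "transition c d", OF has_derivative_transition[OF x] this]
        show ?thesis .
      qed
      have "((\<lambda>y. g d (transition c d y) (dtransition c d y v) (dtransition c d y w)) has_derivative
          (\<lambda>z. (g d ?x (?Gd (?L z) (?L v)) (?L w) + g d ?x (?L v) (?Gd (?L z) (?L w)))
             + g d ?x (d2transition x z v) (?L w) + g d ?x (?L v) (d2transition x z w))) (at x)"
        by (rule has_derivative_bilinear_field[where B = "\<lambda>y. g d (transition c d y)"
              and f = "\<lambda>y. dtransition c d y v" and g = "\<lambda>y. dtransition c d y w"
              and D = "\<lambda>z a b. g d ?x (?Gd (?L z) a) b + g d ?x a (?Gd (?L z) b)",
              OF open_overlap x pseudo_riemannian_chart(2)[OF g d transition_in_image] Dg
                has_derivative_dtransition[OF x] has_derivative_dtransition[OF x]])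
      then have "((\<lambda>y. g c y v w) has_derivative
          (\<lambda>z. (g d ?x (?Gd (?L z) (?L v)) (?L w) + g d ?x (?L v) (?Gd (?L z) (?L w)))
             + g d ?x (d2transition x z v) (?L w) + g d ?x (?L v) (d2transition x z w))) (at x)"
        by (rule has_derivative_transform_within_open[OF _ open_overlap x]) (rule metric_transition[OF g, symmetric])
      then show ?thesis
        unfolding metric_transition[OF g x] LG
        by (simp add: frechet_derivative_eqI bilinear_ladd[OF pseudo_riemannian_chart(2)[OF g d xd]]
            bilinear_radd[OF pseudo_riemannian_chart(2)[OF g d xd]])
    qed
  qed
  from christoffel_eqI[OF is_smooth_manifold g c xc this] show ?thesis using LG by simp
qed

lemma hermitian_of_transition:
  assumes g: "pseudo_riemannian A g" and x: "x \<in> chart_overlap c d"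
  shows "hermitian_of (g d (transition c d x)) (dtransition c d x v) (dtransition c d x w) = hermitian_of (g c x) v w"
  unfolding hermitian_of_def metric_transition[OF g x] complex_linear_scale[OF clin_dtransition[OF x]] ..

end

section \<open>Preliminaries for curves in several charts\<close>

lemma has_derivative_linear_field:
  fixes L :: "'a::real_normed_vector \<Rightarrow> 'b::euclidean_space \<Rightarrow> 'd::real_normed_vector"
  assumes S: "open S" "x \<in> S" and lin: "\<And>y. y \<in> S \<Longrightarrow> linear (L y)"
    and D: "\<And>v. ((\<lambda>y. L y v) has_derivative (\<lambda>z. D z v)) (at x)"
    and f: "(f has_derivative f') (at x)"
  shows "((\<lambda>y. L y (f y)) has_derivative (\<lambda>z. D z (f x) + L x (f' z))) (at x)"
proof -
  \<comment> \<open>A dummy real argument, held at 1, reduces the linear case to the bilinear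
    one.\<close>
  have "((\<lambda>y. (1::real) *\<^sub>R L y (f y)) has_derivative
      (\<lambda>z. (1::real) *\<^sub>R D z (f x) + (1::real) *\<^sub>R L x (f' z) + 0 *\<^sub>R L x (f x))) (at x)"
  proof (rule has_derivative_bilinear_field[where B = "\<lambda>y v (r::real). r *\<^sub>R L y v" and f = f
        and g = "\<lambda>_. 1" and D = "\<lambda>z v (r::real). r *\<^sub>R D z v" and g' = "\<lambda>_. 0", OF S])
    show "bilinear (\<lambda>v (r::real). r *\<^sub>R L y v)" if "y \<in> S" for y
      unfolding bilinear_def
      by (auto intro!: linearI simp: linear_add[OF lin[OF that]] linear_scale[OF lin[OF that]] algebra_simps)
    show "((\<lambda>y. r *\<^sub>R L y v) has_derivative (\<lambda>z. r *\<^sub>R D z v)) (at x)" for v and r :: real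
      by (rule has_derivative_scaleR_right[OF D])
  qed (use f in auto)
  then show ?thesis by simp
qed

lemma smooth_on_ident:
  fixes S :: "'a::real_normed_vector set"
  assumes "open S"
  shows "smooth_on S (\<lambda>x. x)"
  unfolding smooth_on_def
proof
  show "ck_on k S (\<lambda>x. x)" for k
  proof (cases k)
    case 0
    then show ?thesis by simp
  next
    case (Suc m)
    show ?thesis
      unfolding Suc by (rule ck_on_SucI[OF assms has_derivative_ident ck_on_const])
  qed
qed

lemma wedge3_zero: "wedge3 0 v w = (\<lambda>_ _ _. 0)"
  by (simp add: wedge3_def fun_eq_iff)

text \<open>The covectors \<open>\<beta>\<close> and \<open>\<gamma>\<close>, real and imaginary
  part of a coordinate ratio, are dual to \<open>v\<close> and \<open>\<i> *s v\<close>. Evaluated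
  on them and any \<open>\<alpha>\<close>, the trivector is \<open>\<alpha>\<close> of
  \<open>u - k *s v\<close>.\<close>

lemma wedge3_complex_line:
  fixes u v :: "complex ^ 'n"
  assumes w: "wedge3 u v (\<i> *s v) = (\<lambda>_ _ _. 0)" and v: "v \<noteq> 0"
  shows "\<exists>k. u = k *s v"
proof -
  obtain j where j: "v $ j \<noteq> 0" using v by (auto simp: vec_eq_iff)
  define k where "k = u $ j / v $ j"
  have bl: "bounded_linear (\<lambda>z :: complex ^ 'n. z $ j / v $ j)"
    by (rule bounded_linear_compose[OF bounded_linear_divide bounded_linear_vec_nth])
  define \<beta> where "\<beta> = Blinfun (\<lambda>z. Re (z $ j / v $ j))"
  define \<gamma> where "\<gamma> = Blinfun (\<lambda>z. Im (z $ j / v $ j))"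
  have \<beta>: "blinfun_apply \<beta> z = Re (z $ j / v $ j)" for z
    unfolding \<beta>_def by (rule bounded_linear_Blinfun_apply[OF bounded_linear_compose[OF bounded_linear_Re bl], THEN fun_cong])
  have \<gamma>: "blinfun_apply \<gamma> z = Im (z $ j / v $ j)" for z
    unfolding \<gamma>_def by (rule bounded_linear_Blinfun_apply[OF bounded_linear_compose[OF bounded_linear_Im bl], THEN fun_cong])
  have "u - k *s v = 0"
  proof (rule euclidean_eqI)
    fix b :: "complex ^ 'n" assume "b \<in> Basis"
    define \<alpha> where "\<alpha> = Blinfun (\<lambda>z :: complex ^ 'n. z \<bullet> b)"
    have \<alpha>: "blinfun_apply \<alpha> z = z \<bullet> b" for z
      unfolding \<alpha>_def by (rule bounded_linear_Blinfun_apply[OF bounded_linear_inner_left, THEN fun_cong])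
    have vv: "v $ j / v $ j = 1" "(\<i> *s v) $ j / v $ j = \<i>" using j by auto
    have "wedge3 u v (\<i> *s v) \<alpha> \<beta> \<gamma> = 0" using w by simp
    then have "u \<bullet> b - Re k * (v \<bullet> b) - Im k * ((\<i> *s v) \<bullet> b) = 0"
      unfolding wedge3_def \<alpha> \<beta> \<gamma> vv by (simp add: k_def)
    then show "(u - k *s v) \<bullet> b = 0 \<bullet> b"
      unfolding complex_scale_eq[of k] by (simp add: inner_diff_left inner_add_left)
  qed
  then show ?thesis by auto
qed

subsection \<open>Geodesics\<close>

text \<open>The curve is built in the chart \<open>c\<close> as an integral curve in position and
  velocity. \<open>J_planar\<close> asks for smoothness and vanishing of the trivector in every
  chart, which is why the transformation laws enter.\<close>

lemma geodesic_exists: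
  fixes X :: "'p topology" and A :: "('p, complex ^ 'n) chart set"
  assumes M: "complex_manifold X A" and g: "pseudo_riemannian A g" and c: "c \<in> A"
    and x0: "x0 \<in> chart_image c" and v0: "v0 \<noteq> 0"
  obtains I \<gamma> where "J_planar X A J g I \<gamma>" "0 \<in> I" "\<gamma> 0 \<in> fst c" "snd c (\<gamma> 0) = x0"
    "velocity c \<gamma> 0 = v0" "acceleration g c \<gamma> 0 = 0"
proof -
  interpret cc: chart_pair X A c c by unfold_locales (rule M c)+
  let ?S = "chart_image c" and ?G = "christoffel g c"
  note Xm = cc.is_smooth_manifold
  note S = smooth_manifold_chart(2)[OF Xm c]
  have bilG: "bilinear (?G x)" if "x \<in> ?S" for x
    using levi_civita_christoffel[OF Xm g c that] by (simp add: levi_civita_at_def)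
  define T where "T = ?S \<times> (UNIV :: (complex ^ 'n) set)"
  define F where "F p = (snd p, - ?G (fst p) (snd p) (snd p))" for p
  have T: "open T" unfolding T_def by (intro open_Times S open_UNIV)
  have fstT: "fst p \<in> ?S" if "p \<in> T" for p using that by (auto simp: T_def)
  have sfst: "smooth_on T fst" and ssnd: "smooth_on T snd"
    using smooth_on_bounded_linear[OF bounded_linear_fst T smooth_on_ident[OF T]]
      smooth_on_bounded_linear[OF bounded_linear_snd T smooth_on_ident[OF T]] by auto
  have sG: "smooth_on T (\<lambda>p. ?G (fst p) (snd p) (snd p))"
  proof (rule smooth_on_bilinear_field[OF T bilG[OF fstT] _ ssnd ssnd])
    show "smooth_on T (\<lambda>p. ?G (fst p) a b)" for a b
      by (rule smooth_on_compose[OF T sfst smooth_on_christoffel[OF Xm g c] fstT])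
  qed
  have "smooth_on T (\<lambda>p. (snd p, 0) + (0, - ?G (fst p) (snd p) (snd p)))"
  proof (rule smooth_on_add[OF T])
    show "smooth_on T (\<lambda>p. (snd p, 0))"
      by (rule smooth_on_bounded_linear[OF bounded_linear_Pair[OF bounded_linear_ident
            bounded_linear_zero] T ssnd])
    show "smooth_on T (\<lambda>p. (0, - ?G (fst p) (snd p) (snd p)))"
      by (rule smooth_on_bounded_linear[OF bounded_linear_Pair[OF bounded_linear_zero
            bounded_linear_minus[OF bounded_linear_ident]] T sG])
  qed
  then have sF: "smooth_on T F" by (simp add: F_def[abs_def])
  have "(x0, v0) \<in> T" using x0 by (simp add: T_def)
  then obtain e1 \<phi> where e1: "e1 > 0" "\<phi> 0 = (x0, v0)" "\<And>t. t \<in> {-e1<..<e1} \<Longrightarrow> \<phi> t \<in> T"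
    and d\<phi>: "\<And>t. t \<in> {-e1<..<e1} \<Longrightarrow> (\<phi> has_vector_derivative F (\<phi> t)) (at t)"
    and s\<phi>: "smooth_on {-e1<..<e1} \<phi>"
    using integral_curve_exists[OF sF T] by blast
  define x where "x t = fst (\<phi> t)" for t
  define v where "v t = snd (\<phi> t)" for t
  \<comment> \<open>Time is restricted to a ball on which the velocity stays nonzero, as regularity
    demands.\<close>
  have "continuous_on {-e1<..<e1} v"
    unfolding v_def by (intro continuous_on_snd smooth_on_imp_continuous_on s\<phi>)
  then have "open ({-e1<..<e1} \<inter> v -` (- {0}))"
    by (intro continuous_open_preimage) auto
  moreover have "0 \<in> {-e1<..<e1} \<inter> v -` (- {0})" using e1 v0 by (simp add: v_def)
  ultimately obtain e where e: "e > 0" "ball 0 e \<subseteq> {-e1<..<e1} \<inter> v -` (- {0})"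
    using openE by blast
  define I where "I = ball (0::real) e"
  have I: "open I" "0 \<in> I" "is_interval I" using e by (auto simp: I_def is_interval_ball_real)
  have I1: "I \<subseteq> {-e1<..<e1}" and vI: "\<And>t. t \<in> I \<Longrightarrow> v t \<noteq> 0" using e by (auto simp: I_def)
  have xS: "x t \<in> ?S" if "t \<in> I" for t unfolding x_def by (rule fstT[OF e1(3)[OF subsetD[OF I1 that]]])
  have dx: "(x has_vector_derivative v t) (at t)" if "t \<in> I" for t
    using bounded_linear.has_vector_derivative[OF bounded_linear_fst d\<phi>] I1 that
    by (auto simp: x_def[abs_def] v_def F_def)
  have dv: "(v has_vector_derivative - ?G (x t) (v t) (v t)) (at t)" if "t \<in> I" for t
    using bounded_linear.has_vector_derivative[OF bounded_linear_snd d\<phi>] I1 that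
    by (auto simp: x_def v_def[abs_def] F_def)
  have sx: "smooth_on I x"
    unfolding x_def by (rule smooth_on_bounded_linear[OF bounded_linear_fst I(1) smooth_on_subset[OF s\<phi> I1]])
  obtain k where k: "homeomorphic_maps (subtopology X (fst c)) (top_of_set ?S) (snd c) k"
    using smooth_manifold_chart(3)[OF Xm c] by (auto simp: homeomorphic_map_maps)
  define \<gamma> where "\<gamma> t = k (x t)" for t
  have kS: "k y \<in> fst c" "snd c (k y) = y" if "y \<in> ?S" for y
  proof -
    have "continuous_map (top_of_set ?S) (subtopology X (fst c)) k"
      using k by (simp add: homeomorphic_maps_def)
    from continuous_map_image_subset_topspace[OF this] show "k y \<in> fst c" using that by auto
    show "snd c (k y) = y" using k that by (auto simp: homeomorphic_maps_def)
  qed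
  have \<gamma>: "\<gamma> t \<in> fst c" "snd c (\<gamma> t) = x t" if "t \<in> I" for t
    using kS[OF xS[OF that]] by (auto simp: \<gamma>_def)
  have cont_x: "continuous_on I x" by (rule smooth_on_imp_continuous_on[OF sx])
  have cont\<gamma>: "continuous_map (top_of_set I) X \<gamma>"
  proof -
    have "continuous_map (top_of_set I) (top_of_set ?S) x"
      using cont_x xS by (auto simp: continuous_map_in_subtopology)
    moreover have "continuous_map (top_of_set ?S) X k"
      using k unfolding homeomorphic_maps_def continuous_map_in_subtopology by blast
    ultimately have "continuous_map (top_of_set I) X (k \<circ> x)" by (rule continuous_map_compose)
    then show ?thesis by (simp add: \<gamma>_def[abs_def] comp_def)
  qed
  have main: "smooth_on {t \<in> I. \<gamma> t \<in> fst d} (snd d \<circ> \<gamma>) \<and>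
      (\<forall>t\<in>I. \<gamma> t \<in> fst d \<longrightarrow> velocity d \<gamma> t = dtransition c d (x t) (v t) \<and> acceleration g d \<gamma> t = 0)"
    if d: "d \<in> A" for d
  proof -
    interpret cd: chart_pair X A c d by unfold_locales (rule M c d)+
    have iff: "\<gamma> t \<in> fst d \<longleftrightarrow> x t \<in> chart_overlap c d" if t: "t \<in> I" for t
    proof
      show "x t \<in> chart_overlap c d" if "\<gamma> t \<in> fst d"
        using \<gamma>[OF t] that by (auto simp: chart_overlap_def intro!: image_eqI[of _ _ "\<gamma> t"])
      assume "x t \<in> chart_overlap c d"
      then obtain P where P: "x t = snd c P" "P \<in> fst c" "P \<in> fst d" by (auto simp: chart_overlap_def)
      then have "P = \<gamma> t"
        using \<gamma>[OF t] inj_onD[OF smooth_manifold_chart(5)[OF Xm c]] by metis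
      then show "\<gamma> t \<in> fst d" using P by simp
    qed
    define Id where "Id = {t \<in> I. \<gamma> t \<in> fst d}"
    have "Id = I \<inter> x -` chart_overlap c d" using iff by (auto simp: Id_def)
    then have Id: "open Id" using continuous_open_preimage[OF cont_x I(1) cd.open_overlap] by simp
    have IdI: "t \<in> I" "x t \<in> chart_overlap c d" if "t \<in> Id" for t using that iff by (auto simp: Id_def)
    have pt: "snd d (\<gamma> t) = transition c d (x t)" if "t \<in> Id" for t
      using cd.transition_point[OF \<gamma>(1)[OF IdI(1)[OF that]]] \<gamma>(2)[OF IdI(1)[OF that]] by simp
    have 1: "smooth_on Id (snd d \<circ> \<gamma>)"
    proof (rule smooth_on_cong[OF _ Id])
      show "smooth_on Id (\<lambda>t. transition c d (x t))"
        by (rule smooth_on_compose[OF Id smooth_on_subset[OF sx] cd.smooth_transition IdI(2)])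
          (use IdI in auto)
    qed (simp add: pt)
    have vel: "velocity d \<gamma> t = dtransition c d (x t) (v t)" if t: "t \<in> Id" for t
    proof -
      have "((\<lambda>s. transition c d (x s)) has_derivative (\<lambda>h. dtransition c d (x t) (h *\<^sub>R v t))) (at t)"
        using dx[OF IdI(1)[OF t]] unfolding has_vector_derivative_def
        by (rule has_derivative_compose[where f = x, OF _ cd.has_derivative_transition[OF IdI(2)[OF t]]])
      then have "((\<lambda>s. transition c d (x s)) has_vector_derivative dtransition c d (x t) (v t)) (at t)"
        by (simp add: has_vector_derivative_def linear_scale[OF cd.linear_dtransition[OF IdI(2)[OF t]]])
      then have "((snd d \<circ> \<gamma>) has_vector_derivative dtransition c d (x t) (v t)) (at t)"
        by (rule has_vector_derivative_transform_within_open[OF _ Id t]) (simp add: pt)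
      then show ?thesis unfolding velocity_def by (rule vector_derivative_at)
    qed
    \<comment> \<open>Differentiating the transformed velocity produces a
      \<open>d2transition\<close> term, which cancels the one in
      \<open>christoffel_transition\<close>; the geodesic equation in the chart \<open>c\<close>
      removes the rest.\<close>
    have acc: "acceleration g d \<gamma> t = 0" if t: "t \<in> Id" for t
    proof -
      note xt = IdI(2)[OF t]
      let ?a = "- ?G (x t) (v t) (v t)"
      have "((\<lambda>s. dtransition c d (x s) (v s)) has_derivative
          (\<lambda>h. cd.d2transition (x t) (h *\<^sub>R v t) (v t) + dtransition c d (x t) (h *\<^sub>R ?a))) (at t)"
      proof (rule has_derivative_linear_field[where L = "\<lambda>s. dtransition c d (x s)"
            and D = "\<lambda>h w. cd.d2transition (x t) (h *\<^sub>R v t) w", OF Id t])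
        show "linear (dtransition c d (x s))" if "s \<in> Id" for s
          by (rule cd.linear_dtransition[OF IdI(2)[OF that]])
        show "((\<lambda>s. dtransition c d (x s) w) has_derivative (\<lambda>h. cd.d2transition (x t) (h *\<^sub>R v t) w)) (at t)" for w
          using dx[OF IdI(1)[OF t]] unfolding has_vector_derivative_def
          by (rule has_derivative_compose[where f = x, OF _ cd.has_derivative_dtransition[OF xt]])
        show "(v has_derivative (\<lambda>h. h *\<^sub>R ?a)) (at t)"
          using dv[OF IdI(1)[OF t]] by (simp add: has_vector_derivative_def)
      qed
      then have "((\<lambda>s. dtransition c d (x s) (v s)) has_vector_derivative
          cd.d2transition (x t) (v t) (v t) + dtransition c d (x t) ?a) (at t)"
        by (simp add: has_vector_derivative_def linear_scale[OF cd.linear_dtransition[OF xt]]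
            bilinear_lmul[OF cd.bilinear_d2transition[OF xt]] scaleR_add_right del: scaleR_minus_right)
      then have "(velocity d \<gamma> has_vector_derivative
          cd.d2transition (x t) (v t) (v t) + dtransition c d (x t) ?a) (at t)"
        by (rule has_vector_derivative_transform_within_open[OF _ Id t]) (simp add: vel)
      then show ?thesis
        unfolding acceleration_def vel[OF t] pt[OF t]
        by (simp add: vector_derivative_at linear_neg[OF cd.linear_dtransition[OF xt]]
            cd.christoffel_transition[OF g xt])
    qed
    show ?thesis using 1 vel acc by (auto simp: Id_def)
  qed
  have nz: "dtransition c d (x t) (v t) \<noteq> 0" if "d \<in> A" "t \<in> I" "\<gamma> t \<in> fst d" for d t
  proof
    interpret cd: chart_pair X A c d by unfold_locales (rule M c that)+
    assume z: "dtransition c d (x t) (v t) = 0"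
    have xt: "x t \<in> chart_overlap c d"
      using \<gamma>[OF that(2)] that(3) by (auto simp: chart_overlap_def intro!: image_eqI[of _ _ "\<gamma> t"])
    interpret dc: chart_pair X A d c by unfold_locales (rule M c that)+
    have "v t = 0"
      using cd.dtransition_inverse[OF xt, of "v t"] linear_0[OF dc.linear_dtransition[OF cd.transition_in[OF xt]]]
      by (simp add: z)
    then show False using vI[OF that(2)] by simp
  qed
  have "velocity c \<gamma> 0 = v 0"
  proof -
    have "((snd c \<circ> \<gamma>) has_vector_derivative v 0) (at 0)"
      by (rule has_vector_derivative_transform_within_open[OF dx[OF I(2)] I(1,2)]) (simp add: \<gamma>)
    then show ?thesis unfolding velocity_def by (rule vector_derivative_at)
  qed
  moreover have "J_planar X A J g I \<gamma>"
    unfolding J_planar_def regular_curve_def using I cont\<gamma> main nz by (auto simp: wedge3_zero)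
  moreover have "acceleration g c \<gamma> 0 = 0" using main[OF c] I(2) \<gamma>(1) by blast
  ultimately show thesis
    using that[of I \<gamma>] \<gamma>[OF I(2)] I(2) e1(2) by (simp add: x_def v_def)
qed

text \<open>Along the geodesic of \<open>g\<close> with initial velocity \<open>v\<close>, the
  acceleration for \<open>h\<close> at time 0 is exactly the difference of the Christoffel maps, and
  planarity for \<open>h\<close> puts it in the complex line of \<open>v\<close>.\<close>

lemma c_projective_christoffel:
  fixes X :: "'p topology" and A :: "('p, complex ^ 'n) chart set"
  assumes M: "complex_manifold X A" and g: "pseudo_riemannian A g" and h: "pseudo_riemannian A h"
    and c: "c \<in> A" and x: "x \<in> chart_image c" and eq: "c_projectively_equivalent X A complex_structure g h"
  shows "\<exists>k. christoffel h c x v v - christoffel g c x v v = k *s v"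
proof (cases "v = 0")
  case True
  have "bilinear (christoffel h c x)" "bilinear (christoffel g c x)"
    using levi_civita_christoffel[OF _ g c x] levi_civita_christoffel[OF _ h c x] M
    by (auto simp: levi_civita_at_def complex_manifold_def)
  then show ?thesis using True by (auto simp: bilinear_lzero)
next
  case False
  obtain I \<gamma> where \<gamma>: "J_planar X A complex_structure g I \<gamma>" "0 \<in> I" "\<gamma> 0 \<in> fst c" "snd c (\<gamma> 0) = x"
    "velocity c \<gamma> 0 = v" "acceleration g c \<gamma> 0 = 0"
    using geodesic_exists[OF M g c x False] by blast
  have "J_planar X A complex_structure h I \<gamma>"
    using eq \<gamma>(1) by (simp add: c_projectively_equivalent_def)
  then have "wedge3 (acceleration h c \<gamma> 0) v (\<i> *s v) = (\<lambda>_ _ _. 0)"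
    using c \<gamma> unfolding J_planar_def by (metis complex_structure_def)
  then have "\<exists>k. acceleration h c \<gamma> 0 = k *s v" by (rule wedge3_complex_line[OF _ False])
  moreover have "acceleration h c \<gamma> 0 = christoffel h c x v v - christoffel g c x v v"
    using \<gamma>(6) unfolding acceleration_def \<gamma>(4,5) by (simp add: eq_neg_iff_add_eq_0)
  ultimately show ?thesis by simp
qed

lemma c_projectively_equivalent_charts:
  fixes X :: "'p topology" and A :: "('p, complex ^ 'n) chart set"
  assumes M: "complex_manifold X A" and g: "kaehler A complex_structure g" and h: "kaehler A complex_structure h"
    and c: "c \<in> A" and eq: "c_projectively_equivalent X A complex_structure g h"
  shows "c_projective_charts (chart_image c) (\<lambda>x. hermitian_of (g c x)) (christoffel g c)
    (\<lambda>x. hermitian_of (h c x)) (christoffel h c)"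
proof -
  have X: "smooth_manifold X A" and pr: "pseudo_riemannian A g" "pseudo_riemannian A h"
    using M g h by (auto simp: complex_manifold_def kaehler_def)
  interpret K1: kaehler_chart "chart_image c" "\<lambda>x. hermitian_of (g c x)" "christoffel g c"
    by (rule kaehler_imp_kaehler_chart[OF X g c])
  interpret K2: kaehler_chart "chart_image c" "\<lambda>x. hermitian_of (h c x)" "christoffel h c"
    by (rule kaehler_imp_kaehler_chart[OF X h c])
  show ?thesis
    by unfold_locales (rule c_projective_christoffel[OF M pr c _ eq])
qed

section \<open>Einstein metrics\<close>

lemma c_projectively_equivalent_sym:
  "c_projectively_equivalent X A J g h \<Longrightarrow> c_projectively_equivalent X A J h g"
  by (auto simp: c_projectively_equivalent_def)

lemma ricci_eq_ricci_form:
  fixes A :: "('p, complex ^ 'n) chart set"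
  assumes X: "smooth_manifold X A" and g: "kaehler A complex_structure g" and c: "c \<in> A" and x: "x \<in> chart_image c"
  shows "ricci g c x v w = - 2 * (real CARD('n) + 1) * Re (ricci_form (christoffel g c) x w v)"
proof -
  interpret K: kaehler_chart "chart_image c" "\<lambda>x. hermitian_of (g c x)" "christoffel g c"
    by (rule kaehler_imp_kaehler_chart[OF X g c])
  have "riemann g c x u v w = K.curv x u v w" for u
    by (simp add: riemann_def K.curv_def K.DG_def)
  then show ?thesis using K.endo_trace_curv[OF x, of v w] by (simp add: ricci_def)
qed

text \<open>\<open>einstein\<close> concerns the real Ricci tensor, but a Hermitian form is
  determined by its real part: evaluation at \<open>\<i> *s v\<close> gives the negative imaginary
  part. The constant \<open>b\<close> serves all charts because \<open>scal\<close> is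
  constant.\<close>

lemma einstein_imp_ricci_form:
  fixes A :: "('p, complex ^ 'n) chart set"
  assumes X: "smooth_manifold X A" and g: "kaehler_einstein A complex_structure g"
  shows "\<exists>b::real. \<forall>c\<in>A. \<forall>x\<in>chart_image c. \<forall>v u.
    ricci_form (christoffel g c) x v u = of_real b * hermitian_of (g c x) v u"
proof -
  have gK: "kaehler A complex_structure g" and gE: "einstein A g" using g by (auto simp: kaehler_einstein_def)
  obtain s where s: "\<And>c x. c \<in> A \<Longrightarrow> x \<in> chart_image c \<Longrightarrow> scal g c x = s"
    using gE by (auto simp: einstein_def)
  define N where "N = - 2 * (real CARD('n) + 1)"
  have N: "N \<noteq> 0" by (simp add: N_def)
  define b where "b = s / real DIM(complex ^ 'n) / N"
  have "ricci_form (christoffel g c) x v u = of_real b * hermitian_of (g c x) v u"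
    if c: "c \<in> A" and x: "x \<in> chart_image c" for c x v u
  proof -
    interpret K: kaehler_chart "chart_image c" "\<lambda>x. hermitian_of (g c x)" "christoffel g c"
      by (rule kaehler_imp_kaehler_chart[OF X gK c])
    have sym: "g c x v u = g c x u v" for v u
      using gK c x by (auto simp: kaehler_def pseudo_riemannian_def)
    have Re: "Re (ricci_form (christoffel g c) x v u) = b * Re (hermitian_of (g c x) v u)" for v u
    proof -
      have "N * Re (ricci_form (christoffel g c) x v u) = s / real DIM(complex ^ 'n) * g c x u v"
        using ricci_eq_ricci_form[OF X gK c x, of u v] gE c x s[OF c x] by (simp add: einstein_def N_def)
      then show ?thesis using N by (simp add: b_def hermitian_of_def sym[of v u] field_simps)
    qed
    note ric = K.hermitian_ricci_form[OF x] and herm = K.herm[OF x]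
    show ?thesis
    proof (rule complex_eqI)
      show "Re (ricci_form (christoffel g c) x v u) = Re (of_real b * hermitian_of (g c x) v u)"
        using Re[of v u] by simp
      show "Im (ricci_form (christoffel g c) x v u) = Im (of_real b * hermitian_of (g c x) v u)"
        using Re[of "\<i> *s v" u] by (simp add: hermitian_form_scale_left[OF ric] hermitian_form_scale_left[OF herm])
    qed
  qed
  then show ?thesis by blast
qed

lemma ricci_form_imp_einstein:
  fixes A :: "('p, complex ^ 'n) chart set"
  assumes X: "smooth_manifold X A" and g: "kaehler A complex_structure g"
    and ric: "\<And>c x v u. c \<in> A \<Longrightarrow> x \<in> chart_image c \<Longrightarrow>
      ricci_form (christoffel g c) x v u = of_real b * hermitian_of (g c x) v u"
  shows "einstein A g"
proof -
  define l where "l = - 2 * (real CARD('n) + 1) * b"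
  have pr: "pseudo_riemannian A g" using g by (simp add: kaehler_def)
  have r: "ricci g c x v w = l * g c x v w" if c: "c \<in> A" and x: "x \<in> chart_image c" for c x v w
    using ricci_eq_ricci_form[OF X g c x, of v w] ric[OF c x, of w v] pseudo_riemannian_chart(3)[OF pr c x, of v w]
    by (simp add: l_def hermitian_of_def)
  have s: "scal g c x = l * real DIM(complex ^ 'n)" if c: "c \<in> A" and x: "x \<in> chart_image c" for c x
  proof -
    note prc = pseudo_riemannian_chart[OF pr c]
    have "sharp g c x (ricci g c x v) = l *\<^sub>R v" for v
      unfolding sharp_def
    proof (rule the1_equality)
      have "linear (ricci g c x v)"
        using prc(2)[OF x] by (auto intro!: linearI simp: r[OF c x] bilinear_radd bilinear_rmul algebra_simps)
      then show "\<exists>!u. \<forall>w. g c x u w = ricci g c x v w"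
        using dual_vector_unique[OF prc(2)[OF x] prc(4)[OF x]] by blast
      show "\<forall>w. g c x (l *\<^sub>R v) w = ricci g c x v w"
        using prc(2)[OF x] by (simp add: r[OF c x] bilinear_lmul)
    qed
    then show ?thesis by (simp add: scal_def endo_trace_def inner_Basis)
  qed
  show ?thesis
    unfolding einstein_def using r s by auto
qed

text \<open>The Ricci form of \<open>g\<close> differs from that of \<open>g1\<close> by
  \<open>dbar_Ups\<close>. It is enough to transform this term, since the factor \<open>b1\<close>
  for \<open>g1\<close> is the same in both charts.\<close>

lemma (in chart_pair) ricci_factor_transition:
  assumes g1: "kaehler A complex_structure g1" and g: "kaehler A complex_structure g"
    and eq: "c_projectively_equivalent X A complex_structure g1 g"
    and ric1: "\<And>c x v u. c \<in> A \<Longrightarrow> x \<in> chart_image c \<Longrightarrow>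
      ricci_form (christoffel g1 c) x v u = of_real b1 * hermitian_of (g1 c x) v u"
    and x: "x \<in> chart_overlap c d"
    and rc: "\<And>v u. ricci_form (christoffel g c) x v u = of_real \<alpha> * hermitian_of (g c x) v u"
    and rd: "\<And>v u. ricci_form (christoffel g d) (transition c d x) v u
      = of_real \<beta> * hermitian_of (g d (transition c d x)) v u"
  shows "\<alpha> = \<beta>"
proof -
  interpret Cc: c_projective_charts "chart_image c" "\<lambda>x. hermitian_of (g1 c x)" "christoffel g1 c"
    "\<lambda>x. hermitian_of (g c x)" "christoffel g c"
    by (rule c_projectively_equivalent_charts[OF M g1 g c eq])
  interpret Cd: c_projective_charts "chart_image d" "\<lambda>x. hermitian_of (g1 d x)" "christoffel g1 d"
    "\<lambda>x. hermitian_of (g d x)" "christoffel g d"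
    by (rule c_projectively_equivalent_charts[OF M g1 g d eq])
  have pr: "pseudo_riemannian A g1" "pseudo_riemannian A g" using g1 g by (auto simp: kaehler_def)
  let ?\<phi> = "transition c d" and ?L = "\<lambda>x. dtransition c d x"
  \<comment> \<open>Both Christoffel maps acquire the same \<open>d2transition\<close> term; it
    cancels in the difference, so \<open>Ups\<close> transforms as a one-form.\<close>
  have Ups: "Cc.Ups y v = Cd.Ups (?\<phi> y) (?L y v)" if y: "y \<in> chart_overlap c d" for y v
  proof (cases "v = 0")
    case True
    have "Cc.Ups y 0 = 0" using Cc.Ups_scale[of y 0 0] y overlap_subset by auto
    moreover have "Cd.Ups (?\<phi> y) 0 = 0" using Cd.Ups_scale[OF transition_in_image[OF y], of 0 0] by simp
    ultimately show ?thesis using True linear_0[OF linear_dtransition[OF y]] by simp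
  next
    case False
    have yc: "y \<in> chart_image c" using y overlap_subset by auto
    note L = complex_linear_add[OF clin_dtransition[OF y]] complex_linear_scale[OF clin_dtransition[OF y]]
    have Lv: "?L y v \<noteq> 0"
    proof
      interpret dc: chart_pair X A d c by unfold_locales (rule M c d)+
      assume "?L y v = 0"
      then show False
        using dtransition_inverse[OF y, of v] linear_0[OF dc.linear_dtransition[OF transition_in[OF y]]] False by simp
    qed
    have "?L y (christoffel g c y v v) = ?L y (christoffel g1 c y v v) + (2 * Cc.Ups y v) *s ?L y v"
      unfolding Cc.G2_eq[OF yc] L by (simp add: vec_eq_iff algebra_simps)
    then have "christoffel g d (?\<phi> y) (?L y v) (?L y v)
        = christoffel g1 d (?\<phi> y) (?L y v) (?L y v) + (2 * Cc.Ups y v) *s ?L y v"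
      unfolding christoffel_transition[OF pr(1) y] christoffel_transition[OF pr(2) y] by (simp add: algebra_simps)
    then have "(2 * Cd.Ups (?\<phi> y) (?L y v)) *s ?L y v = (2 * Cc.Ups y v) *s ?L y v"
      unfolding Cd.G2_eq[OF transition_in_image[OF y]] by (simp add: vec_eq_iff algebra_simps)
    then show ?thesis using Lv by simp
  qed
  have xc: "x \<in> chart_image c" using x overlap_subset by auto
  note xd = transition_in_image[OF x]
  have Ups_linear: "linear (Cd.Ups y)" if "y \<in> chart_image d" for y
    by (rule linearI)
      (simp_all add: Cd.Ups_add[OF that] Cd.Ups_scale[OF that] scaleR_eq_of_real_scale scaleR_conv_of_real)
  have dUps: "Cc.dUps x u w = Cd.dUps (?\<phi> x) (?L x u) (?L x w) + Cd.Ups (?\<phi> x) (d2transition x u w)" for u w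
  proof -
    have "((\<lambda>y. Cd.Ups (?\<phi> y) (?L y w)) has_derivative
        (\<lambda>u. Cd.dUps (?\<phi> x) (?L x u) (?L x w) + Cd.Ups (?\<phi> x) (d2transition x u w))) (at x)"
    proof (rule has_derivative_linear_field[where L = "\<lambda>y. Cd.Ups (?\<phi> y)"
          and D = "\<lambda>u a. Cd.dUps (?\<phi> x) (?L x u) a", OF open_overlap x])
      show "linear (Cd.Ups (?\<phi> y))" if "y \<in> chart_overlap c d" for y
        by (rule Ups_linear[OF transition_in_image[OF that]])
      show "((\<lambda>y. Cd.Ups (?\<phi> y) a) has_derivative (\<lambda>u. Cd.dUps (?\<phi> x) (?L x u) a)) (at x)" for a
        by (rule has_derivative_compose[where f = ?\<phi> and g = "\<lambda>y. Cd.Ups y a",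
              OF has_derivative_transition[OF x] Cd.has_derivative_Ups[OF xd]])
    qed (rule has_derivative_dtransition[OF x])
    then have "((\<lambda>y. Cc.Ups y w) has_derivative
        (\<lambda>u. Cd.dUps (?\<phi> x) (?L x u) (?L x w) + Cd.Ups (?\<phi> x) (d2transition x u w))) (at x)"
      by (rule has_derivative_transform_within_open[OF _ open_overlap x]) (simp add: Ups)
    from fun_cong[OF has_derivative_unique[OF Cc.has_derivative_Ups[OF xc] this], of u] show ?thesis .
  qed
  \<comment> \<open>The extra term with \<open>d2transition\<close> is complex linear in
    \<open>u\<close>, so the antiholomorphic combination annihilates it.\<close>
  have dbar: "Cc.dbar_Ups x u w = Cd.dbar_Ups (?\<phi> x) (?L x u) (?L x w)" for u w
    unfolding Cc.dbar_Ups_def Cd.dbar_Ups_def dUps d2transition_i[OF x] Cd.Ups_scale[OF xd]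
      complex_linear_scale[OF clin_dtransition[OF x]]
    by (simp add: algebra_simps)
  obtain p q where pq: "hermitian_of (g c x) p q \<noteq> 0"
    using nondegenerate_nonzero_value[OF Cc.K2.nondeg[OF xc]] by blast
  have "of_real \<alpha> * hermitian_of (g c x) p q - of_real b1 * hermitian_of (g1 c x) p q
      = of_real \<beta> * hermitian_of (g c x) p q - of_real b1 * hermitian_of (g1 c x) p q"
    using Cc.ricci_form_relation[OF xc, of p q] Cd.ricci_form_relation[OF xd, of "?L x p" "?L x q"] dbar[of q p]
    unfolding rc rd ric1[OF c xc] ric1[OF d xd] hermitian_of_transition[OF pr(1) x] hermitian_of_transition[OF pr(2) x]
    by (simp add: algebra_simps)
  then show ?thesis using pq by simp
qed

section \<open>Patching over a connected manifold\<close>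

lemma openin_chart_preimage:
  assumes X: "smooth_manifold X A" and c: "c \<in> A" and U: "open U" "U \<subseteq> chart_image c"
  shows "openin X {P \<in> fst c. snd c P \<in> U}"
proof -
  have "continuous_map (subtopology X (fst c)) (top_of_set (chart_image c)) (snd c)"
    using smooth_manifold_chart(3)[OF X c] homeomorphic_imp_continuous_map by blast
  moreover have "openin (top_of_set (chart_image c)) U"
    using U openin_open_eq[OF smooth_manifold_chart(2)[OF X c]] by blast
  ultimately have "openin (subtopology X (fst c)) {P \<in> topspace (subtopology X (fst c)). snd c P \<in> U}"
    by (rule openin_continuous_map_preimage)
  then show ?thesis
    unfolding smooth_manifold_chart(4)[OF X c]
    using openin_trans_full smooth_manifold_chart(1)[OF X c] by blast
qed

lemma chart_cover:
  assumes "smooth_manifold X A" "P \<in> topspace X"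
  obtains c where "c \<in> A" "P \<in> fst c"
  using assms unfolding smooth_manifold_def by (metis UN_E)

lemma chart_ball:
  assumes X: "smooth_manifold X A" and c: "c \<in> A" and P: "P \<in> fst c"
  obtains r where "r > 0" "cball (snd c P) r \<subseteq> chart_image c" "openin X {Q \<in> fst c. snd c Q \<in> ball (snd c P) r}"
proof -
  have "snd c P \<in> chart_image c" using P by (auto simp: chart_image_def)
  then obtain r where r: "r > 0" "cball (snd c P) r \<subseteq> chart_image c"
    using smooth_manifold_chart(2)[OF X c] open_contains_cball by blast
  have "openin X {Q \<in> fst c. snd c Q \<in> ball (snd c P) r}"
    by (rule openin_chart_preimage[OF X c]) (use r ball_subset_cball in \<open>auto simp: subset_iff\<close>)
  then show thesis by (rule that[OF r])
qed

lemma connected_space_clopen_eq: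
  assumes "connected_space X" "openin X Z" "openin X (topspace X - Z)" "Z \<noteq> {}"
  shows "Z = topspace X"
  using assms openin_subset[OF assms(2)] unfolding connected_space_clopen_in closedin_def by blast

text \<open>Membership in \<open>Z\<close> does not change on a coordinate ball, which makes both
  \<open>Z\<close> and its complement open.\<close>

lemma locally_constant_imp_constant:
  fixes f :: "('p, complex ^ 'n) chart \<Rightarrow> complex ^ 'n \<Rightarrow> 'b"
  assumes X: "smooth_manifold X A" and conn: "connected_space X"
    and trans: "\<And>c d P. c \<in> A \<Longrightarrow> d \<in> A \<Longrightarrow> P \<in> fst c \<Longrightarrow> P \<in> fst d \<Longrightarrow> f c (snd c P) = f d (snd d P)"
    and loc: "\<And>c a r x y. c \<in> A \<Longrightarrow> cball a r \<subseteq> chart_image c \<Longrightarrow> x \<in> ball a r \<Longrightarrow> y \<in> ball a r \<Longrightarrow> f c x = f c y"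
  shows "\<exists>s. \<forall>c\<in>A. \<forall>x\<in>chart_image c. f c x = s"
proof (cases "topspace X = {}")
  case True
  have "chart_image c = {}" if "c \<in> A" for c
    using openin_subset[OF smooth_manifold_chart(1)[OF X that]] True by (simp add: chart_image_def)
  then show ?thesis by simp
next
  case False
  then obtain P0 c0 where P0: "P0 \<in> topspace X" "c0 \<in> A" "P0 \<in> fst c0" using chart_cover[OF X] by blast
  define s where "s = f c0 (snd c0 P0)"
  define Z where "Z = {P \<in> topspace X. \<forall>c\<in>A. P \<in> fst c \<longrightarrow> f c (snd c P) = s}"
  have near: "\<exists>V. openin X V \<and> P \<in> V \<and> (\<forall>Q\<in>V. Q \<in> Z \<longleftrightarrow> P \<in> Z)" if P: "P \<in> topspace X" for P
  proof -
    obtain c where c: "c \<in> A" "P \<in> fst c" using chart_cover[OF X P] by blast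
    obtain r where r: "r > 0" "cball (snd c P) r \<subseteq> chart_image c" "openin X {Q \<in> fst c. snd c Q \<in> ball (snd c P) r}"
      using chart_ball[OF X c] by blast
    have iff: "Q \<in> Z \<longleftrightarrow> f c (snd c Q) = s" if "Q \<in> fst c" for Q
    proof
      show "f c (snd c Q) = s" if "Q \<in> Z" using that c(1) \<open>Q \<in> fst c\<close> by (simp add: Z_def)
      assume s: "f c (snd c Q) = s"
      have "f d (snd d Q) = s" if "d \<in> A" "Q \<in> fst d" for d
        using trans[OF that(1) c(1) that(2) \<open>Q \<in> fst c\<close>] s by simp
      moreover have "Q \<in> topspace X"
        using openin_subset[OF smooth_manifold_chart(1)[OF X c(1)]] \<open>Q \<in> fst c\<close> by blast
      ultimately show "Q \<in> Z" by (simp add: Z_def)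
    qed
    have "Q \<in> Z \<longleftrightarrow> P \<in> Z" if Q: "Q \<in> fst c" "snd c Q \<in> ball (snd c P) r" for Q
      using loc[OF c(1) r(2) Q(2), of "snd c P"] r(1) iff[OF Q(1)] iff[OF c(2)] by simp
    then have "\<forall>Q\<in>{Q \<in> fst c. snd c Q \<in> ball (snd c P) r}. Q \<in> Z \<longleftrightarrow> P \<in> Z" by blast
    moreover have "P \<in> {Q \<in> fst c. snd c Q \<in> ball (snd c P) r}" using r(1) c(2) by simp
    ultimately show ?thesis using r(3) by blast
  qed
  have "openin X Z"
  proof (subst openin_subopen, intro ballI)
    fix P assume P: "P \<in> Z"
    then have "P \<in> topspace X" by (simp add: Z_def)
    from near[OF this] obtain V where "openin X V" "P \<in> V" "\<forall>Q\<in>V. Q \<in> Z \<longleftrightarrow> P \<in> Z" by blast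
    then show "\<exists>V. openin X V \<and> P \<in> V \<and> V \<subseteq> Z" using P by (intro exI[of _ V]) blast
  qed
  moreover have "openin X (topspace X - Z)"
  proof (subst openin_subopen, intro ballI)
    fix P assume P: "P \<in> topspace X - Z"
    then have "P \<in> topspace X" by simp
    from near[OF this] obtain V where "openin X V" "P \<in> V" "\<forall>Q\<in>V. Q \<in> Z \<longleftrightarrow> P \<in> Z" by blast
    moreover from this(1) have "V \<subseteq> topspace X" by (rule openin_subset)
    ultimately show "\<exists>V. openin X V \<and> P \<in> V \<and> V \<subseteq> topspace X - Z"
      using P by (intro exI[of _ V]) blast
  qed
  moreover have "P0 \<in> Z"
    using P0(1) trans[OF _ P0(2) _ P0(3)] unfolding Z_def s_def by blast
  ultimately have Z: "Z = topspace X" using connected_space_clopen_eq[OF conn] by blast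
  have "f c x = s" if c: "c \<in> A" and x: "x \<in> chart_image c" for c x
  proof -
    obtain P where P: "P \<in> fst c" "x = snd c P" using x by (auto simp: chart_image_def)
    then have "P \<in> Z" using Z openin_subset[OF smooth_manifold_chart(1)[OF X c]] by auto
    then show ?thesis using P c by (auto simp: Z_def)
  qed
  then show ?thesis by (intro exI[of _ s]) simp
qed

text \<open>The constant \<open>k\<close> is fixed once, at \<open>y0\<close>, and the set of points
  near which \<open>h2 = k h1\<close> is shown to be open and closed; closedness is the unique
  continuation in \<open>proportionality_spreads\<close>.\<close>

lemma proportional_of_locally_proportional:
  fixes A :: "('p, complex ^ 'n) chart set"
  assumes M: "complex_manifold X A" and conn: "connected_space X" and n: "CARD('n) \<ge> 2"
    and g1: "kaehler A complex_structure g1" and g2: "kaehler A complex_structure g2"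
    and eq: "c_projectively_equivalent X A complex_structure g1 g2"
    and ric1: "\<And>c x v u. c \<in> A \<Longrightarrow> x \<in> chart_image c \<Longrightarrow>
      ricci_form (christoffel g1 c) x v u = of_real b1 * hermitian_of (g1 c x) v u"
    and ric2: "\<And>c x v u. c \<in> A \<Longrightarrow> x \<in> chart_image c \<Longrightarrow>
      ricci_form (christoffel g2 c) x v u = of_real b2 * hermitian_of (g2 c x) v u"
    and c0: "c0 \<in> A" and U0: "open U0" "U0 \<subseteq> chart_image c0" "y0 \<in> U0"
    and prop0: "\<And>y. y \<in> U0 \<Longrightarrow> \<exists>k::real. \<forall>v w. hermitian_of (g2 c0 y) v w = of_real k * hermitian_of (g1 c0 y) v w"
  shows "proportional A g1 g2"
proof -
  have X: "smooth_manifold X A" using M by (simp add: complex_manifold_def)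
  have pr: "pseudo_riemannian A g1" "pseudo_riemannian A g2" using g1 g2 by (auto simp: kaehler_def)
  note charts = c_projectively_equivalent_charts[OF M g1 g2 _ eq]
  interpret C0: c_projective_charts "chart_image c0" "\<lambda>x. hermitian_of (g1 c0 x)" "christoffel g1 c0"
    "\<lambda>x. hermitian_of (g2 c0 x)" "christoffel g2 c0"
    by (rule charts[OF c0])
  obtain k :: real where k: "\<And>v w. hermitian_of (g2 c0 y0) v w = of_real k * hermitian_of (g1 c0 y0) v w"
    "\<And>v. C0.Ups y0 v = 0" "b2 * k = b1"
    using C0.proportional_on_open[OF n ric1[OF c0] ric2[OF c0] U0 prop0] by blast
  let ?P = "\<lambda>c y. \<forall>v w. hermitian_of (g2 c y) v w = of_real k * hermitian_of (g1 c y) v w"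
  have transP: "?P c x" if "c \<in> A" "d \<in> A" "x \<in> chart_overlap c d" "?P d (transition c d x)" for c d x
  proof -
    interpret cd: chart_pair X A c d by unfold_locales (rule M that)+
    show ?thesis
      using that(4) cd.hermitian_of_transition[OF pr(1) that(3)] cd.hermitian_of_transition[OF pr(2) that(3)] by metis
  qed
  \<comment> \<open>Asking for a whole neighbourhood makes \<open>Z\<close> open at once and
    provides the open sets that \<open>proportional_on_open\<close> needs; one chart is enough by
    \<open>transP\<close>.\<close>
  define Z where "Z = {P. \<exists>c\<in>A. \<exists>U. open U \<and> U \<subseteq> chart_image c \<and> P \<in> fst c \<and> snd c P \<in> U \<and> (\<forall>y\<in>U. ?P c y)}"
  have ZX: "Z \<subseteq> topspace X"
    using openin_subset[OF smooth_manifold_chart(1)[OF X]] by (auto simp: Z_def)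
  have open_Z: "openin X Z"
  proof (subst openin_subopen, intro ballI)
    fix P assume "P \<in> Z"
    then obtain c U where U: "c \<in> A" "open U" "U \<subseteq> chart_image c" "P \<in> fst c" "snd c P \<in> U" "\<forall>y\<in>U. ?P c y"
      by (auto simp: Z_def)
    show "\<exists>T. openin X T \<and> P \<in> T \<and> T \<subseteq> Z"
      by (rule exI[of _ "{Q \<in> fst c. snd c Q \<in> U}"])
        (use openin_chart_preimage[OF X U(1-3)] U in \<open>auto simp: Z_def\<close>)
  qed
  have spread: "?P c y"
    if c: "c \<in> A" and B: "cball a r \<subseteq> chart_image c" and V: "open V" "V \<subseteq> chart_image c" "z \<in> V" "\<forall>y\<in>V. ?P c y"
      and z: "z \<in> ball a r" and y: "y \<in> ball a r" for c a r V z y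
  proof -
    interpret C: c_projective_charts "chart_image c" "\<lambda>x. hermitian_of (g1 c x)" "christoffel g1 c"
      "\<lambda>x. hermitian_of (g2 c x)" "christoffel g2 c"
      by (rule charts[OF c])
    \<comment> \<open>On \<open>V\<close> the factor is already \<open>k\<close>; the point of this
      step is \<open>C.Ups z v = 0\<close> and the relation of constants in the present chart.
      Comparing at a nonzero value of the form gives \<open>k' = k\<close>.\<close>
    obtain k' :: real where k': "\<And>v w. hermitian_of (g2 c z) v w = of_real k' * hermitian_of (g1 c z) v w"
      "\<And>v. C.Ups z v = 0" "b2 * k' = b1"
      using C.proportional_on_open[OF n ric1[OF c] ric2[OF c] V(1-3)] V(4) by blast
    have zc: "z \<in> chart_image c" using V by auto
    obtain p q where pq: "hermitian_of (g1 c z) p q \<noteq> 0"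
      using nondegenerate_nonzero_value[OF C.K1.nondeg[OF zc]] by blast
    have "of_real k * hermitian_of (g1 c z) p q = of_real k' * hermitian_of (g1 c z) p q"
      using k'(1)[of p q] V(3,4) by metis
    then have "k = k'" using pq by simp
    then show ?thesis
      using C.proportionality_spreads[OF n ric1[OF c] ric2[OF c] B z y k'] by blast
  qed
  have "openin X (topspace X - Z)"
  proof (subst openin_subopen, intro ballI)
    fix P assume P: "P \<in> topspace X - Z"
    then obtain c where c: "c \<in> A" "P \<in> fst c" using chart_cover[OF X] by blast
    obtain r where r: "r > 0" "cball (snd c P) r \<subseteq> chart_image c" "openin X {Q \<in> fst c. snd c Q \<in> ball (snd c P) r}"
      using chart_ball[OF X c] by blast
    have "Q \<notin> Z" if Q: "Q \<in> fst c" "snd c Q \<in> ball (snd c P) r" for Q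
    proof
      assume "Q \<in> Z"
      then obtain d U where U: "d \<in> A" "open U" "U \<subseteq> chart_image d" "Q \<in> fst d" "snd d Q \<in> U" "\<forall>y\<in>U. ?P d y"
        by (auto simp: Z_def)
      interpret cd: chart_pair X A c d by unfold_locales (rule M c U)+
      \<comment> \<open>The neighbourhood of \<open>Q\<close> is known in the chart
        \<open>d\<close>; \<open>V\<close> carries it to the chart \<open>c\<close>, whose ball also
        contains \<open>P\<close>.\<close>
      define V where "V = chart_overlap c d \<inter> transition c d -` U"
      have V: "open V"
        unfolding V_def
        by (rule continuous_open_preimage[OF smooth_on_imp_continuous_on[OF cd.smooth_transition] cd.open_overlap U(2)])
      have "snd c Q \<in> V"
        using Q U cd.transition_point[OF Q(1)] by (auto simp: V_def chart_overlap_def)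
      moreover have "\<forall>y\<in>V. ?P c y"
        using transP[OF c(1) U(1)] U(6) by (auto simp: V_def)
      moreover have "V \<subseteq> chart_image c" using cd.overlap_subset by (auto simp: V_def)
      ultimately have "\<forall>y\<in>ball (snd c P) r. ?P c y"
        using spread[OF c(1) r(2) V _ _ _ Q(2)] by blast
      moreover have "ball (snd c P) r \<subseteq> chart_image c" using r(2) ball_subset_cball by blast
      ultimately have "P \<in> Z"
        using c r(1) unfolding Z_def by (intro CollectI bexI[of _ c] exI[of _ "ball (snd c P) r"]) auto
      then show False using P by simp
    qed
    then show "\<exists>T. openin X T \<and> P \<in> T \<and> T \<subseteq> topspace X - Z"
      using r c(2) openin_subset[OF r(3)] by (intro exI[of _ "{Q \<in> fst c. snd c Q \<in> ball (snd c P) r}"]) auto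
  qed
  moreover have "Z \<noteq> {}"
  proof -
    have "y0 \<in> chart_image c0" using U0 by auto
    then obtain P0 where P0: "P0 \<in> fst c0" "snd c0 P0 = y0" by (auto simp: chart_image_def)
    obtain r where r: "r > 0" "cball y0 r \<subseteq> chart_image c0" using chart_ball[OF X c0 P0(1)] P0(2) by metis
    \<comment> \<open>In \<open>prop0\<close> the factor may still vary with the point; spreading
      from \<open>y0\<close> makes it the constant \<open>k\<close> on a ball.\<close>
    have "?P c0 y" if "y \<in> ball y0 r" for y
      using C0.proportionality_spreads[OF n ric1[OF c0] ric2[OF c0] r(2) _ that k] r(1) by simp
    moreover have "ball y0 r \<subseteq> chart_image c0" using r(2) ball_subset_cball by blast
    ultimately have "P0 \<in> Z"
      using P0 c0 r(1) unfolding Z_def by (intro CollectI bexI[of _ c0] exI[of _ "ball y0 r"]) auto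
    then show ?thesis by blast
  qed
  ultimately have Z: "Z = topspace X" using connected_space_clopen_eq[OF conn open_Z] by blast
  have "g2 c x v w = k * g1 c x v w" if c: "c \<in> A" and x: "x \<in> chart_image c" for c x v w
  proof -
    obtain P where P: "P \<in> fst c" "x = snd c P" using x by (auto simp: chart_image_def)
    then have "P \<in> Z" using Z openin_subset[OF smooth_manifold_chart(1)[OF X c]] by auto
    then obtain d U where U: "d \<in> A" "P \<in> fst d" "snd d P \<in> U" "\<forall>y\<in>U. ?P d y" by (auto simp: Z_def)
    interpret cd: chart_pair X A c d by unfold_locales (rule M c U)+
    have "?P c x"
    proof (rule transP[OF c U(1)])
      show "x \<in> chart_overlap c d" using P U by (auto simp: chart_overlap_def)
      show "?P d (transition c d x)" using U(3,4) cd.transition_point[OF P(1)] P(2) by simp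
    qed
    then have "Re (hermitian_of (g2 c x) v w) = Re (of_real k * hermitian_of (g1 c x) v w)" by simp
    then show ?thesis by (simp add: hermitian_of_def)
  qed
  then show ?thesis unfolding proportional_def by blast
qed

theorem theorem6:
  fixes X :: "'p topology"
    and A :: "('p, complex ^ 'n) chart set"
    and g1 g2 g :: "('p, complex ^ 'n) bilinear_field"
  assumes "complex_manifold X A"
    and "connected_space X"
    and "2 * CARD('n) \<ge> 4"
    and "kaehler_einstein A complex_structure g1"
    and "kaehler_einstein A complex_structure g2"
    and "\<not> proportional A g1 g2"
    and "c_projectively_equivalent X A complex_structure g1 g2"
    and "kaehler A complex_structure g"
    and "c_projectively_equivalent X A complex_structure g g1"
    and "c_projectively_equivalent X A complex_structure g g2"
  shows "einstein A g"
proof -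
  have X: "smooth_manifold X A" using assms(1) by (simp add: complex_manifold_def)
  have n: "CARD('n) \<ge> 2" using assms(3) by simp
  have k: "kaehler A complex_structure g1" "kaehler A complex_structure g2"
    using assms(4,5) by (auto simp: kaehler_einstein_def)
  obtain b1 :: real where b1: "\<And>c x v u. c \<in> A \<Longrightarrow> x \<in> chart_image c \<Longrightarrow>
      ricci_form (christoffel g1 c) x v u = of_real b1 * hermitian_of (g1 c x) v u"
    using einstein_imp_ricci_form[OF X assms(4)] by blast
  obtain b2 :: real where b2: "\<And>c x v u. c \<in> A \<Longrightarrow> x \<in> chart_image c \<Longrightarrow>
      ricci_form (christoffel g2 c) x v u = of_real b2 * hermitian_of (g2 c x) v u"
    using einstein_imp_ricci_form[OF X assms(5)] by blast
  note eq = c_projectively_equivalent_sym[OF assms(9)]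
  have dense: "\<exists>y\<in>U. \<forall>k::real. \<exists>v w. hermitian_of (g2 c y) v w \<noteq> of_real k * hermitian_of (g1 c y) v w"
    if U: "c \<in> A" "open U" "U \<subseteq> chart_image c" "U \<noteq> {}" for c U
  proof (rule ccontr)
    assume a: "\<not> ?thesis"
    obtain y0 where "y0 \<in> U" using U(4) by blast
    have "\<exists>k::real. \<forall>v w. hermitian_of (g2 c y) v w = of_real k * hermitian_of (g1 c y) v w" if "y \<in> U" for y
      using a that by blast
    from proportional_of_locally_proportional[OF assms(1,2) n k assms(7) b1 b2 U(1-3) \<open>y0 \<in> U\<close> this]
    have "proportional A g1 g2" .
    then show False using assms(6) by simp
  qed
  have "\<exists>\<alpha>::real. \<forall>v u. ricci_form (christoffel g c) x v u = of_real \<alpha> * hermitian_of (g c x) v u"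
    if c: "c \<in> A" and x: "x \<in> chart_image c" for c x
    by (rule ricci_proportional_by_density[OF c_projectively_equivalent_charts[OF assms(1) k c assms(7)]
          c_projectively_equivalent_charts[OF assms(1) k(1) assms(8) c eq] x b1[OF c] b2[OF c] dense[OF c]])
  then obtain \<alpha> :: "('p, complex ^ 'n) chart \<Rightarrow> complex ^ 'n \<Rightarrow> real" where
    \<alpha>: "\<And>c x v u. c \<in> A \<Longrightarrow> x \<in> chart_image c \<Longrightarrow>
      ricci_form (christoffel g c) x v u = of_real (\<alpha> c x) * hermitian_of (g c x) v u"
    by metis
  \<comment> \<open>\<open>\<alpha>\<close> was chosen separately for each chart and point, so its
    agreement on overlaps and its constancy on coordinate balls both have to be proved.\<close>
  have "\<exists>s. \<forall>c\<in>A. \<forall>x\<in>chart_image c. \<alpha> c x = s"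
  proof (rule locally_constant_imp_constant[OF X assms(2)])
    fix c d P assume cd: "c \<in> A" "d \<in> A" "P \<in> fst c" "P \<in> fst d"
    interpret cd: chart_pair X A c d by unfold_locales (rule assms(1) cd)+
    have x: "snd c P \<in> chart_overlap c d" "snd c P \<in> chart_image c" "snd d P \<in> chart_image d"
      using cd by (auto simp: chart_overlap_def chart_image_def)
    have t: "transition c d (snd c P) = snd d P" by (rule cd.transition_point[OF cd(3)])
    show "\<alpha> c (snd c P) = \<alpha> d (snd d P)"
      by (rule cd.ricci_factor_transition[OF k(1) assms(8) eq b1 x(1) \<alpha>[OF cd(1) x(2)]], unfold t)
        (assumption, assumption, rule \<alpha>[OF cd(2) x(3)])
  next
    fix c a r x y
    assume c: "c \<in> A" and B: "cball a r \<subseteq> chart_image c" and xy: "x \<in> ball a r" "y \<in> ball a r"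
    interpret K: kaehler_chart "chart_image c" "\<lambda>x. hermitian_of (g c x)" "christoffel g c"
      by (rule kaehler_imp_kaehler_chart[OF X assms(8) c])
    have B': "ball a r \<subseteq> chart_image c" using B ball_subset_cball by blast
    show "\<alpha> c x = \<alpha> c y"
      by (rule K.ricci_factor_locally_constant[OF n B' \<alpha>[OF c] xy]) (use B' in auto)
  qed
  then obtain s where "\<And>c x. c \<in> A \<Longrightarrow> x \<in> chart_image c \<Longrightarrow> \<alpha> c x = s" by blast
  then show ?thesis using ricci_form_imp_einstein[OF X assms(8), of s] \<alpha> by simp
qed

end
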